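(* Let $H_1,\dots,H_k$ be 2-connected graphs and let $\mathcal{G}=\mathrm{Ex}(H_1,\dots,H_k)$. Let $\Delta_n$ denote the maximum degree of a graph drawn uniformly at random from $\mathcal{G}_n$. Then: \begin{enumerate} \item If none of the $H_i$ is a minor of a fan graph $F_n$ (for any $n$), then there is a constant $c>0$ such that $\Delta_n \ge c\log n$ w.h.p. This holds in particular if all the $H_i$ are 3-connected or all the $H_i$ are not outerplanar. \item If all the $H_i$ contain $C_4$ as a minor, then for every $\epsilon>0$, $\Delta_n \ge (2-\epsilon)\frac{\log n}{\log\log n}$ w.h.p. \item If all the $H_i$ contain $C_5$ as a minor, then for every $\epsilon>0$, $\Delta_n \ge (1-\epsilon)\frac{\log n}{\log\log\log n}$ w.h.p. \item If all the $H_i$ contain $C_{2\ell+1}$ as a minor for some $\ell\ge 3$, then there is a constant $c>0$ such that $\Delta_n \ge c\frac{\log n}{\log^{(\ell+1)} n}$ w.h.p. \end{enumerate} In particular, since every 2-connected graph contains $C_3$ as a minor, $\Delta_n \ge c\log n/\log\log n$ always holds w.h.p. for some constant $c>0$.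
   Context: All graphs are labelled. For graphs $H_1,\dots,H_k$, $\mathrm{Ex}(H_1,\dots,H_k)$ is the class of (labelled) graphs containing none of $H_1,\dots,H_k$ as a minor; $\mathcal{G}_n$ denotes the graphs in $\mathcal{G}$ with vertex set $\{1,\dots,n\}$, and a random graph from $\mathcal{G}$ of size $n$ is drawn uniformly from $\mathcal{G}_n$. An event holds with high probability (w.h.p.) if its probability in $\mathcal{G}_n$ tends to $1$ as $n\to\infty$. The fan graph $F_n$ consists of a path on $n-1$ vertices plus one extra vertex adjacent to all vertices of the path. $C_m$ is the cycle of length $m$. $\log$ is the natural logarithm and $\log^{(j)} n$ denotes the logarithm iterated $j$ times. *)

theory Defs
  imports "HOL-Probability.Probability" "Graph_Theory.Digraph_Component"
begin

text \<open>
  A finite simple graph is a \<^locale>\<open>pair_graph\<close>: a finite, loop-free digraph whose set of arcs is a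
  symmetric relation. An undirected edge is thus a pair of opposite arcs, and the degree of a vertex
  is its out-degree. Both \<open>HOL-Analysis\<close> and \<open>Graph_Theory\<close> have a constant \<open>connected\<close>, hence the
  qualified name for the graph-theoretic one (which entails that there is at least one vertex).
\<close>

definition graph_of :: "'a set \<Rightarrow> 'a rel \<Rightarrow> 'a pair_pre_digraph" where
  "graph_of V E = \<lparr>pverts = V, parcs = E \<union> E\<inverse>\<rparr>"

text \<open>The vertex \<open>0\<close> is the extra vertex and \<open>1, \<dots>, n - 1\<close> is the path; it is meant for \<open>n \<ge> 2\<close>.\<close>

definition fan :: "nat \<Rightarrow> nat pair_pre_digraph" where
  "fan n = graph_of {0..<n}
     ({(i, i + 1) | i. 1 \<le> i \<and> i + 1 < n} \<union> {(0, i) | i. 1 \<le> i \<and> i < n})"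

text \<open>Meant for \<open>m \<ge> 3\<close>.\<close>

definition cycle_graph :: "nat \<Rightarrow> nat pair_pre_digraph" where
  "cycle_graph m = graph_of {0..<m} {(i, (i + 1) mod m) | i. i < m}"

definition induces_connected :: "'a pair_pre_digraph \<Rightarrow> 'a set \<Rightarrow> bool" where
  "induces_connected G B \<longleftrightarrow> Digraph_Component.connected (with_proj G \<restriction> B)"

text \<open>\<open>H\<close> is a minor of \<open>G\<close>: contracting the branch sets \<open>B v\<close> in a subgraph of \<open>G\<close> yields \<open>H\<close>.\<close>

definition minor :: "'a pair_pre_digraph \<Rightarrow> 'b pair_pre_digraph \<Rightarrow> bool" where
  "minor H G \<longleftrightarrow> (\<exists>B :: 'a \<Rightarrow> 'b set.
     (\<forall>v \<in> pverts H. B v \<subseteq> pverts G \<and> induces_connected G (B v)) \<and>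
     disjoint_family_on B (pverts H) \<and>
     (\<forall>(u, v) \<in> parcs H. \<exists>x \<in> B u. \<exists>y \<in> B v. (x, y) \<in> parcs G))"

definition k_connected :: "nat \<Rightarrow> 'a pair_pre_digraph \<Rightarrow> bool" where
  "k_connected k G \<longleftrightarrow> k < card (pverts G) \<and>
     (\<forall>X \<subseteq> pverts G. card X < k \<longrightarrow> induces_connected G (pverts G - X))"

text \<open>
  A drawing places the vertices at distinct points of the plane and represents each edge by a simple
  arc between its end vertices (the same point set for both orientations); edges meet vertices and
  each other only at common end vertices.
\<close>

definition plane_drawing ::
    "'a pair_pre_digraph \<Rightarrow> ('a \<Rightarrow> complex) \<Rightarrow> ('a \<times> 'a \<Rightarrow> real \<Rightarrow> complex) \<Rightarrow> bool" where
  "plane_drawing G p \<gamma> \<longleftrightarrow> inj_on p (pverts G) \<and>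
     (\<forall>(u, v) \<in> parcs G.
        arc (\<gamma> (u, v)) \<and> pathstart (\<gamma> (u, v)) = p u \<and> pathfinish (\<gamma> (u, v)) = p v \<and>
        path_image (\<gamma> (v, u)) = path_image (\<gamma> (u, v)) \<and>
        path_image (\<gamma> (u, v)) \<inter> p ` pverts G = {p u, p v}) \<and>
     (\<forall>(u, v) \<in> parcs G. \<forall>(x, y) \<in> parcs G. {u, v} \<noteq> {x, y} \<longrightarrow>
        path_image (\<gamma> (u, v)) \<inter> path_image (\<gamma> (x, y)) \<subseteq> p ` ({u, v} \<inter> {x, y}))"

definition drawing_set ::
    "'a pair_pre_digraph \<Rightarrow> ('a \<Rightarrow> complex) \<Rightarrow> ('a \<times> 'a \<Rightarrow> real \<Rightarrow> complex) \<Rightarrow> complex set" where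
  "drawing_set G p \<gamma> = p ` pverts G \<union> (\<Union>e \<in> parcs G. path_image (\<gamma> e))"

text \<open>The outer face is the unbounded component of the complement of the drawing.\<close>

definition outerplanar :: "'a pair_pre_digraph \<Rightarrow> bool" where
  "outerplanar G \<longleftrightarrow> (\<exists>p \<gamma>. plane_drawing G p \<gamma> \<and>
     p ` pverts G \<subseteq> frontier (outside (drawing_set G p \<gamma>)))"

definition excluded_minors :: "'a pair_pre_digraph list \<Rightarrow> nat pair_pre_digraph set" where
  "excluded_minors Hs = {G. pair_graph G \<and> (\<forall>H \<in> set Hs. \<not> minor H G)}"

definition of_size :: "nat pair_pre_digraph set \<Rightarrow> nat \<Rightarrow> nat pair_pre_digraph set" where
  "of_size \<G> n = {G \<in> \<G>. pverts G = {1..n}}"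

definition max_degree :: "'a pair_pre_digraph \<Rightarrow> nat" where
  "max_degree G = Max (out_degree (with_proj G) ` pverts G)"

definition whp ::
    "nat pair_pre_digraph set \<Rightarrow> (nat \<Rightarrow> nat pair_pre_digraph \<Rightarrow> bool) \<Rightarrow> bool" where
  "whp \<G> P \<longleftrightarrow>
     (\<lambda>n. measure_pmf.prob (pmf_of_set (of_size \<G> n)) {G. P n G}) \<longlonglongrightarrow> 1"

definition max_degree_ge_whp :: "nat pair_pre_digraph set \<Rightarrow> (nat \<Rightarrow> real) \<Rightarrow> bool" where
  "max_degree_ge_whp \<G> f \<longleftrightarrow> whp \<G> (\<lambda>n G. real (max_degree G) \<ge> f n)"

end

theory Submission
  imports Defs
begin

text \<open>
  The number of graphs in the class on \<open>n\<close> vertices grows at most like \<open>g n \<le> K n \<cdot> g (n - 1)\<close>: every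
  graph has linearly many vertices that can be contracted away or deleted so that boundedly many bits
  and one more label undo the removal (Norine, Seymour, Thomas and Wollan). On the other hand, as the
  excluded minors are 2-connected, a graph of the class on \<open>n\<close> vertices with all degrees below \<open>k\<close>
  stays in the class when the apex of a cone over a graph \<open>T\<close> with \<open>k\<close> new vertices is identified with
  one of its vertices, provided that the cone is in the class. This can be undone up to a factor
  exponential in \<open>k\<close>, so the proportion of graphs with maximum degree below \<open>k\<close> is at most
  \<open>M ^ k k! / (n t)\<close>, where \<open>t\<close> counts the labelled graphs \<open>T\<close> on \<open>k\<close> vertices. Paths, matchings, and
  forests of height \<open>l - 1\<close> have cones that are fans, have no \<open>C\<^sub>4\<close>, and have no \<open>C\<^bsub>2l+1\<^esub>\<close> minor,
  and counting them gives the four bounds.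
\<close>

section \<open>Connected sets and minors\<close>


text \<open>Gluing \<open>k\<close> new vertices compares graphs on \<open>n\<close> vertices with
  graphs on \<open>n + k\<close> vertices, so what enters is an upper bound
  \<open>K ^ k * (n + k)! / n!\<close> on the ratio of the two counts. The factorials cancel against
  the \<open>n + k choose k\<close> choices of the new labels, up to the \<open>k!\<close> that
  remains in the bound. The apex is not marked in the glued graph. Low degrees in the original graph
  are what makes it recognizable among few candidates, which is why exactly the low-degree graphs
  are extended. The bound is useful as long as \<open>M ^ k * k! / t\<close> is at most a power of
  \<open>n\<close> with exponent below \<open>1\<close>. For \<open>t = (k - 1)!\<close> this allows
  \<open>k\<close> of order log n. For \<open>t = (k / 2)!\<close> the quotient is about
  \<open>k ^ (k / 2)\<close>, the source of the constant 2. Forests with \<open>l\<close> levels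
  leave about \<open>exp (k * log^(l) k)\<close>, which becomes the \<open>(l + 1)\<close>-fold
  logarithm of \<open>n\<close> once \<open>k\<close> is near log n. Each case thus asks for as many
  bases as possible whose cone avoids the excluded minors.\<close>

lemma pair_graph_iff:
  "pair_graph G \<longleftrightarrow> finite (pverts G) \<and> parcs G \<subseteq> pverts G \<times> pverts G \<and> sym (parcs G) \<and> irrefl (parcs G)"
proof
  assume "pair_graph G"
  then interpret pair_graph G .
  show "finite (pverts G) \<and> parcs G \<subseteq> pverts G \<times> pverts G \<and> sym (parcs G) \<and> irrefl (parcs G)"
    using pair_finite_verts in_arcsD1 in_arcsD2 pair_sym_arcs pair_no_loops
    by (fastforce simp: symmetric_def irrefl_def)
next
  assume a: "finite (pverts G) \<and> parcs G \<subseteq> pverts G \<times> pverts G \<and> sym (parcs G) \<and> irrefl (parcs G)"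
  then have "finite (parcs G)" by (meson finite_SigmaI finite_subset)
  with a show "pair_graph G"
    by unfold_locales (auto simp: symmetric_def irrefl_def)
qed

text \<open>Connectivity for a bare relation, so that the arcs can be exchanged (subgraph,
  restriction, base of a cone) without building another graph.\<close>

definition conn :: "'a rel \<Rightarrow> 'a set \<Rightarrow> bool" where
  "conn E B \<longleftrightarrow> B \<noteq> {} \<and> (\<forall>x\<in>B. \<forall>y\<in>B. (x, y) \<in> (E \<inter> B \<times> B)\<^sup>*)"

lemma rtrancl_on_iff:
  assumes "x \<in> B"
  shows "(x, y) \<in> rtrancl_on B E \<longleftrightarrow> (x, y) \<in> (E \<inter> B \<times> B)\<^sup>*"
proof
  show "(x, y) \<in> rtrancl_on B E \<Longrightarrow> (x, y) \<in> (E \<inter> B \<times> B)\<^sup>*"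
    by (induction rule: rtrancl_on_induct) (auto intro: rtrancl_into_rtrancl)
  show "(x, y) \<in> (E \<inter> B \<times> B)\<^sup>* \<Longrightarrow> (x, y) \<in> rtrancl_on B E"
    by (induction rule: rtrancl_induct) (use assms in \<open>auto intro: rtrancl_on_into_rtrancl_on\<close>)
qed

lemma induces_connected_iff:
  assumes "pair_graph G"
  shows "induces_connected G B \<longleftrightarrow> conn (parcs G) B"
proof -
  have s: "sym (parcs G)" using assms by (simp add: pair_graph_iff)
  have "parcs (mk_symmetric (with_proj G \<restriction> B)) = parcs G \<inter> B \<times> B"
    using s by (auto simp: parcs_mk_symmetric dest: symD)
  then show ?thesis
    by (auto simp: induces_connected_def Digraph_Component.connected_def strongly_connected_def
        conn_def reachable_def rtrancl_on_iff)
qed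

text \<open>Connectivity is mostly used through cuts, with this as elimination rule and
  \<open>connI\<close> as introduction rule: a walk from \<open>x\<close> to \<open>z\<close> inside
  \<open>B\<close> has to leave \<open>X\<close> along some arc.\<close>

lemma connD:
  assumes "conn E B" "X \<subseteq> B" "x \<in> X" "z \<in> B - X"
  obtains u v where "u \<in> X" "v \<in> B - X" "(u, v) \<in> E"
proof -
  have "(x, z) \<in> (E \<inter> B \<times> B)\<^sup>*" using assms by (auto simp: conn_def)
  then have "z \<in> X \<or> (\<exists>u\<in>X. \<exists>v\<in>B - X. (u, v) \<in> E)"
    by (induction rule: rtrancl_induct) (use assms in auto)
  with assms that show thesis by blast
qed

text \<open>The vertices reachable from \<open>x\<close> inside \<open>B\<close> would form a cut
  without outgoing arc. Naming \<open>x\<close> and \<open>z\<close> in the premise makes both sides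
  of the cut nonempty.\<close>

lemma connI:
  assumes "sym E" "B \<noteq> {}"
    and cut: "\<And>X x z. \<lbrakk>X \<subseteq> B; x \<in> X; z \<in> B - X\<rbrakk> \<Longrightarrow> \<exists>u\<in>X. \<exists>v\<in>B - X. (u, v) \<in> E"
  shows "conn E B"
proof -
  have "(x, y) \<in> (E \<inter> B \<times> B)\<^sup>*" if "x \<in> B" "y \<in> B" for x y
  proof (rule ccontr)
    assume n: "(x, y) \<notin> (E \<inter> B \<times> B)\<^sup>*"
    define X where "X = {z \<in> B. (x, z) \<in> (E \<inter> B \<times> B)\<^sup>*}"
    have "\<exists>u\<in>X. \<exists>v\<in>B - X. (u, v) \<in> E"
      by (rule cut[of X x y]) (use that n in \<open>auto simp: X_def\<close>)
    then obtain u v where "u \<in> X" "v \<in> B" "v \<notin> X" "(u, v) \<in> E" by blast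
    then show False
      using rtrancl_into_rtrancl[of x u "E \<inter> B \<times> B" v] by (simp add: X_def)
  qed
  with assms(2) show ?thesis by (simp add: conn_def)
qed

lemma conn_singleton: "conn E {x}"
  by (auto simp: conn_def)

lemma conn_nonempty: "conn E B \<Longrightarrow> B \<noteq> {}"
  by (auto simp: conn_def)

lemma conn_mono:
  assumes "conn E B" "\<And>x y. \<lbrakk>x \<in> B; y \<in> B; (x, y) \<in> E\<rbrakk> \<Longrightarrow> (x, y) \<in> E'"
  shows "conn E' B"
proof -
  have "E \<inter> B \<times> B \<subseteq> E' \<inter> B \<times> B" using assms(2) by auto
  from rtrancl_mono[OF this] assms(1) show ?thesis unfolding conn_def by blast
qed

text \<open>A cut of the union either splits some \<open>C v\<close>, whose own connectivity gives
  the arc, or it is a union of whole pieces and induces a cut of \<open>B\<close>. This is the core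
  of the transitivity of minors.\<close>

lemma conn_UN:
  assumes "sym E'" "conn E B"
    and "\<And>v. v \<in> B \<Longrightarrow> conn E' (C v)"
    and "\<And>u v. \<lbrakk>u \<in> B; v \<in> B; (u, v) \<in> E\<rbrakk> \<Longrightarrow> \<exists>x\<in>C u. \<exists>y\<in>C v. (x, y) \<in> E'"
  shows "conn E' (\<Union>v\<in>B. C v)"
proof (rule connI[OF assms(1)])
  show "(\<Union>v\<in>B. C v) \<noteq> {}" using conn_nonempty[OF assms(2)] conn_nonempty[OF assms(3)] by blast
  fix X x z assume X: "X \<subseteq> (\<Union>v\<in>B. C v)" "x \<in> X" "z \<in> (\<Union>v\<in>B. C v) - X"
  show "\<exists>u\<in>X. \<exists>v\<in>(\<Union>v\<in>B. C v) - X. (u, v) \<in> E'"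
  proof (cases "\<exists>v\<in>B. C v \<inter> X \<noteq> {} \<and> C v - X \<noteq> {}")
    case True
    then obtain v a b where v: "v \<in> B" "a \<in> C v \<inter> X" "b \<in> C v - C v \<inter> X" by blast
    from connD[OF assms(3)[OF v(1)] _ v(2,3)] v show ?thesis by blast
  next
    case False
    define W where "W = {v \<in> B. C v \<inter> X \<noteq> {}}"
    have W: "C v \<subseteq> X" if "v \<in> W" for v using False that by (auto simp: W_def)
    obtain v where v: "v \<in> B" "x \<in> C v" using X by auto
    obtain w where w: "w \<in> B" "z \<in> C w" using X by auto
    have "v \<in> W" "w \<in> B - W" using v w X W by (auto simp: W_def)
    then obtain a b where ab: "a \<in> W" "b \<in> B - W" "(a, b) \<in> E"
      using connD[OF assms(2), of W v w] unfolding W_def by blast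
    then obtain p q where "p \<in> C a" "q \<in> C b" "(p, q) \<in> E'"
      using assms(4)[of a b] by (auto simp: W_def)
    moreover have "p \<in> X" using W[OF ab(1)] \<open>p \<in> C a\<close> by blast
    moreover have "q \<notin> X" using ab(2) \<open>q \<in> C b\<close> by (auto simp: W_def)
    ultimately show ?thesis using ab(2) by blast
  qed
qed

lemma minor_iff:
  assumes "pair_graph G"
  shows "minor H G \<longleftrightarrow> (\<exists>B. (\<forall>v \<in> pverts H. B v \<subseteq> pverts G \<and> conn (parcs G) (B v)) \<and>
     disjoint_family_on B (pverts H) \<and>
     (\<forall>(u, v) \<in> parcs H. \<exists>x \<in> B u. \<exists>y \<in> B v. (x, y) \<in> parcs G))"
  by (simp add: minor_def induces_connected_iff[OF assms])

lemma minorI: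
  assumes "pair_graph G"
    and "\<And>v. v \<in> pverts H \<Longrightarrow> B v \<subseteq> pverts G"
    and "\<And>v. v \<in> pverts H \<Longrightarrow> conn (parcs G) (B v)"
    and "\<And>u v. \<lbrakk>u \<in> pverts H; v \<in> pverts H; u \<noteq> v\<rbrakk> \<Longrightarrow> B u \<inter> B v = {}"
    and "\<And>u v. (u, v) \<in> parcs H \<Longrightarrow> \<exists>x \<in> B u. \<exists>y \<in> B v. (x, y) \<in> parcs G"
  shows "minor H G"
  unfolding minor_iff[OF assms(1)] using assms by (intro exI[of _ B]) (auto simp: disjoint_family_on_def)

lemma minorE:
  assumes "minor H G" "pair_graph G"
  obtains B where "\<And>v. v \<in> pverts H \<Longrightarrow> B v \<subseteq> pverts G"
    and "\<And>v. v \<in> pverts H \<Longrightarrow> conn (parcs G) (B v)"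
    and "\<And>u v. \<lbrakk>u \<in> pverts H; v \<in> pverts H; u \<noteq> v\<rbrakk> \<Longrightarrow> B u \<inter> B v = {}"
    and "\<And>u v. (u, v) \<in> parcs H \<Longrightarrow> \<exists>x \<in> B u. \<exists>y \<in> B v. (x, y) \<in> parcs G"
proof -
  from assms obtain B where B: "\<forall>v \<in> pverts H. B v \<subseteq> pverts G \<and> conn (parcs G) (B v)"
     "disjoint_family_on B (pverts H)"
     "\<forall>(u, v) \<in> parcs H. \<exists>x \<in> B u. \<exists>y \<in> B v. (x, y) \<in> parcs G"
    unfolding minor_iff[OF assms(2)] by blast
  show thesis by (rule that[of B]) (use B in \<open>auto simp: disjoint_family_on_def\<close>)
qed

lemma minor_trans:
  assumes "minor F H" "minor H G" "pair_graph H" "pair_graph G"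
  shows "minor F G"
proof -
  obtain B where B: "\<And>v. v \<in> pverts F \<Longrightarrow> B v \<subseteq> pverts H"
    "\<And>v. v \<in> pverts F \<Longrightarrow> conn (parcs H) (B v)"
    "\<And>u v. \<lbrakk>u \<in> pverts F; v \<in> pverts F; u \<noteq> v\<rbrakk> \<Longrightarrow> B u \<inter> B v = {}"
    "\<And>u v. (u, v) \<in> parcs F \<Longrightarrow> \<exists>x \<in> B u. \<exists>y \<in> B v. (x, y) \<in> parcs H"
    by (rule minorE[OF assms(1,3)], rule that)
  obtain C where C: "\<And>v. v \<in> pverts H \<Longrightarrow> C v \<subseteq> pverts G"
    "\<And>v. v \<in> pverts H \<Longrightarrow> conn (parcs G) (C v)"
    "\<And>u v. \<lbrakk>u \<in> pverts H; v \<in> pverts H; u \<noteq> v\<rbrakk> \<Longrightarrow> C u \<inter> C v = {}"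
    "\<And>u v. (u, v) \<in> parcs H \<Longrightarrow> \<exists>x \<in> C u. \<exists>y \<in> C v. (x, y) \<in> parcs G"
    by (rule minorE[OF assms(2,4)], rule that)
  have s: "sym (parcs G)" using assms(4) by (simp add: pair_graph_iff)
  show ?thesis
  proof (rule minorI[OF assms(4), of _ "\<lambda>v. \<Union>w\<in>B v. C w"])
    fix v assume v: "v \<in> pverts F"
    show "(\<Union>w\<in>B v. C w) \<subseteq> pverts G" using B(1)[OF v] C(1) by blast
    show "conn (parcs G) (\<Union>w\<in>B v. C w)"
      by (rule conn_UN[OF s B(2)[OF v]]) (use B(1)[OF v] C in blast)+
  next
    fix u v assume uv: "u \<in> pverts F" "v \<in> pverts F" "u \<noteq> v"
    have "C a \<inter> C b = {}" if "a \<in> B u" "b \<in> B v" for a b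
      using that B(1)[OF uv(1)] B(1)[OF uv(2)] B(3)[OF uv] by (intro C(3)) auto
    then show "(\<Union>w\<in>B u. C w) \<inter> (\<Union>w\<in>B v. C w) = {}" by blast
  next
    fix u v assume "(u, v) \<in> parcs F"
    then show "\<exists>x\<in>\<Union>w\<in>B u. C w. \<exists>y\<in>\<Union>w\<in>B v. C w. (x, y) \<in> parcs G"
      using B(4) C(4) by (metis UN_I)
  qed
qed

lemma minor_embed:
  assumes "pair_graph G" "inj_on f (pverts H)" "f ` pverts H \<subseteq> pverts G"
    and "\<And>u v. (u, v) \<in> parcs H \<Longrightarrow> (f u, f v) \<in> parcs G"
  shows "minor H G"
  by (rule minorI[OF assms(1), of _ "\<lambda>v. {f v}"])
    (use assms in \<open>auto simp: conn_singleton inj_on_def\<close>)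

lemma minor_subgraph:
  assumes "pair_graph G" "pverts H \<subseteq> pverts G" "parcs H \<subseteq> parcs G"
  shows "minor H G"
  by (rule minor_embed[OF assms(1), of id]) (use assms in auto)

text \<open>The merged vertex keeps the label \<open>p\<close>, so the vertex set loses exactly the
  label \<open>u\<close>; this is what makes the count over label sets recursive.\<close>

definition contract :: "'a \<Rightarrow> 'a \<Rightarrow> 'a pair_pre_digraph \<Rightarrow> 'a pair_pre_digraph" where
  "contract u p G = \<lparr>pverts = pverts G - {u},
     parcs = {(x, y) \<in> parcs G. x \<noteq> u \<and> y \<noteq> u} \<union>
       {(p, y) | y. (u, y) \<in> parcs G \<and> y \<noteq> p} \<union> {(x, p) | x. (x, u) \<in> parcs G \<and> x \<noteq> p}\<rparr>"

lemma pair_graph_contract: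
  assumes "pair_graph G" "(u, p) \<in> parcs G"
  shows "pair_graph (contract u p G)"
  using assms unfolding pair_graph_iff contract_def
  by (auto simp: sym_def irrefl_def)

lemma minor_contract:
  assumes "pair_graph G" "(u, p) \<in> parcs G"
  shows "minor (contract u p G) G"
proof (rule minorI[OF assms(1), of _ "\<lambda>v. if v = p then {u, p} else {v}"])
  have G: "parcs G \<subseteq> pverts G \<times> pverts G" "sym (parcs G)" "irrefl (parcs G)"
    using assms(1) by (auto simp: pair_graph_iff)
  have up: "conn (parcs G) {u, p}"
    by (rule connI[OF G(2)]) (use assms(2) symD[OF G(2) assms(2)] in \<open>auto simp: insert_Diff_if\<close>)
  show "conn (parcs G) (if v = p then {u, p} else {v})" for v
    using up by (auto simp: conn_singleton)
  show "(if v = p then {u, p} else {v}) \<subseteq> pverts G" if "v \<in> pverts (contract u p G)" for v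
    using that assms(2) G by (auto simp: contract_def)
  show "(if v = p then {u, p} else {v}) \<inter> (if w = p then {u, p} else {w}) = {}"
    if "v \<in> pverts (contract u p G)" "w \<in> pverts (contract u p G)" "v \<noteq> w" for v w
    using that by (auto simp: contract_def)
  show "\<exists>x\<in>if v = p then {u, p} else {v}. \<exists>y\<in>if w = p then {u, p} else {w}. (x, y) \<in> parcs G"
    if "(v, w) \<in> parcs (contract u p G)" for v w
    using that by (auto simp: contract_def)
qed

definition restr :: "'a pair_pre_digraph \<Rightarrow> 'a set \<Rightarrow> 'a pair_pre_digraph" where
  "restr G X = \<lparr>pverts = X, parcs = parcs G \<inter> X \<times> X\<rparr>"

lemma restr_simps [simp]: "pverts (restr G X) = X" "parcs (restr G X) = parcs G \<inter> X \<times> X"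
  by (auto simp: restr_def)

lemma pair_graph_restr:
  assumes "pair_graph G" "X \<subseteq> pverts G"
  shows "pair_graph (restr G X)"
  using assms finite_subset[OF assms(2)] by (auto simp: pair_graph_iff sym_def irrefl_def)

lemma minor_restr:
  assumes "pair_graph G" "X \<subseteq> pverts G"
  shows "minor (restr G X) G"
  by (rule minor_subgraph[OF assms(1)]) (use assms in auto)

definition relabel :: "('a \<Rightarrow> 'b) \<Rightarrow> 'a pair_pre_digraph \<Rightarrow> 'b pair_pre_digraph" where
  "relabel f G = \<lparr>pverts = f ` pverts G, parcs = map_prod f f ` parcs G\<rparr>"

lemma relabel_simps [simp]:
  "pverts (relabel f G) = f ` pverts G" "parcs (relabel f G) = map_prod f f ` parcs G"
  by (auto simp: relabel_def)

lemma pair_graph_relabel: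
  assumes "pair_graph G" "inj_on f (pverts G)"
  shows "pair_graph (relabel f G)"
proof -
  have G: "finite (pverts G)" "parcs G \<subseteq> pverts G \<times> pverts G" "sym (parcs G)" "irrefl (parcs G)"
    using assms by (auto simp: pair_graph_iff)
  have "sym (map_prod f f ` parcs G)"
    using G(3) by (fastforce simp: sym_def)
  moreover have "irrefl (map_prod f f ` parcs G)"
    using G(2,4) assms(2) by (fastforce simp: irrefl_def inj_on_def)
  ultimately show ?thesis using G by (auto simp: pair_graph_iff)
qed

lemma relabel_relabel:
  assumes "pair_graph G" "\<And>x. x \<in> pverts G \<Longrightarrow> g (f x) = x"
  shows "relabel g (relabel f G) = G"
proof -
  have "parcs G \<subseteq> pverts G \<times> pverts G" using assms by (auto simp: pair_graph_iff)
  then have "map_prod g g ` map_prod f f ` parcs G = parcs G"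
    using assms(2) by (simp add: image_image prod.map_comp) (auto simp: subset_iff image_iff split_paired_all)
  moreover have "g ` f ` pverts G = pverts G" using assms(2) by (force simp: image_image)
  ultimately show ?thesis by (simp add: relabel_def)
qed

lemma minor_relabel:
  assumes "pair_graph G" "inj_on f (pverts G)"
  shows "minor H (relabel f G) \<longleftrightarrow> minor H G"
proof
  have 1: "minor G (relabel f G)"
    by (rule minor_embed[OF pair_graph_relabel[OF assms] assms(2)]) auto
  have G: "parcs G \<subseteq> pverts G \<times> pverts G" using assms by (auto simp: pair_graph_iff)
  have 2: "minor (relabel f G) G"
    by (rule minor_embed[OF assms(1), of "inv_into (pverts G) f"])
      (use assms G in \<open>auto simp: inj_on_inv_into dest!: subsetD\<close>)
  show "minor H (relabel f G) \<Longrightarrow> minor H G"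
    using minor_trans[OF _ 2] assms pair_graph_relabel by blast
  show "minor H G \<Longrightarrow> minor H (relabel f G)"
    using minor_trans[OF _ 1] assms pair_graph_relabel by blast
qed

definition nb :: "'a rel \<Rightarrow> 'a \<Rightarrow> 'a set" where
  "nb E v = {w. (v, w) \<in> E}"

lemma mem_nb [simp]: "w \<in> nb E v \<longleftrightarrow> (v, w) \<in> E"
  by (simp add: nb_def)

lemma finite_nb: "pair_graph G \<Longrightarrow> finite (nb (parcs G) v)"
  by (rule finite_subset[of _ "pverts G"]) (auto simp: pair_graph_iff)

lemma out_degree_eq: "out_degree (with_proj G) v = card (nb (parcs G) v)"
proof -
  have "out_arcs (with_proj G) v = Pair v ` nb (parcs G) v"
    by (auto simp: out_arcs_def)
  then show ?thesis by (simp add: out_degree_def card_image inj_on_def)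
qed

lemma finite_parcs: "pair_graph G \<Longrightarrow> finite (parcs G)"
  unfolding pair_graph_iff by (meson finite_SigmaI finite_subset)

lemma card_parcs:
  assumes "pair_graph G"
  shows "card (parcs G) = (\<Sum>v\<in>pverts G. card (nb (parcs G) v))"
proof -
  have "parcs G = (SIGMA v:pverts G. nb (parcs G) v)"
    using assms by (auto simp: pair_graph_iff)
  then have "card (parcs G) = card (SIGMA v:pverts G. nb (parcs G) v)" by simp
  also have "\<dots> = (\<Sum>v\<in>pverts G. card (nb (parcs G) v))"
    using assms by (subst card_SigmaI) (auto simp: finite_nb pair_graph_iff)
  finally show ?thesis .
qed


section \<open>Sparsity of graphs without a complete minor\<close>

definition complete_on :: "nat \<Rightarrow> nat pair_pre_digraph" where
  "complete_on t = \<lparr>pverts = {0..<t}, parcs = {(i, j). i < t \<and> j < t \<and> i \<noteq> j}\<rparr>"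

text \<open>Contraction loses the two arcs between \<open>u\<close> and \<open>p\<close> and, for
  every common neighbour, a pair of arcs that becomes parallel to another pair. A neighbour of
  \<open>u\<close> alone merely changes its partner.\<close>

lemma card_parcs_contract:
  assumes "pair_graph G" "(u, p) \<in> parcs G"
  shows "card (parcs G) \<le> card (parcs (contract u p G)) + 2 * card (nb (parcs G) u \<inter> nb (parcs G) p) + 2"
proof -
  let ?N = "nb (parcs G)"
  define A where "A = {(x, y) \<in> parcs G. x \<noteq> u \<and> y \<noteq> u}"
  define Q where "Q = ?N u - ?N p - {p}"
  have G: "sym (parcs G)" "irrefl (parcs G)" using assms by (auto simp: pair_graph_iff)
  have fin: "finite (parcs G)" "finite (?N u)" "finite (?N p)"
    using assms finite_parcs finite_nb by auto
  have fA: "finite A" by (rule finite_subset[OF _ fin(1)]) (auto simp: A_def)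
  have fQ: "finite Q" using fin by (auto simp: Q_def)
  have "parcs G \<subseteq> A \<union> {u} \<times> ?N u \<union> ?N u \<times> {u}"
    using symD[OF G(1)] by (auto simp: A_def)
  then have "card (parcs G) \<le> card (A \<union> {u} \<times> ?N u \<union> ?N u \<times> {u})"
    using fA fin by (intro card_mono) auto
  also have "\<dots> \<le> card (A \<union> {u} \<times> ?N u) + card (?N u \<times> {u})" by (rule card_Un_le)
  also have "\<dots> \<le> card A + card ({u} \<times> ?N u) + card (?N u \<times> {u})"
    using card_Un_le[of A "{u} \<times> ?N u"] by simp
  also have "\<dots> = card A + 2 * card (?N u)" by (simp add: card_cartesian_product)
  finally have 1: "card (parcs G) \<le> card A + 2 * card (?N u)" .
  have "?N u = insert p (Q \<union> (?N u \<inter> ?N p))" using assms(2) by (auto simp: Q_def)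
  then have "card (?N u) = card (insert p (Q \<union> (?N u \<inter> ?N p)))" by simp
  also have "\<dots> = Suc (card (Q \<union> (?N u \<inter> ?N p)))"
    by (rule card_insert_disjoint) (use fin fQ G(2) in \<open>auto simp: Q_def irrefl_def\<close>)
  also have "card (Q \<union> (?N u \<inter> ?N p)) = card Q + card (?N u \<inter> ?N p)"
    by (rule card_Un_disjoint) (use fin fQ in \<open>auto simp: Q_def\<close>)
  finally have 2: "card (?N u) = Suc (card Q + card (?N u \<inter> ?N p))" .
  have pA: "(p, q) \<notin> A" "(q, p) \<notin> A" if "q \<in> Q" for q
    using that symD[OF G(1)] by (auto simp: A_def Q_def)
  have pQ: "p \<notin> Q" by (simp add: Q_def)
  have "card A + card Q + card Q = card (A \<union> {p} \<times> Q \<union> Q \<times> {p})"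
  proof -
    have "card (A \<union> {p} \<times> Q \<union> Q \<times> {p}) = card (A \<union> {p} \<times> Q) + card (Q \<times> {p})"
      by (rule card_Un_disjoint) (use fA fQ pA pQ in auto)
    moreover have "card (A \<union> {p} \<times> Q) = card A + card ({p} \<times> Q)"
      by (rule card_Un_disjoint) (use fA fQ pA in auto)
    ultimately show ?thesis by (simp add: card_cartesian_product)
  qed
  also have "\<dots> \<le> card (parcs (contract u p G))"
  proof (rule card_mono)
    show "finite (parcs (contract u p G))"
      by (rule finite_parcs[OF pair_graph_contract[OF assms]])
    show "A \<union> {p} \<times> Q \<union> Q \<times> {p} \<subseteq> parcs (contract u p G)"
      using symD[OF G(1)] by (auto simp: A_def Q_def contract_def)
  qed
  finally show ?thesis using 1 2 by simp
qed

text \<open>Mader: either some edge can be contracted without lowering the density, or the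
  neighbourhood of a vertex has half the density of the graph.\<close>

lemma dense_complete_minor:
  assumes "pair_graph G" "pverts G \<noteq> {}" "2 * 2 ^ t * card (pverts G) \<le> card (parcs G)"
  shows "minor (complete_on t) G"
  using assms
proof (induction t arbitrary: G)
  case 0
  then show ?case by (intro minorI) (auto simp: complete_on_def)
next
  case (Suc t)
  \<comment> \<open>The threshold is \<open>2 * c\<close> arcs per vertex: contracting an edge with
    fewer than \<open>c\<close> common neighbours costs one vertex and at most \<open>2 * c\<close>
    arcs, so the density survives.\<close>
  define c where "c = (2::nat) ^ Suc t"
  have "minor (complete_on (Suc t)) G" if "pair_graph G" "pverts G \<noteq> {}" "2 * c * card (pverts G) \<le> card (parcs G)"
    using that
  proof (induction "card (pverts G)" arbitrary: G rule: less_induct)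
    case less
    let ?N = "nb (parcs G)"
    have G: "finite (pverts G)" "sym (parcs G)" "irrefl (parcs G)" "parcs G \<subseteq> pverts G \<times> pverts G"
      using less.prems(1) by (auto simp: pair_graph_iff)
    show ?case
    proof (cases "\<exists>(u, p)\<in>parcs G. card (?N u \<inter> ?N p) + 1 \<le> c")
      case True
      then obtain u p where up: "(u, p) \<in> parcs G" "card (?N u \<inter> ?N p) + 1 \<le> c" by blast
      let ?G = "contract u p G"
      have u: "u \<in> pverts G" "p \<in> pverts G" "u \<noteq> p" using up G by (auto simp: irrefl_def)
      have cV: "card (pverts G) = Suc (card (pverts ?G))"
        using u G(1) by (simp add: contract_def card_Suc_Diff1 del: card_Diff_insert)
      have "2 * c * card (pverts G) \<le> card (parcs ?G) + 2 * c"
        using card_parcs_contract[OF less.prems(1) up(1)] up(2) less.prems(3) by linarith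
      then have "2 * c * card (pverts ?G) \<le> card (parcs ?G)" by (simp add: cV)
      moreover have "pverts ?G \<noteq> {}" using u by (auto simp: contract_def)
      ultimately have "minor (complete_on (Suc t)) ?G"
        using less.hyps[of ?G] pair_graph_contract[OF less.prems(1) up(1)] cV by simp
      then show ?thesis
        by (rule minor_trans[OF _ minor_contract[OF less.prems(1) up(1)]
              pair_graph_contract[OF less.prems(1) up(1)] less.prems(1)])
    next
      case False
      have "0 < c" by (simp add: c_def)
      moreover have "0 < card (pverts G)" using less.prems(2) G(1) by (simp add: card_gt_0_iff)
      ultimately have "0 < 2 * c * card (pverts G)" by simp
      then have "0 < card (parcs G)" using less.prems(3) by linarith
      then have "parcs G \<noteq> {}" by auto
      then obtain x y where xy: "(x, y) \<in> parcs G" by auto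
      \<comment> \<open>Each neighbour of \<open>x\<close> shares at least \<open>c\<close>
        neighbours with \<open>x\<close>, so the neighbourhood has at least
        \<open>c = 2 * 2 ^ t\<close> arcs per vertex, the threshold for \<open>t\<close>. The
        additional branch set will be \<open>{x}\<close>.\<close>
      let ?H = "restr G (?N x)"
      have NV: "?N x \<subseteq> pverts G" using G(4) by auto
      have H: "pair_graph ?H" using pair_graph_restr[OF less.prems(1) NV] .
      have fN: "finite (?N x)" using finite_nb[OF less.prems(1)] .
      have "c * card (?N x) = (\<Sum>z\<in>?N x. c)" by simp
      also have "\<dots> \<le> (\<Sum>z\<in>?N x. card (nb (parcs ?H) z))"
      proof (rule sum_mono)
        fix z assume z: "z \<in> ?N x"
        then have "nb (parcs ?H) z = ?N x \<inter> ?N z" by auto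
        moreover have "c \<le> card (?N x \<inter> ?N z)" using False z by fastforce
        ultimately show "c \<le> card (nb (parcs ?H) z)" by simp
      qed
      also have "\<dots> = card (parcs ?H)" using card_parcs[OF H] by simp
      finally have "2 * 2 ^ t * card (pverts ?H) \<le> card (parcs ?H)" by (simp add: c_def)
      moreover have "pverts ?H \<noteq> {}" using xy by auto
      ultimately have mH: "minor (complete_on t) ?H" by (intro Suc.IH[OF H])
      obtain B where B: "\<And>v. v \<in> pverts (complete_on t) \<Longrightarrow> B v \<subseteq> pverts ?H"
        "\<And>v. v \<in> pverts (complete_on t) \<Longrightarrow> conn (parcs ?H) (B v)"
        "\<And>u v. \<lbrakk>u \<in> pverts (complete_on t); v \<in> pverts (complete_on t); u \<noteq> v\<rbrakk> \<Longrightarrow> B u \<inter> B v = {}"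
        "\<And>u v. (u, v) \<in> parcs (complete_on t) \<Longrightarrow> \<exists>x\<in>B u. \<exists>y\<in>B v. (x, y) \<in> parcs ?H"
        by (rule minorE[OF mH H], rule that)
      define C where "C = (\<lambda>i. if i = t then {x} else B i)"
      have BC: "C i = B i" "B i \<subseteq> ?N x" "B i \<noteq> {}" "conn (parcs G) (B i)" if "i < t" for i
      proof -
        have i: "i \<in> pverts (complete_on t)" using that by (simp add: complete_on_def)
        show "C i = B i" "B i \<subseteq> ?N x" "B i \<noteq> {}"
          using B(1)[OF i] conn_nonempty[OF B(2)[OF i]] that by (auto simp: C_def)
        show "conn (parcs G) (B i)" using B(2)[OF i] by (rule conn_mono) auto
      qed
      have xN: "x \<notin> ?N x" using G(3) by (auto simp: irrefl_def)
      have xB: "x \<notin> B i" if "i < t" for i using BC(2)[OF that] xN by blast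
      show ?thesis
      proof (rule minorI[OF less.prems(1), of _ C])
        fix v assume v: "v \<in> pverts (complete_on (Suc t))"
        show "C v \<subseteq> pverts G"
        proof (cases "v = t")
          case True then show ?thesis using xy G(4) by (auto simp: C_def)
        next
          case False then have "v < t" using v by (auto simp: complete_on_def)
          then show ?thesis using BC NV by blast
        qed
        show "conn (parcs G) (C v)"
          using v BC by (cases "v = t") (auto simp: C_def conn_singleton complete_on_def)
      next
        fix u v assume uv: "u \<in> pverts (complete_on (Suc t))" "v \<in> pverts (complete_on (Suc t))" "u \<noteq> v"
        have "u < t \<or> u = t" "v < t \<or> v = t" using uv by (auto simp: complete_on_def)
        then show "C u \<inter> C v = {}"
          using B(3)[of u v] xB[of u] xB[of v] uv(3) by (auto simp: C_def complete_on_def)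
      next
        fix u v assume uv: "(u, v) \<in> parcs (complete_on (Suc t))"
        then have "u < t \<and> v < t \<or> u = t \<and> v < t \<or> u < t \<and> v = t" "u \<noteq> v" by (auto simp: complete_on_def)
        then consider "u < t" "v < t" "u \<noteq> v" | "u = t" "v < t" | "u < t" "v = t" by blast
        then show "\<exists>x\<in>C u. \<exists>y\<in>C v. (x, y) \<in> parcs G"
        proof cases
          case 1
          then show ?thesis using B(4)[of u v] BC(1) by (auto simp: complete_on_def)
        next
          case 2
          then obtain z where "z \<in> B v" using BC(3) by auto
          then show ?thesis using 2 BC[OF 2(2)] by (auto simp: C_def)
        next
          case 3
          then obtain z where z: "z \<in> B u" using BC(3) by auto
          then have "(x, z) \<in> parcs G" using BC(2)[OF 3(1)] by auto
          then have "(z, x) \<in> parcs G" using symD[OF G(2)] by blast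
          then show ?thesis using 3 BC(1)[OF 3(1)] z by (auto simp: C_def)
        qed
      qed
    qed
  qed
  then show ?case using Suc.prems by (simp add: c_def)
qed

lemma card_parcs_le:
  assumes "pair_graph G" "\<not> minor (complete_on t) G"
  shows "card (parcs G) \<le> 2 * 2 ^ t * card (pverts G)"
proof (cases "pverts G = {}")
  case True
  then show ?thesis using assms(1) by (auto simp: pair_graph_iff)
next
  case False
  then show ?thesis using dense_complete_minor[OF assms(1)] assms(2) by (meson nat_le_linear)
qed

text \<open>Sparsity of all subsets yields a vertex \<open>v\<close> with at most \<open>d\<close>
  neighbours. At most \<open>2 ^ d\<close> cliques contain \<open>v\<close>, and the others live in
  \<open>V - {v}\<close>; the summand \<open>1\<close> is the empty clique.\<close>

lemma card_cliques_le:
  assumes "finite V" "\<And>X. X \<subseteq> V \<Longrightarrow> card (E \<inter> X \<times> X) \<le> d * card X"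
  shows "card {Q. Q \<subseteq> V \<and> (\<forall>x\<in>Q. \<forall>y\<in>Q. x \<noteq> y \<longrightarrow> (x, y) \<in> E)} \<le> 2 ^ d * card V + 1"
  using assms
proof (induction "card V" arbitrary: V)
  case 0
  then have "{Q. Q \<subseteq> V \<and> (\<forall>x\<in>Q. \<forall>y\<in>Q. x \<noteq> y \<longrightarrow> (x, y) \<in> E)} = {{}}" by auto
  then show ?case by simp
next
  case (Suc n)
  let ?K = "\<lambda>V. {Q. Q \<subseteq> V \<and> (\<forall>x\<in>Q. \<forall>y\<in>Q. x \<noteq> y \<longrightarrow> (x, y) \<in> E)}"
  have "\<exists>v\<in>V. card (nb E v \<inter> V) \<le> d"
  proof (rule ccontr)
    assume "\<not> ?thesis"
    then have *: "d + 1 \<le> card (nb E v \<inter> V)" if "v \<in> V" for v using that by fastforce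
    have "E \<inter> V \<times> V = (SIGMA v:V. nb E v \<inter> V)" by auto
    then have "card (E \<inter> V \<times> V) = (\<Sum>v\<in>V. card (nb E v \<inter> V))"
      using Suc.prems(1) by (simp add: card_SigmaI)
    also have "\<dots> \<ge> (\<Sum>v\<in>V. d + 1)" by (rule sum_mono) (rule *)
    finally have "(d + 1) * card V \<le> d * card V" using Suc.prems(2)[of V] by (simp add: mult.commute)
    then show False using Suc.hyps(2) by simp
  qed
  then obtain v where v: "v \<in> V" "card (nb E v \<inter> V) \<le> d" by blast
  have V: "card (V - {v}) = n" using v Suc.hyps(2) Suc.prems(1) by simp
  have "?K V \<subseteq> ?K (V - {v}) \<union> insert v ` Pow (nb E v \<inter> V)"
  proof
    fix Q assume Q: "Q \<in> ?K V"
    show "Q \<in> ?K (V - {v}) \<union> insert v ` Pow (nb E v \<inter> V)"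
    proof (cases "v \<in> Q")
      case True
      have "Q - {v} \<subseteq> nb E v \<inter> V"
      proof
        fix x assume x: "x \<in> Q - {v}"
        then have "v \<noteq> x" "x \<in> Q" by auto
        then show "x \<in> nb E v \<inter> V" using Q True by auto
      qed
      moreover have "Q = insert v (Q - {v})" using True by auto
      ultimately show ?thesis by blast
    next
      case False
      then show ?thesis using Q by blast
    qed
  qed
  then have "card (?K V) \<le> card (?K (V - {v}) \<union> insert v ` Pow (nb E v \<inter> V))"
    using Suc.prems(1) by (intro card_mono) auto
  also have "\<dots> \<le> card (?K (V - {v})) + card (insert v ` Pow (nb E v \<inter> V))" by (rule card_Un_le)
  also have "card (?K (V - {v})) \<le> 2 ^ d * card (V - {v}) + 1"
  proof (rule Suc.hyps(1))
    show "card (E \<inter> X \<times> X) \<le> d * card X" if "X \<subseteq> V - {v}" for X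
      using Suc.prems(2)[of X] that by blast
  qed (use V Suc.prems(1) in auto)
  also have "card (insert v ` Pow (nb E v \<inter> V)) \<le> card (Pow (nb E v \<inter> V))"
    using Suc.prems(1) by (intro card_image_le) auto
  also have "\<dots> = 2 ^ card (nb E v \<inter> V)" by (rule card_Pow) (use Suc.prems(1) in simp)
  also have "\<dots> \<le> 2 ^ d" using v(2) by simp
  finally show ?case using V Suc.hyps(2)[symmetric] by (simp add: algebra_simps)
qed

text \<open>If some \<open>v\<close> in \<open>L\<close> has nonadjacent neighbours \<open>x\<close>
  and \<open>y\<close>, contracting \<open>v\<close> into \<open>x\<close> creates the edge between
  them inside \<open>B\<close>, that is two arcs, and destroys at most one neighbourhood; with the
  weight 2 the left side does not drop. When no such \<open>v\<close> is left, every neighbourhood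
  is a clique in the sparse graph on \<open>B\<close>, and \<open>card_cliques_le\<close> applies
  with \<open>d = 2 * C\<close>.\<close>

lemma card_nbhds_le:
  fixes G :: "'a pair_pre_digraph"
  assumes "pair_graph G" "pverts G = B \<union> L" "B \<inter> L = {}" "parcs G \<inter> L \<times> L = {}"
    and "\<not> minor (complete_on t) G"
  defines "C \<equiv> (2::nat) ^ t"
  shows "2 * card (nb (parcs G) ` L) + card (parcs G \<inter> B \<times> B) \<le> 2 * C * card B + 2 * (2 ^ (2 * C) * card B + 1)"
  using assms(1-5)
proof (induction "card L" arbitrary: G L rule: less_induct)
  case less
  let ?E = "parcs G"
  have G: "finite (pverts G)" "sym ?E" "irrefl ?E" "?E \<subseteq> pverts G \<times> pverts G"
    using less.prems(1) by (auto simp: pair_graph_iff)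
  have fin: "finite B" "finite L" using G(1) less.prems(2) by auto
  have NB: "nb ?E v \<subseteq> B" if "v \<in> L" for v
    using that less.prems(2,4) G(4) unfolding nb_def by blast
  show ?case
  proof (cases "\<exists>v\<in>L. \<exists>x\<in>nb ?E v. \<exists>y\<in>nb ?E v. x \<noteq> y \<and> (x, y) \<notin> ?E")
    case True
    then obtain v x y where v: "v \<in> L" "(v, x) \<in> ?E" "(v, y) \<in> ?E" "x \<noteq> y" "(x, y) \<notin> ?E" by auto
    let ?G = "contract v x G"
    have xy: "x \<in> B" "y \<in> B" using NB[OF v(1)] v by auto
    have vB: "v \<notin> B" using v(1) less.prems(3) by auto
    have PG: "pair_graph ?G" by (rule pair_graph_contract[OF less.prems(1) v(2)])
    have nb: "nb (parcs ?G) w = nb ?E w" if "w \<in> L - {v}" for w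
    proof -
      have "(w, v) \<notin> ?E" using that v(1) less.prems(4) by auto
      moreover have "w \<noteq> x" using that xy less.prems(3) by auto
      ultimately show ?thesis using that by (auto simp: contract_def)
    qed
    have noL: "parcs ?G \<inter> (L - {v}) \<times> (L - {v}) = {}"
    proof -
      have "(w, y) \<in> ?E" if "w \<in> L - {v}" "(w, y) \<in> parcs ?G" for w y
        using nb[OF that(1)] that(2) by (metis mem_nb)
      with less.prems(4) show ?thesis by blast
    qed
    have "2 * card (nb (parcs ?G) ` (L - {v})) + card (parcs ?G \<inter> B \<times> B)
        \<le> 2 * C * card B + 2 * (2 ^ (2 * C) * card B + 1)"
    proof (rule less.hyps)
      show "card (L - {v}) < card L" using v(1) fin(2) by (meson card_Diff1_less)
      show "pverts ?G = B \<union> (L - {v})" using less.prems(2) vB by (auto simp: contract_def)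
      show "\<not> minor (complete_on t) ?G"
        using less.prems(5) minor_trans[OF _ minor_contract[OF less.prems(1) v(2)] PG less.prems(1)] by blast
    qed (use PG noL less.prems(3) in auto)
    moreover have "nb (parcs ?G) ` (L - {v}) = nb ?E ` (L - {v})" using nb by (rule image_cong[OF refl])
    moreover have "card (nb ?E ` L) \<le> card (nb ?E ` (L - {v})) + 1"
    proof -
      have "nb ?E ` L \<subseteq> insert (nb ?E v) (nb ?E ` (L - {v}))" by auto
      then have "card (nb ?E ` L) \<le> card (insert (nb ?E v) (nb ?E ` (L - {v})))"
        using fin(2) by (intro card_mono) auto
      also have "\<dots> \<le> card (nb ?E ` (L - {v})) + 1" by (simp add: card_insert_if fin(2))
      finally show ?thesis .
    qed
    moreover have "card (?E \<inter> B \<times> B) + 2 \<le> card (parcs ?G \<inter> B \<times> B)"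
    proof -
      have fE: "finite (?E \<inter> B \<times> B)" using finite_parcs[OF less.prems(1)] by auto
      have yx: "(y, x) \<notin> ?E" using v(5) symD[OF G(2)] by auto
      have "card (insert (x, y) (insert (y, x) (?E \<inter> B \<times> B))) = card (?E \<inter> B \<times> B) + 2"
        using fE v(4,5) yx by simp
      moreover have "insert (x, y) (insert (y, x) (?E \<inter> B \<times> B)) \<subseteq> parcs ?G \<inter> B \<times> B"
        using v xy vB symD[OF G(2)] by (auto simp: contract_def)
      moreover have "finite (parcs ?G \<inter> B \<times> B)" using finite_parcs[OF PG] by auto
      ultimately show ?thesis using card_mono by metis
    qed
    ultimately have "card (nb ?E ` L) \<le> card (nb (parcs ?G) ` (L - {v})) + 1" by simp
    with \<open>card (?E \<inter> B \<times> B) + 2 \<le> _\<close> \<open>2 * card (nb (parcs ?G) ` (L - {v})) + _ \<le> _\<close>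
    show ?thesis by linarith
  next
    case False
    have sub: "card (?E \<inter> X \<times> X) \<le> 2 * C * card X" if "X \<subseteq> B" for X
    proof -
      have X: "X \<subseteq> pverts G" using that less.prems(2) by auto
      have "\<not> minor (complete_on t) (restr G X)"
        using less.prems(5) minor_trans[OF _ minor_restr[OF less.prems(1) X] pair_graph_restr[OF less.prems(1) X] less.prems(1)] by blast
      from card_parcs_le[OF pair_graph_restr[OF less.prems(1) X] this] show ?thesis by (simp add: C_def)
    qed
    have "nb ?E ` L \<subseteq> {Q. Q \<subseteq> B \<and> (\<forall>x\<in>Q. \<forall>y\<in>Q. x \<noteq> y \<longrightarrow> (x, y) \<in> ?E)}"
    proof (rule image_subsetI)
      fix u assume u: "u \<in> L"
      have "\<forall>x\<in>nb ?E u. \<forall>y\<in>nb ?E u. x \<noteq> y \<longrightarrow> (x, y) \<in> ?E" using False u by blast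
      with NB[OF u] show "nb ?E u \<in> {Q. Q \<subseteq> B \<and> (\<forall>x\<in>Q. \<forall>y\<in>Q. x \<noteq> y \<longrightarrow> (x, y) \<in> ?E)}"
        by blast
    qed
    then have "card (nb ?E ` L) \<le> card {Q. Q \<subseteq> B \<and> (\<forall>x\<in>Q. \<forall>y\<in>Q. x \<noteq> y \<longrightarrow> (x, y) \<in> ?E)}"
      using fin(1) by (intro card_mono) auto
    also have "\<dots> \<le> 2 ^ (2 * C) * card B + 1" by (rule card_cliques_le[OF fin(1) sub])
    finally show ?thesis using sub[of B] by simp
  qed
qed

section \<open>Reducible vertices: low edges and twins\<close>

definition deg :: "'a pair_pre_digraph \<Rightarrow> 'a \<Rightarrow> nat" where
  "deg G v = card (nb (parcs G) v)"

text \<open>First reducible configuration: contracting \<open>u\<close> into \<open>p\<close> is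
  undone by the two old neighbourhoods, chosen among at most \<open>2 * D\<close> vertices.\<close>

definition low_edge :: "nat \<Rightarrow> 'a pair_pre_digraph \<Rightarrow> 'a \<Rightarrow> 'a \<Rightarrow> bool" where
  "low_edge D G u p \<longleftrightarrow> (u, p) \<in> parcs G \<and> deg G u \<le> D \<and> deg G p \<le> D"

text \<open>Second reducible configuration: deleting \<open>u\<close> is undone by copying the
  neighbourhood of \<open>p\<close>.\<close>

definition twins :: "'a pair_pre_digraph \<Rightarrow> 'a \<Rightarrow> 'a \<Rightarrow> bool" where
  "twins G u p \<longleftrightarrow> u \<noteq> p \<and> nb (parcs G) u = nb (parcs G) p"

text \<open>The vertices split into \<open>B\<close> of degree above \<open>D\<close>, the ends
  \<open>X\<close> of low edges, and the rest \<open>L'\<close>, whose neighbours all lie in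
  \<open>B\<close>. Linearly many arcs make \<open>B\<close> small, \<open>card_nbhds_le\<close>
  leaves at most \<open>P * card B + 1\<close> neighbourhoods on \<open>L'\<close>, and vertices
  sharing a neighbourhood are twins. The choice \<open>D = 8 * C * P\<close> makes
  \<open>4 * P * card B\<close> at most the number of vertices.\<close>

lemma many_reducible:
  fixes G :: "'a pair_pre_digraph"
  assumes "pair_graph G" "\<not> minor (complete_on t) G" "3 \<le> card (pverts G)"
  defines "C \<equiv> (2::nat) ^ t"
  defines "D \<equiv> 8 * C * (C + 2 ^ (2 * C))"
  shows "card (pverts G) \<le> 8 * (card {u \<in> pverts G. \<exists>p\<in>pverts G. low_edge D G u p} +
     card {u \<in> pverts G. \<exists>p\<in>pverts G. twins G u p})"
proof -
  let ?V = "pverts G" and ?E = "parcs G"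
  let ?N = "nb ?E"
  define P where "P = C + 2 ^ (2 * C)"
  define L where "L = {v \<in> ?V. deg G v \<le> D}"
  define B where "B = {v \<in> ?V. \<not> deg G v \<le> D}"
  define X where "X = {u \<in> ?V. \<exists>p\<in>?V. low_edge D G u p}"
  define Y where "Y = {u \<in> ?V. \<exists>p\<in>?V. twins G u p}"
  define L' where "L' = L - X"
  have G: "finite ?V" "sym ?E" "irrefl ?E" "?E \<subseteq> ?V \<times> ?V"
    using assms(1) by (auto simp: pair_graph_iff)
  have fin: "finite L" "finite B" "finite X" "finite Y" "finite L'"
    using G(1) by (auto simp: L_def B_def X_def Y_def L'_def)
  have XL: "X \<subseteq> L" by (auto simp: X_def L_def low_edge_def)
  have "?V = B \<union> (X \<union> L')" using XL by (auto simp: L_def B_def L'_def)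
  then have n: "card ?V \<le> card B + (card X + card L')"
    using card_Un_le[of B "X \<union> L'"] card_Un_le[of X L'] by simp
  have D1: "(D + 1) * card B \<le> 2 * C * card ?V"
  proof -
    have "(D + 1) * card B = (\<Sum>v\<in>B. D + 1)" by simp
    also have "\<dots> \<le> (\<Sum>v\<in>B. card (?N v))" by (rule sum_mono) (auto simp: B_def deg_def)
    also have "\<dots> \<le> (\<Sum>v\<in>?V. card (?N v))"
      by (rule sum_mono2) (use G(1) in \<open>auto simp: B_def\<close>)
    also have "\<dots> \<le> 2 * C * card ?V" using card_parcs_le[OF assms(1,2)] card_parcs[OF assms(1)] by (simp add: C_def)
    finally show ?thesis .
  qed
  have "C * (4 * (P * card B)) \<le> C * card ?V"
  proof -
    have "8 * C * P * card B \<le> 2 * C * card ?V" using D1 by (simp add: D_def P_def algebra_simps)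
    then show ?thesis by simp
  qed
  then have PB: "4 * (P * card B) \<le> card ?V" by (simp add: C_def)
  have "1 \<le> P" by (simp add: P_def C_def trans_le_add1)
  then have "1 * card B \<le> P * card B" by (rule mult_le_mono1)
  then have B: "4 * card B \<le> card ?V" using PB by linarith
  have noL: "?N u \<subseteq> B" if "u \<in> L'" for u
    using that G(4) by (auto simp: L'_def L_def B_def X_def low_edge_def)
  have BL: "B \<union> L' \<subseteq> ?V" "B \<inter> L' = {}" by (auto simp: B_def L'_def L_def)
  let ?H = "restr G (B \<union> L')"
  have PH: "pair_graph ?H" using pair_graph_restr[OF assms(1) BL(1)] .
  have mH: "\<not> minor (complete_on t) ?H"
    using assms(2) minor_trans[OF _ minor_restr[OF assms(1) BL(1)] PH assms(1)] by blast
  have arcH: "parcs ?H \<inter> L' \<times> L' = {}" using noL BL(2) by fastforce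
  have "2 * card (nb (parcs ?H) ` L') \<le> 2 * C * card B + 2 * (2 ^ (2 * C) * card B + 1)"
    using card_nbhds_le[OF PH _ BL(2) arcH mH] by (simp add: C_def)
  moreover have "nb (parcs ?H) ` L' = ?N ` L'"
  proof (rule image_cong[OF refl])
    fix u assume u: "u \<in> L'"
    show "nb (parcs ?H) u = ?N u" using noL[OF u] u by auto
  qed
  ultimately have N: "card (?N ` L') \<le> P * card B + 1" by (simp add: P_def algebra_simps)
  have inj: "inj_on ?N (L' - Y)"
    by (rule inj_onI) (auto simp: Y_def L'_def L_def twins_def)
  have "card L' \<le> card (L' - Y \<union> Y)" using fin by (intro card_mono) auto
  also have "\<dots> \<le> card (L' - Y) + card Y" by (rule card_Un_le)
  also have "card (L' - Y) \<le> card (?N ` L')"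
    using card_image[OF inj] card_mono[of "?N ` L'" "?N ` (L' - Y)"] fin(5) by auto
  finally have "card L' \<le> P * card B + 1 + card Y" using N by linarith
  moreover obtain q where q: "q = P * card B" by blast
  ultimately have "card L' \<le> q + 1 + card Y" by simp
  then have "4 * card ?V \<le> 4 * card B + 4 * q + 4 + 4 * (card X + card Y)" using n by simp
  then have "2 * card ?V \<le> 4 + 4 * (card X + card Y)" using PB B unfolding q[symmetric] by simp
  \<comment> \<open>At least three vertices force \<open>card X + card Y\<close> to be positive, so
    it absorbs the additive \<open>4\<close>.\<close>
  then have "card ?V \<le> 8 * (card X + card Y)" using assms(3) by simp
  then show ?thesis by (simp add: X_def Y_def)
qed


section \<open>Growth of a minor-closed class\<close>

lemma inj_on_relabel:
  assumes "inj_on f X" "\<And>G. G \<in> A \<Longrightarrow> pair_graph G \<and> pverts G = X"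
  shows "inj_on (relabel f) A"
proof (rule inj_on_inverseI)
  fix G assume "G \<in> A"
  then show "relabel (inv_into X f) (relabel f G) = G"
    using assms by (intro relabel_relabel) auto
qed

lemma sum_card_swap:
  assumes "finite A" "finite B"
  shows "(\<Sum>x\<in>A. card {y \<in> B. R x y}) = (\<Sum>y\<in>B. card {x \<in> A. R x y})"
  using sum.swap_restrict[OF assms, of "\<lambda>_ _. 1::nat" R] by simp

text \<open>The growth bound rests on these three facts. As a relabelled graph is a minor of the
  original, closure under minors includes closure under isomorphism.\<close>

locale small_class =
  fixes \<G> :: "nat pair_pre_digraph set" and t :: nat
  assumes pair_graph: "G \<in> \<G> \<Longrightarrow> pair_graph G"
    and minor_closed: "\<lbrakk>G \<in> \<G>; pair_graph G'; minor G' G\<rbrakk> \<Longrightarrow> G' \<in> \<G>"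
    and no_complete: "G \<in> \<G> \<Longrightarrow> \<not> minor (complete_on t) G"
begin

definition cls :: "nat set \<Rightarrow> nat pair_pre_digraph set" where
  "cls X = {G \<in> \<G>. pverts G = X}"

lemma clsD: "G \<in> cls X \<Longrightarrow> G \<in> \<G> \<and> pair_graph G \<and> pverts G = X"
  by (auto simp: cls_def pair_graph)

lemma finite_cls: "finite X \<Longrightarrow> finite (cls X)"
proof (rule finite_subset)
  show "cls X \<subseteq> (\<lambda>E. \<lparr>pverts = X, parcs = E\<rparr>) ` Pow (X \<times> X)"
  proof
    fix G assume "G \<in> cls X"
    then have "G = \<lparr>pverts = X, parcs = parcs G\<rparr>" "parcs G \<subseteq> X \<times> X"
      using clsD[of G X] by (auto simp: pair_graph_iff)
    then show "G \<in> (\<lambda>E. \<lparr>pverts = X, parcs = E\<rparr>) ` Pow (X \<times> X)" by blast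
  qed
qed simp

lemma relabel_in_class:
  assumes "G \<in> \<G>" "inj_on f (pverts G)"
  shows "relabel f G \<in> \<G>"
proof (rule minor_closed[OF assms(1)])
  show "pair_graph (relabel f G)" using pair_graph_relabel[OF pair_graph[OF assms(1)] assms(2)] .
  have "minor (relabel f G) (relabel f G)"
    by (rule minor_subgraph[OF \<open>pair_graph (relabel f G)\<close>]) auto
  then show "minor (relabel f G) G"
    using minor_relabel[OF pair_graph[OF assms(1)] assms(2)] by blast
qed

lemma card_cls_le:
  assumes "finite X" "finite Y" "card X = card Y"
    and "\<And>G f. \<lbrakk>pair_graph G; inj_on f (pverts G); P G\<rbrakk> \<Longrightarrow> P (relabel f G)"
  shows "card {G \<in> cls X. P G} \<le> card {G \<in> cls Y. P G}"
proof -
  obtain f where f: "bij_betw f X Y" using assms(1-3) finite_same_card_bij by blast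
  show ?thesis
  proof (rule card_inj_on_le)
    show "inj_on (relabel f) {G \<in> cls X. P G}"
      by (rule inj_on_relabel[of f X]) (use f clsD in \<open>auto simp: bij_betw_def\<close>)
    show "relabel f ` {G \<in> cls X. P G} \<subseteq> {G \<in> cls Y. P G}"
    proof (rule image_subsetI)
      fix G assume G: "G \<in> {G \<in> cls X. P G}"
      then have pg: "G \<in> \<G>" "pair_graph G" "pverts G = X" using clsD by auto
      have "inj_on f (pverts G)" using f pg(3) by (simp add: bij_betw_def)
      then have "relabel f G \<in> \<G>" "P (relabel f G)"
        using relabel_in_class[OF pg(1)] assms(4)[OF pg(2)] G by auto
      then show "relabel f G \<in> {G \<in> cls Y. P G}"
        using f pg(3) by (simp add: cls_def bij_betw_def)
    qed
    show "finite {G \<in> cls Y. P G}" using finite_cls[OF assms(2)] by simp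
  qed
qed

lemma card_cls_eq:
  assumes "finite X" "finite Y" "card X = card Y"
    and "\<And>G f. \<lbrakk>pair_graph G; inj_on f (pverts G); P G\<rbrakk> \<Longrightarrow> P (relabel f G)"
  shows "card {G \<in> cls X. P G} = card {G \<in> cls Y. P G}"
  using card_cls_le[of X Y P] card_cls_le[of Y X P] assms by (simp add: le_antisym)

definition num :: "nat \<Rightarrow> nat" where
  "num n = card (cls {1..n})"

lemma card_cls: "finite X \<Longrightarrow> card (cls X) = num (card X)"
  using card_cls_eq[of X "{1..card X}" "\<lambda>_. True"] by (simp add: num_def)

text \<open>\<open>G\<close> is recovered from the contraction and the two old neighbourhoods, both
  of them subsets of the neighbourhood of \<open>p\<close> after contraction. That set has at most
  \<open>2 * D\<close> elements, hence \<open>4 ^ D * 4 ^ D\<close> codes.\<close>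

lemma card_low_edge_le:
  assumes "finite W" "u \<in> W"
  shows "card {G \<in> cls W. low_edge D G u p} \<le> 16 ^ D * num (card W - 1)"
proof -
  let ?S = "SIGMA G:{G \<in> cls (W - {u}). deg G p \<le> 2 * D}. Pow (nb (parcs G) p) \<times> Pow (nb (parcs G) p)"
  let ?f = "\<lambda>G. (contract u p G, nb (parcs G) u - {p}, nb (parcs G) p - {u})"
  have fc: "finite (cls (W - {u}))" using finite_cls assms(1) by simp
  have fn: "finite (nb (parcs G) p)" if "G \<in> cls X" for G X using clsD[OF that] finite_nb[of G] by simp
  have "card {G \<in> cls W. low_edge D G u p} \<le> card ?S"
  proof (rule card_inj_on_le)
    show "inj_on ?f {G \<in> cls W. low_edge D G u p}"
    proof (rule inj_onI)
      fix G H assume GH: "G \<in> {G \<in> cls W. low_edge D G u p}" "H \<in> {G \<in> cls W. low_edge D G u p}" "?f G = ?f H"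
      have pg: "sym (parcs G)" "sym (parcs H)" and V: "pverts G = pverts H"
        using clsD[of G W] clsD[of H W] GH by (auto simp: pair_graph_iff)
      have up: "(u, p) \<in> parcs G" "(u, p) \<in> parcs H" using GH by (auto simp: low_edge_def)
      have c: "parcs (contract u p G) = parcs (contract u p H)" using GH(3) by simp
      have *: "(x, y) \<in> parcs G \<longleftrightarrow> (x, y) \<in> parcs H" if "x = u \<or> x = p" for x y
      proof -
        have "nb (parcs G) u - {p} = nb (parcs H) u - {p}" "nb (parcs G) p - {u} = nb (parcs H) p - {u}"
          using GH(3) by auto
        then show ?thesis using that up pg by (auto simp: set_eq_iff dest: symD)
      qed
      have "(x, y) \<in> parcs G \<longleftrightarrow> (x, y) \<in> parcs H" for x y
      proof (cases "x \<in> {u, p} \<or> y \<in> {u, p}")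
        case True
        then show ?thesis using *[of x y] *[of y x] pg by (auto dest: symD)
      next
        case False
        then have "(x, y) \<in> parcs G \<longleftrightarrow> (x, y) \<in> parcs (contract u p G)"
          "(x, y) \<in> parcs H \<longleftrightarrow> (x, y) \<in> parcs (contract u p H)"
          by (auto simp: contract_def)
        then show ?thesis using c by simp
      qed
      then have "parcs G = parcs H" by auto
      with V show "G = H" by simp
    qed
    show "?f ` {G \<in> cls W. low_edge D G u p} \<subseteq> ?S"
    proof (rule image_subsetI)
      fix G assume G: "G \<in> {G \<in> cls W. low_edge D G u p}"
      then have up: "(u, p) \<in> parcs G" "deg G u \<le> D" "deg G p \<le> D" by (auto simp: low_edge_def)
      have pg: "pair_graph G" "G \<in> \<G>" "pverts G = W" using G clsD by auto
      have s: "sym (parcs G)" using pg(1) by (auto simp: pair_graph_iff)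
      have up': "u \<noteq> p" using up(1) pg(1) by (auto simp: pair_graph_iff irrefl_def)
      have "contract u p G \<in> cls (W - {u})"
        using minor_closed[OF pg(2) pair_graph_contract minor_contract] pg up by (auto simp: cls_def contract_def)
      moreover have "deg (contract u p G) p \<le> 2 * D"
      proof -
        have "nb (parcs (contract u p G)) p \<subseteq> nb (parcs G) u \<union> nb (parcs G) p"
          by (auto simp: contract_def)
        then have "deg (contract u p G) p \<le> card (nb (parcs G) u \<union> nb (parcs G) p)"
          unfolding deg_def using finite_nb[OF pg(1)] by (intro card_mono) auto
        also have "\<dots> \<le> deg G u + deg G p" unfolding deg_def by (rule card_Un_le)
        finally show ?thesis using up by simp
      qed
      moreover have "nb (parcs G) u - {p} \<subseteq> nb (parcs (contract u p G)) p"
        "nb (parcs G) p - {u} \<subseteq> nb (parcs (contract u p G)) p"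
        using up' by (auto simp: contract_def)
      ultimately show "?f G \<in> ?S" by simp
    qed
    show "finite ?S" using fc fn by (intro finite_SigmaI) auto
  qed
  also have "card ?S = (\<Sum>G\<in>{G \<in> cls (W - {u}). deg G p \<le> 2 * D}. 2 ^ deg G p * 2 ^ deg G p)"
    using fc fn by (subst card_SigmaI) (auto simp: card_cartesian_product card_Pow deg_def intro!: sum.cong)
  also have "\<dots> \<le> (\<Sum>G\<in>{G \<in> cls (W - {u}). deg G p \<le> 2 * D}. 2 ^ (2 * D) * 2 ^ (2 * D))"
    by (intro sum_mono mult_le_mono power_increasing) auto
  also have "\<dots> = card {G \<in> cls (W - {u}). deg G p \<le> 2 * D} * 16 ^ D"
    by (simp add: power_mult flip: power_mult_distrib)
  also have "\<dots> \<le> card (cls (W - {u})) * 16 ^ D"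
    using fc by (intro mult_le_mono1 card_mono) auto
  also have "card (cls (W - {u})) = num (card W - 1)" using card_cls[of "W - {u}"] assms by simp
  finally show ?thesis by (simp add: mult.commute)
qed

lemma card_twins_le:
  assumes "finite W" "u \<in> W"
  shows "card {G \<in> cls W. twins G u p} \<le> num (card W - 1)"
proof -
  have "card {G \<in> cls W. twins G u p} \<le> card (cls (W - {u}))"
  proof (rule card_inj_on_le)
    show "inj_on (\<lambda>G. restr G (W - {u})) {G \<in> cls W. twins G u p}"
    proof (rule inj_onI)
      fix G H assume GH: "G \<in> {G \<in> cls W. twins G u p}" "H \<in> {G \<in> cls W. twins G u p}"
        "restr G (W - {u}) = restr H (W - {u})"
      have pg: "sym (parcs G)" "sym (parcs H)" "irrefl (parcs G)" "irrefl (parcs H)"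
        and V: "pverts G = W" "pverts H = W" and W: "parcs G \<subseteq> W \<times> W" "parcs H \<subseteq> W \<times> W"
        using clsD[of G W] clsD[of H W] GH by (auto simp: pair_graph_iff)
      have up: "u \<noteq> p" "nb (parcs G) u = nb (parcs G) p" "nb (parcs H) u = nb (parcs H) p"
        using GH by (auto simp: twins_def)
      have up2: "(u, y) \<in> parcs G \<longleftrightarrow> (p, y) \<in> parcs G" "(u, y) \<in> parcs H \<longleftrightarrow> (p, y) \<in> parcs H" for y
        using up(2,3) by (auto simp: set_eq_iff)
      have "parcs (restr G (W - {u})) = parcs (restr H (W - {u}))" using GH(3) by simp
      then have r: "(x, y) \<in> parcs G \<longleftrightarrow> (x, y) \<in> parcs H" if "x \<in> W" "y \<in> W" "x \<noteq> u" "y \<noteq> u" for x y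
        using that by (auto simp: set_eq_iff)
      have nu: "(u, u) \<notin> parcs G" "(u, u) \<notin> parcs H" using pg by (auto simp: irrefl_def)
      have r1: "(u, y) \<in> parcs G \<longleftrightarrow> (u, y) \<in> parcs H" for y
      proof (cases "y = u")
        case False
        then show ?thesis unfolding up2 using r[of p y] W up(1) by auto
      qed (use nu in simp)
      have "(x, y) \<in> parcs G \<longleftrightarrow> (x, y) \<in> parcs H" for x y
        using r1[of y] r1[of x] r[of x y] W symD[OF pg(1)] symD[OF pg(2)]
        by (cases "x = u"; cases "y = u") blast+
      then have "parcs G = parcs H" by auto
      with V show "G = H" by simp
    qed
    show "(\<lambda>G. restr G (W - {u})) ` {G \<in> cls W. twins G u p} \<subseteq> cls (W - {u})"
    proof (rule image_subsetI)
      fix G assume "G \<in> {G \<in> cls W. twins G u p}"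
      then have pg: "pair_graph G" "G \<in> \<G>" "pverts G = W" using clsD by auto
      show "restr G (W - {u}) \<in> cls (W - {u})"
        using minor_closed[OF pg(2) pair_graph_restr minor_restr] pg by (auto simp: cls_def)
    qed
    show "finite (cls (W - {u}))" using finite_cls assms(1) by simp
  qed
  then show ?thesis using card_cls[of "W - {u}"] assms by simp
qed

text \<open>Double counting of graphs with a reducible pair \<open>(u, p)\<close>, counted once for
  each kind: every graph has at least \<open>n / 8\<close> such pairs by
  \<open>many_reducible\<close>, and each of the \<open>n * n\<close> pairs is reducible in at most
  \<open>(16 ^ D + 1) * num (n - 1)\<close> graphs.\<close>

lemma num_le_Suc:
  "\<exists>K\<ge>1. \<forall>n\<ge>3. num n \<le> K * n * num (n - 1)"
proof -
  define C where "C = (2::nat) ^ t"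
  define D where "D = 8 * C * (C + 2 ^ (2 * C))"
  define K where "K = 8 * (16 ^ D + (1::nat))"
  have "num n \<le> K * n * num (n - 1)" if n: "3 \<le> n" for n
  proof -
    define W where "W = {1..n}"
    have W: "finite W" "card W = n" by (auto simp: W_def)
    have fc: "finite (cls W)" using finite_cls[OF W(1)] .
    let ?l = "\<lambda>G e. low_edge D G (fst e) (snd e)" and ?t = "\<lambda>G e. twins G (fst e) (snd e)"
    have G: "n \<le> 8 * (card {e \<in> W \<times> W. ?l G e} + card {e \<in> W \<times> W. ?t G e})" if "G \<in> cls W" for G
    proof -
      have pg: "pair_graph G" "G \<in> \<G>" "pverts G = W" using clsD[OF that] by auto
      have "{u \<in> W. \<exists>p\<in>W. low_edge D G u p} = fst ` {e \<in> W \<times> W. ?l G e}" by force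
      then have "card {u \<in> W. \<exists>p\<in>W. low_edge D G u p} \<le> card {e \<in> W \<times> W. ?l G e}"
        using card_image_le[of "{e \<in> W \<times> W. ?l G e}" fst] W(1) by simp
      moreover have "{u \<in> W. \<exists>p\<in>W. twins G u p} = fst ` {e \<in> W \<times> W. ?t G e}" by force
      then have "card {u \<in> W. \<exists>p\<in>W. twins G u p} \<le> card {e \<in> W \<times> W. ?t G e}"
        using card_image_le[of "{e \<in> W \<times> W. ?t G e}" fst] W(1) by simp
      ultimately show ?thesis
        using many_reducible[OF pg(1) no_complete[OF pg(2)]] n W(2) pg(3) by (simp add: C_def D_def)
    qed
    have "n * num n = (\<Sum>G\<in>cls W. n)" by (simp add: num_def W_def)
    also have "\<dots> \<le> (\<Sum>G\<in>cls W. 8 * (card {e \<in> W \<times> W. ?l G e} + card {e \<in> W \<times> W. ?t G e}))"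
      by (rule sum_mono) (rule G)
    also have "\<dots> = 8 * ((\<Sum>G\<in>cls W. card {e \<in> W \<times> W. ?l G e}) + (\<Sum>G\<in>cls W. card {e \<in> W \<times> W. ?t G e}))"
      by (simp add: sum_distrib_left sum.distrib)
    also have "\<dots> = 8 * ((\<Sum>e\<in>W \<times> W. card {G \<in> cls W. ?l G e}) + (\<Sum>e\<in>W \<times> W. card {G \<in> cls W. ?t G e}))"
      using W(1) by (simp add: sum_card_swap[OF fc])
    also have "\<dots> \<le> 8 * ((\<Sum>e\<in>W \<times> W. 16 ^ D * num (n - 1)) + (\<Sum>e\<in>W \<times> W. num (n - 1)))"
      using card_low_edge_le[OF W(1)] card_twins_le[OF W(1)] W(2)
      by (intro mult_le_mono2 add_mono sum_mono) auto
    also have "\<dots> = n * (K * n * num (n - 1))"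
      using W by (simp add: card_cartesian_product K_def algebra_simps)
    finally show ?thesis using n by simp
  qed
  moreover have "1 \<le> K" by (simp add: K_def)
  ultimately show ?thesis by blast
qed

text \<open>Iterates \<open>num_le_Suc\<close>; the accumulated label factors are
  \<open>fact (n + k) / fact n\<close>, cleared of the denominator to stay in the natural
  numbers.\<close>

lemma num_growth:
  "\<exists>K\<ge>1. \<forall>n\<ge>3. \<forall>k. num (n + k) * fact n \<le> K ^ k * fact (n + k) * num n"
proof -
  obtain K where K: "1 \<le> K" "\<And>n. 3 \<le> n \<Longrightarrow> num n \<le> K * n * num (n - 1)" using num_le_Suc by blast
  have "num (n + k) * fact n \<le> K ^ k * fact (n + k) * num n" if n: "3 \<le> n" for n k
  proof (induction k)
    case (Suc k)
    have "num (n + Suc k) * fact n \<le> (K * (n + Suc k) * num (n + k)) * fact n"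
      using K(2)[of "n + Suc k"] n by (intro mult_le_mono1) simp
    also have "\<dots> = K * (n + Suc k) * (num (n + k) * fact n)" by simp
    also have "\<dots> \<le> K * (n + Suc k) * (K ^ k * fact (n + k) * num n)"
      by (intro mult_le_mono2 Suc)
    finally show ?case by (simp add: algebra_simps)
  qed simp
  with K(1) show ?thesis by blast
qed

end


section \<open>Gluing cones\<close>

definition cone :: "'a \<Rightarrow> 'a set \<Rightarrow> 'a rel \<Rightarrow> 'a pair_pre_digraph" where
  "cone v S T = \<lparr>pverts = insert v S, parcs = T \<union> {v} \<times> S \<union> S \<times> {v}\<rparr>"

lemma cone_simps [simp]:
  "pverts (cone v S T) = insert v S" "parcs (cone v S T) = T \<union> {v} \<times> S \<union> S \<times> {v}"
  by (auto simp: cone_def)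

text \<open>When \<open>S\<close> is disjoint from \<open>G\<close> and \<open>T\<close> lies on
  \<open>S\<close>, this is the 1-sum of \<open>G\<close> and the cone at \<open>v\<close>, so that
  a 2-connected minor cannot use both parts.\<close>

definition glue_cone :: "'a pair_pre_digraph \<Rightarrow> 'a \<Rightarrow> 'a set \<Rightarrow> 'a rel \<Rightarrow> 'a pair_pre_digraph" where
  "glue_cone G v S T = \<lparr>pverts = pverts G \<union> S, parcs = parcs G \<union> T \<union> {v} \<times> S \<union> S \<times> {v}\<rparr>"

lemma glue_cone_simps [simp]:
  "pverts (glue_cone G v S T) = pverts G \<union> S"
  "parcs (glue_cone G v S T) = parcs G \<union> T \<union> {v} \<times> S \<union> S \<times> {v}"
  by (auto simp: glue_cone_def)

text \<open>Every branch set is cut down to \<open>V1\<close>. Only the one through \<open>v\<close>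
  can change; its part in \<open>V2\<close> hangs at the cut vertex \<open>v\<close>, so the rest
  stays connected and keeps its arcs to the other branch sets.\<close>

lemma minor_one_sum_aux:
  fixes B :: "'a \<Rightarrow> 'b set"
  assumes G: "pair_graph G" and H: "pair_graph H"
    and V: "pverts G = V1 \<union> V2" "V1 \<inter> V2 = {v}" "parcs G \<subseteq> V1 \<times> V1 \<union> V2 \<times> V2"
    and B: "\<And>w. w \<in> pverts H \<Longrightarrow> B w \<subseteq> pverts G"
      "\<And>w. w \<in> pverts H \<Longrightarrow> conn (parcs G) (B w)"
      "\<And>u w. \<lbrakk>u \<in> pverts H; w \<in> pverts H; u \<noteq> w\<rbrakk> \<Longrightarrow> B u \<inter> B w = {}"
      "\<And>u w. (u, w) \<in> parcs H \<Longrightarrow> \<exists>x\<in>B u. \<exists>y\<in>B w. (x, y) \<in> parcs G"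
    and one: "\<And>w. \<lbrakk>w \<in> pverts H; v \<notin> B w\<rbrakk> \<Longrightarrow> B w \<subseteq> V1"
  shows "minor H (restr G V1)"
proof -
  have s: "sym (parcs G)" using G by (simp add: pair_graph_iff)
  have H2: "parcs H \<subseteq> pverts H \<times> pverts H" "irrefl (parcs H)" using H by (auto simp: pair_graph_iff)
  have V1: "V1 \<subseteq> pverts G" using V(1) by auto
  have R: "pair_graph (restr G V1)" by (rule pair_graph_restr[OF G V1])
  have s': "sym (parcs (restr G V1))" using R by (simp add: pair_graph_iff)
  have step: "y \<in> V1" if "(x, y) \<in> parcs G" "x \<in> V1" "x \<noteq> v" for x y
  proof -
    have "x \<notin> V2" using that(2,3) V(2) by blast
    then show ?thesis using V(3) that(1) by blast
  qed
  have vV: "v \<in> V1" using V(2) by blast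
  show ?thesis
  proof (rule minorI[OF R, of _ "\<lambda>w. B w \<inter> V1"])
    fix w assume w: "w \<in> pverts H"
    show "B w \<inter> V1 \<subseteq> pverts (restr G V1)" by simp
    show "conn (parcs (restr G V1)) (B w \<inter> V1)"
    proof (rule connI[OF s'])
      show "B w \<inter> V1 \<noteq> {}" using one[OF w] conn_nonempty[OF B(2)[OF w]] vV by blast
      fix X x z assume X: "X \<subseteq> B w \<inter> V1" "x \<in> X" "z \<in> B w \<inter> V1 - X"
      show "\<exists>a\<in>X. \<exists>b\<in>B w \<inter> V1 - X. (a, b) \<in> parcs (restr G V1)"
      \<comment> \<open>The cut arc is taken out of the side that avoids \<open>v\<close>: from a
        vertex of \<open>V1\<close> other than \<open>v\<close> no arc leaves
        \<open>V1\<close>.\<close>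
      proof (cases "v \<in> X")
        case False
        obtain a b where ab: "a \<in> X" "b \<in> B w - X" "(a, b) \<in> parcs G"
          using connD[OF B(2)[OF w], of X x z] X by blast
        then have "b \<in> V1" using step[OF ab(3)] False X(1) by blast
        then show ?thesis using ab X(1) by auto
      next
        case True
        let ?Y = "B w \<inter> V1 - X"
        obtain a b where ab: "a \<in> ?Y" "b \<in> B w - ?Y" "(a, b) \<in> parcs G"
          using connD[OF B(2)[OF w], of ?Y z x] X by blast
        then have "b \<in> V1" using step[OF ab(3)] True by blast
        then have "b \<in> X" using ab(2) by blast
        then show ?thesis using ab(1) \<open>b \<in> V1\<close> symD[OF s ab(3)] by auto
      qed
    qed
  next
    fix u w assume "u \<in> pverts H" "w \<in> pverts H" "u \<noteq> w"
    then show "(B u \<inter> V1) \<inter> (B w \<inter> V1) = {}" using B(3)[of u w] by blast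
  next
    fix u w assume uw: "(u, w) \<in> parcs H"
    then have uw': "u \<in> pverts H" "w \<in> pverts H" "u \<noteq> w" using H2 by (auto simp: irrefl_def)
    obtain x y where xy: "x \<in> B u" "y \<in> B w" "(x, y) \<in> parcs G" using B(4)[OF uw] by blast
    have yx: "(y, x) \<in> parcs G" using symD[OF s xy(3)] .
    have "x \<in> V1 \<and> y \<in> V1"
    proof (cases "v \<in> B u")
      case False
      then have x: "x \<in> V1" "x \<noteq> v" using one[OF uw'(1)] xy(1) by blast+
      then show ?thesis using step[OF xy(3)] by blast
    next
      case True
      then have "v \<notin> B w" using B(3)[OF uw'] by blast
      then have y: "y \<in> V1" "y \<noteq> v" using one[OF uw'(2)] xy(2) by blast+
      then show ?thesis using step[OF yx] by blast
    qed
    then show "\<exists>x\<in>B u \<inter> V1. \<exists>y\<in>B w \<inter> V1. (x, y) \<in> parcs (restr G V1)" using xy by auto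
  qed
qed

text \<open>At most one branch set contains the cut vertex. Each of the others lies on one side, and
  adjacent ones lie on the same side. As \<open>H\<close> stays connected when the exceptional
  vertex is removed, all of them are on one common side.\<close>

lemma minor_one_sum:
  assumes G: "pair_graph G" and H: "pair_graph H" "k_connected 2 H"
    and V: "pverts G = V1 \<union> V2" "V1 \<inter> V2 = {v}" "parcs G \<subseteq> V1 \<times> V1 \<union> V2 \<times> V2"
    and m: "minor H G"
  shows "minor H (restr G V1) \<or> minor H (restr G V2)"
proof -
  obtain B where B: "\<And>w. w \<in> pverts H \<Longrightarrow> B w \<subseteq> pverts G"
      "\<And>w. w \<in> pverts H \<Longrightarrow> conn (parcs G) (B w)"
      "\<And>u w. \<lbrakk>u \<in> pverts H; w \<in> pverts H; u \<noteq> w\<rbrakk> \<Longrightarrow> B u \<inter> B w = {}"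
      "\<And>u w. (u, w) \<in> parcs H \<Longrightarrow> \<exists>x\<in>B u. \<exists>y\<in>B w. (x, y) \<in> parcs G"
    by (rule minorE[OF m G], rule that)
  define W where "W = {w \<in> pverts H. v \<in> B w}"
  have "card W \<le> 1"
  proof (rule ccontr)
    assume "\<not> card W \<le> 1"
    then have "2 \<le> card W" by simp
    then obtain a b where "a \<in> W" "b \<in> W" "a \<noteq> b"
      by (meson card_2_iff' obtain_subset_with_card_n subset_iff)
    then show False using B(3)[of a b] by (auto simp: W_def)
  qed
  then have cH: "conn (parcs H) (pverts H - W)"
    using H by (auto simp: k_connected_def induces_connected_iff W_def)
  have nocross: False if "(a, b) \<in> parcs G" "a \<in> V1" "a \<noteq> v" "b \<in> V2" "b \<noteq> v" for a b
    using that V(2,3) by blast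
  have side: "B w \<subseteq> V1 \<or> B w \<subseteq> V2" if "w \<in> pverts H - W" for w
  proof (rule ccontr)
    assume "\<not> ?thesis"
    then obtain x z where xz: "x \<in> B w" "x \<notin> V2" "z \<in> B w" "z \<notin> V1" by blast
    have w: "w \<in> pverts H" "v \<notin> B w" using that by (auto simp: W_def)
    have sub: "B w \<subseteq> V1 \<union> V2" using B(1)[OF w(1)] V(1) by simp
    have "x \<in> B w \<inter> V1" "z \<in> B w - B w \<inter> V1" using xz sub by blast+
    then obtain a b where ab: "a \<in> B w \<inter> V1" "b \<in> B w - B w \<inter> V1" "(a, b) \<in> parcs G"
      using connD[OF B(2)[OF w(1)], of "B w \<inter> V1" x z] by blast
    moreover have "b \<in> V2" using ab(2) sub by blast
    moreover have "a \<noteq> v" "b \<noteq> v" using ab w(2) by blast+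
    ultimately show False using nocross[of a b] by blast
  qed
  define S where "S = {w \<in> pverts H - W. B w \<subseteq> V1}"
  have "S = {} \<or> S = pverts H - W"
  proof (rule ccontr)
    assume "\<not> ?thesis"
    then obtain x z where "x \<in> S" "z \<in> (pverts H - W) - S" unfolding S_def by blast
    then obtain a b where ab: "a \<in> S" "b \<in> (pverts H - W) - S" "(a, b) \<in> parcs H"
      using connD[OF cH, of S x z] by (auto simp: S_def)
    then obtain p q where pq: "p \<in> B a" "q \<in> B b" "(p, q) \<in> parcs G" using B(4) by blast
    have "v \<notin> B a" "v \<notin> B b" "B a \<subseteq> V1" using ab by (auto simp: S_def W_def)
    moreover have "B b \<subseteq> V2" using ab side[of b] by (auto simp: S_def)
    ultimately show False using nocross[OF pq(3)] pq by blast
  qed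
  then show ?thesis
  proof
    assume "S = pverts H - W"
    then have one: "B w \<subseteq> V1" if "w \<in> pverts H" "v \<notin> B w" for w using that by (auto simp: S_def W_def)
    have "minor H (restr G V1)"
      by (rule minor_one_sum_aux[where B = B, OF G H(1) V]) (rule B one; assumption)+
    then show ?thesis ..
  next
    assume "S = {}"
    then have one: "B w \<subseteq> V2" if "w \<in> pverts H" "v \<notin> B w" for w
      using that side[of w] by (auto simp: S_def W_def)
    have V': "pverts G = V2 \<union> V1" "V2 \<inter> V1 = {v}" "parcs G \<subseteq> V2 \<times> V2 \<union> V1 \<times> V1" using V by auto
    have "minor H (restr G V2)"
      by (rule minor_one_sum_aux[where B = B, OF G H(1) V']) (rule B one; assumption)+
    then show ?thesis ..
  qed
qed

lemma minor_glue_cone: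
  assumes G: "pair_graph G" and H: "pair_graph H" "k_connected 2 H"
    and v: "v \<in> pverts G" and S: "S \<inter> pverts G = {}" and T: "T \<subseteq> S \<times> S" "pair_graph (cone v S T)"
    and m: "minor H (glue_cone G v S T)"
  shows "minor H G \<or> minor H (cone v S T)"
proof -
  have J: "pair_graph (glue_cone G v S T)"
    using G T(2) by (auto simp: pair_graph_iff v sym_def irrefl_def)
  have EG: "parcs G \<subseteq> pverts G \<times> pverts G" "irrefl (parcs G)" using G by (auto simp: pair_graph_iff)
  have e1: "restr (glue_cone G v S T) (pverts G) = G"
    unfolding restr_def by (rule pair_pre_digraph.equality) (use EG S T in auto)
  have e2: "restr (glue_cone G v S T) (insert v S) = cone v S T"
    unfolding restr_def cone_def by (rule pair_pre_digraph.equality) (use EG S T in \<open>auto simp: irrefl_def\<close>)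
  have "minor H (restr (glue_cone G v S T) (pverts G)) \<or> minor H (restr (glue_cone G v S T) (insert v S))"
    by (rule minor_one_sum[OF J H, of _ _ v]) (use m EG v S T in auto)
  then show ?thesis unfolding e1 e2 .
qed

lemma pair_graph_glue_cone:
  assumes "pair_graph G" "pair_graph (cone v S T)" "v \<in> pverts G"
  shows "pair_graph (glue_cone G v S T)"
  using assms by (auto simp: pair_graph_iff sym_def irrefl_def)

locale glueable_class = small_class +
  assumes glue: "\<lbrakk>G \<in> \<G>; v \<in> pverts G; S \<inter> pverts G = {}; T \<subseteq> S \<times> S; cone v S T \<in> \<G>\<rbrakk>
    \<Longrightarrow> glue_cone G v S T \<in> \<G>"
begin

lemma relabel_cone:
  assumes "bij_betw h {0..<k} S" "v \<notin> S" "T \<subseteq> {0..<k} \<times> {0..<k}" "cone k {0..<k} T \<in> \<G>"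
  shows "cone v S (map_prod h h ` T) \<in> \<G>"
proof -
  let ?f = "h(k := v)"
  have h: "h ` {0..<k} = S" "inj_on h {0..<k}" using assms(1) by (auto simp: bij_betw_def)
  have f: "?f ` {0..<k} = S" using h(1) by auto
  have "inj_on ?f (insert k {0..<k})"
    using h assms(2) by (auto simp: inj_on_def)
  then have "relabel ?f (cone k {0..<k} T) \<in> \<G>"
    using relabel_in_class[OF assms(4)] by simp
  moreover have "relabel ?f (cone k {0..<k} T) = cone v S (map_prod h h ` T)"
  proof -
    have "map_prod ?f ?f ` T = map_prod h h ` T"
      by (rule image_cong) (use assms(3) in auto)
    moreover have "map_prod ?f ?f ` ({k} \<times> {0..<k}) = {v} \<times> S" "map_prod ?f ?f ` ({0..<k} \<times> {k}) = S \<times> {v}"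
      using f by (auto simp: map_prod_surj_on[unfolded map_prod_def] image_iff) force+
    moreover have "?f ` insert k {0..<k} = insert v S" using f by auto
    ultimately show ?thesis unfolding relabel_def cone_def by (simp add: image_Un)
  qed
  ultimately show ?thesis by simp
qed

definition small_deg :: "nat set \<Rightarrow> nat \<Rightarrow> nat pair_pre_digraph set" where
  "small_deg X k = {G \<in> cls X. \<forall>v\<in>pverts G. deg G v < k}"

lemma finite_small_deg: "finite X \<Longrightarrow> finite (small_deg X k)"
  using finite_cls[of X] by (auto simp: small_deg_def)

lemma deg_relabel:
  assumes "pair_graph G" "inj_on f (pverts G)" "v \<in> pverts G"
  shows "deg (relabel f G) (f v) = deg G v"
proof -
  have E: "parcs G \<subseteq> pverts G \<times> pverts G" using assms(1) by (simp add: pair_graph_iff)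
  have "nb (parcs (relabel f G)) (f v) = f ` nb (parcs G) v"
  proof (intro set_eqI iffI)
    fix y assume "y \<in> nb (parcs (relabel f G)) (f v)"
    then obtain a b where ab: "(a, b) \<in> parcs G" "f a = f v" "y = f b" by auto
    then have "a = v" using assms(2,3) E by (auto dest: inj_onD)
    then show "y \<in> f ` nb (parcs G) v" using ab by auto
  qed force
  moreover have "inj_on f (nb (parcs G) v)"
    by (rule inj_on_subset[OF assms(2)]) (use E in auto)
  ultimately show ?thesis by (simp add: deg_def card_image)
qed

lemma card_small_deg:
  assumes "finite X"
  shows "card (small_deg X k) = card (small_deg {1..card X} k)"
  unfolding small_deg_def
  by (rule card_cls_eq) (use assms in \<open>auto simp: deg_relabel\<close>)

text \<open>Gluing a cone with \<open>k\<close> rim vertices to a graph with all degrees below \<open>k\<close> is almost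
  injective: the apex is one of the at most \<open>k + 1\<close> vertices of degree at least \<open>k\<close>, and the rim
  is a set of neighbours of it.\<close>

lemma count_glued:
  assumes k: "1 \<le> k" and F: "\<And>T. T \<in> F \<Longrightarrow> T \<subseteq> {0..<k} \<times> {0..<k} \<and> cone k {0..<k} T \<in> \<G>"
  shows "(m + k choose k) * (card (small_deg {1..m} k) * (m * card F)) \<le> num (m + k) * ((k + 1) * 4 ^ k)"
proof -
  define W where "W = {1..m + k}"
  have W: "finite W" "card W = m + k" by (auto simp: W_def)
  have fF: "finite F"
    by (rule finite_subset[of _ "Pow ({0..<k} \<times> {0..<k})"]) (use F in auto)
  define SS where "SS = {S. S \<subseteq> W \<and> card S = k}"
  have SS: "finite S" "card (W - S) = m" "finite (W - S)" "S \<subseteq> W" "card S = k" if "S \<in> SS" for S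
    using that W by (auto simp: SS_def card_Diff_subset finite_subset)
  have "\<forall>S\<in>SS. \<exists>h. bij_betw h {0..<k} S"
    using SS ex_bij_betw_nat_finite by metis
  \<comment> \<open>One fixed labelling per rim, so that the arcs placed on \<open>S\<close>
    determine \<open>T\<close>.\<close>
  then obtain h where h: "\<And>S. S \<in> SS \<Longrightarrow> bij_betw (h S) {0..<k} S" by metis
  define Z where "Z = (SIGMA S:SS. small_deg (W - S) k \<times> ((W - S) \<times> F))"
  define \<Phi> where "\<Phi> = (\<lambda>(S, G, v, T). glue_cone G v S (map_prod (h S) (h S) ` T))"
  have fSS: "finite SS" using W(1) by (simp add: SS_def)
  have fZ: "finite Z" unfolding Z_def
    using fSS fF finite_small_deg SS by (intro finite_SigmaI finite_cartesian_product) auto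
  have "card Z = (\<Sum>S\<in>SS. card (small_deg (W - S) k \<times> ((W - S) \<times> F)))"
    unfolding Z_def using fSS fF finite_small_deg SS by (intro card_SigmaI ballI finite_cartesian_product) auto
  also have "\<dots> = (\<Sum>S\<in>SS. card (small_deg {1..m} k) * (m * card F))"
  proof (rule sum.cong[OF refl])
    fix S assume S: "S \<in> SS"
    show "card (small_deg (W - S) k \<times> ((W - S) \<times> F)) = card (small_deg {1..m} k) * (m * card F)"
      using card_small_deg[OF SS(3)[OF S], of k] SS(2)[OF S] by (simp add: card_cartesian_product)
  qed
  also have "\<dots> = (m + k choose k) * (card (small_deg {1..m} k) * (m * card F))"
    using n_subsets[OF W(1), of k] W(2) by (simp add: SS_def)
  finally have cZ: "card Z = (m + k choose k) * (card (small_deg {1..m} k) * (m * card F))" .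
  have ZD: "S \<in> SS \<and> G \<in> \<G> \<and> pair_graph G \<and> pverts G = W - S \<and> (\<forall>v\<in>W - S. deg G v < k) \<and> v \<in> W - S \<and> T \<in> F
      \<and> map_prod (h S) (h S) ` T \<subseteq> S \<times> S"
    if "(S, G, v, T) \<in> Z" for S G v T
  proof -
    have "map_prod (h S) (h S) ` T \<subseteq> S \<times> S"
      using that F[of T] h[of S] by (auto simp: Z_def bij_betw_def)
    then show ?thesis using that clsD[of G "W - S"] by (auto simp: Z_def small_deg_def)
  qed
  have \<Phi>: "\<Phi> z \<in> cls W" if "z \<in> Z" for z
  proof -
    obtain S G v T where z: "z = (S, G, v, T)" by (cases z)
    note zD = ZD[OF that[unfolded z]]
    have "cone v S (map_prod (h S) (h S) ` T) \<in> \<G>"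
      using relabel_cone[OF h] zD F[of T] by blast
    then have "glue_cone G v S (map_prod (h S) (h S) ` T) \<in> \<G>"
      using glue[of G v S "map_prod (h S) (h S) ` T"] zD by auto
    moreover have "S \<subseteq> W" using zD SS by blast
    ultimately show ?thesis using zD by (auto simp: z \<Phi>_def cls_def)
  qed
  have fib: "card {z \<in> Z. \<Phi> z = J} \<le> (k + 1) * 4 ^ k" if J: "J \<in> cls W" for J
  proof (cases "{z \<in> Z. \<Phi> z = J} = {}")
    case False
    then obtain S0 G0 v0 T0 where z0: "(S0, G0, v0, T0) \<in> Z" "\<Phi> (S0, G0, v0, T0) = J" by auto
    note D0 = ZD[OF z0(1)]
    obtain R0 where R0: "R0 = map_prod (h S0) (h S0) ` T0" by blast
    have J0: "parcs J = parcs G0 \<union> R0 \<union> {v0} \<times> S0 \<union> S0 \<times> {v0}"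
      using z0(2) by (auto simp: \<Phi>_def R0)
    have R0S: "R0 \<subseteq> S0 \<times> S0" using D0 by (simp add: R0)
    have E0: "parcs G0 \<subseteq> (W - S0) \<times> (W - S0)" using D0 by (auto simp: pair_graph_iff)
    have pJ: "pair_graph J" using clsD[OF J] by simp
    have S0: "finite S0" "card S0 = k" using SS D0 by auto
    \<comment> \<open>The rim of every preimage with apex \<open>v\<close> is a subset of the
      neighbours of \<open>v\<close> in \<open>J\<close>; at most \<open>2 * k\<close> neighbours
      leave \<open>4 ^ k\<close> choices.\<close>
    have dJ: "deg J v \<le> 2 * k" if "v \<in> insert v0 S0" for v
    proof (cases "v = v0")
      case True
      have "nb (parcs J) v0 \<subseteq> nb (parcs G0) v0 \<union> S0" unfolding J0 using D0 E0 R0S by auto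
      then have "deg J v0 \<le> card (nb (parcs G0) v0 \<union> S0)"
        unfolding deg_def using finite_nb[of G0] D0 S0 by (intro card_mono) auto
      also have "\<dots> \<le> deg G0 v0 + k" using card_Un_le[of "nb (parcs G0) v0" S0] S0 by (simp add: deg_def)
      also have "deg G0 v0 < k" using D0 by blast
      finally have "deg J v0 < k + k" by simp
      then show ?thesis using True by simp
    next
      case False
      then have v: "v \<in> S0" using that by simp
      have "nb (parcs J) v \<subseteq> insert v0 S0" unfolding J0 using D0 E0 R0S v by auto
      then have "deg J v \<le> card (insert v0 S0)" unfolding deg_def using S0 by (intro card_mono) auto
      also have "\<dots> \<le> k + 1" using S0 by (simp add: card_insert_if)
      finally show ?thesis using k by simp
    qed
    have "card {z \<in> Z. \<Phi> z = J} \<le> card (SIGMA v:insert v0 S0. Pow (nb (parcs J) v))"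
    proof (rule card_inj_on_le)
      \<comment> \<open>Apex and rim determine the preimage: \<open>G\<close> and the arcs on the
        rim are the restrictions of \<open>J\<close> to \<open>W - S\<close> and to
        \<open>S\<close>.\<close>
      show "inj_on (\<lambda>(S, G, v, T). (v, S)) {z \<in> Z. \<Phi> z = J}"
      proof (rule inj_onI)
        fix x y assume x: "x \<in> {z \<in> Z. \<Phi> z = J}" and y: "y \<in> {z \<in> Z. \<Phi> z = J}"
          and eq: "(\<lambda>(S, G, v, T). (v, S)) x = (\<lambda>(S, G, v, T). (v, S)) y"
        obtain S G v T where x': "x = (S, G, v, T)" by (cases x)
        obtain G' T' where y': "y = (S, G', v, T')" using eq x' by (cases y) auto
        note Dx = ZD[of S G v T] and Dy = ZD[of S G' v T']
        have xy: "(S, G, v, T) \<in> Z" "(S, G', v, T') \<in> Z" using x y x' y' by auto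
        note Dx = ZD[OF xy(1)] and Dy = ZD[OF xy(2)]
        let ?h = "map_prod (h S) (h S)"
        obtain R R' where R: "R = ?h ` T" "R' = ?h ` T'" by blast
        have "\<Phi> x = J" "\<Phi> y = J" using x y by auto
        then have JG: "J = glue_cone G v S R" and JG': "J = glue_cone G' v S R'"
          by (simp_all add: x' y' \<Phi>_def R)
        have Jx: "parcs J = parcs G \<union> R \<union> {v} \<times> S \<union> S \<times> {v}"
          by (subst JG) simp
        have Jy: "parcs J = parcs G' \<union> R' \<union> {v} \<times> S \<union> S \<times> {v}"
          by (subst JG') simp
        have RS: "R \<subseteq> S \<times> S" "R' \<subseteq> S \<times> S" "v \<notin> S" using Dx Dy by (auto simp: R)
        have EG: "parcs G \<subseteq> (W - S) \<times> (W - S)" "parcs G' \<subseteq> (W - S) \<times> (W - S)"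
          using Dx Dy by (auto simp: pair_graph_iff)
        have "parcs G = parcs J \<inter> (W - S) \<times> (W - S)" unfolding Jx using EG(1) RS by auto
        also have "\<dots> = parcs G'" unfolding Jy using EG(2) RS by auto
        finally have "G = G'" using Dx Dy by (intro pair_pre_digraph.equality) auto
        have "R = parcs J \<inter> S \<times> S" unfolding Jx using EG(1) RS by auto
        also have "\<dots> = R'" unfolding Jy using EG(2) RS by auto
        finally have "?h ` T = ?h ` T'" unfolding R .
        moreover have "inj_on ?h ({0..<k} \<times> {0..<k})"
          using h[of S] Dx by (intro map_prod_inj_on) (auto simp: bij_betw_def)
        moreover have "T \<subseteq> {0..<k} \<times> {0..<k}" "T' \<subseteq> {0..<k} \<times> {0..<k}"
          using F[of T] F[of T'] Dx Dy by simp_all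
        ultimately have "T = T'" by (simp add: inj_on_image_eq_iff)
        with \<open>G = G'\<close> show "x = y" by (simp add: x' y')
      qed
      show "(\<lambda>(S, G, v, T). (v, S)) ` {z \<in> Z. \<Phi> z = J} \<subseteq> (SIGMA v:insert v0 S0. Pow (nb (parcs J) v))"
      proof (rule image_subsetI)
        fix z assume z: "z \<in> {z \<in> Z. \<Phi> z = J}"
        obtain S G v T where z': "z = (S, G, v, T)" by (cases z)
        have zZ: "(S, G, v, T) \<in> Z" using z z' by simp
        note D = ZD[OF zZ]
        have Jz: "parcs J = parcs G \<union> map_prod (h S) (h S) ` T \<union> {v} \<times> S \<union> S \<times> {v}"
          using z by (auto simp: z' \<Phi>_def)
        have S: "S \<subseteq> nb (parcs J) v" unfolding Jz by auto
        have "k \<le> deg J v" unfolding deg_def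
          using card_mono[OF finite_nb[OF pJ] S] SS D by auto
        \<comment> \<open>A single preimage confines all apices: outside \<open>insert v0 S0\<close>
          the degrees in \<open>J\<close> are those in \<open>G0\<close>, below \<open>k\<close>,
          whereas an apex has degree at least \<open>k\<close>.\<close>
        have "v \<in> insert v0 S0"
        proof (rule ccontr)
          assume n: "v \<notin> insert v0 S0"
          then have "nb (parcs J) v = nb (parcs G0) v" unfolding J0 using R0S by auto
          then have "deg J v = deg G0 v" by (simp add: deg_def)
          also have "\<dots> < k" using D0 D n by auto
          finally show False using \<open>k \<le> deg J v\<close> by simp
        qed
        then show "(\<lambda>(S, G, v, T). (v, S)) z \<in> (SIGMA v:insert v0 S0. Pow (nb (parcs J) v))"
          using S by (simp add: z')
      qed
      show "finite (SIGMA v:insert v0 S0. Pow (nb (parcs J) v))"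
        using S0 finite_nb[OF pJ] by (intro finite_SigmaI) auto
    qed
    also have "\<dots> = (\<Sum>v\<in>insert v0 S0. 2 ^ deg J v)"
      using S0 finite_nb[OF pJ] by (subst card_SigmaI) (auto simp: card_Pow deg_def)
    also have "\<dots> \<le> (\<Sum>v\<in>insert v0 S0. 2 ^ (2 * k))"
      using dJ by (intro sum_mono power_increasing) auto
    also have "\<dots> = card (insert v0 S0) * 4 ^ k" by (simp add: power_mult)
    also have "\<dots> \<le> (k + 1) * 4 ^ k"
      using S0 by (intro mult_le_mono1) (simp add: card_insert_if)
    finally show ?thesis .
  next
    case True
    show ?thesis unfolding True by simp
  qed
  have "Z = (\<Union>J\<in>cls W. {z \<in> Z. \<Phi> z = J})" using \<Phi> by auto
  then have "card Z \<le> (\<Sum>J\<in>cls W. card {z \<in> Z. \<Phi> z = J})"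
    using card_UN_le[OF finite_cls[OF W(1)], of "\<lambda>J. {z \<in> Z. \<Phi> z = J}"] by simp
  also have "\<dots> \<le> (\<Sum>J\<in>cls W. (k + 1) * 4 ^ k)" by (intro sum_mono fib)
  also have "\<dots> = num (m + k) * ((k + 1) * 4 ^ k)" by (simp add: num_def W_def)
  finally show ?thesis unfolding cZ .
qed

text \<open>Combines \<open>count_glued\<close> with \<open>num_growth\<close>; after multiplication
  by \<open>fact (n + k)\<close> the binomial coefficient cancels. The base is \<open>8 * K\<close>
  because \<open>k + 1\<close> is at most \<open>2 ^ k\<close>, next to \<open>4 ^ k\<close> and
  \<open>K ^ k\<close>.\<close>

lemma small_deg_bound:
  "\<exists>M\<ge>1. \<forall>n\<ge>3. \<forall>k\<ge>1. \<forall>F. (\<forall>T\<in>F. T \<subseteq> {0..<k} \<times> {0..<k} \<and> cone k {0..<k} T \<in> \<G>) \<longrightarrow>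
     card (small_deg {1..n} k) * (n * card F) \<le> M ^ k * fact k * num n"
proof -
  obtain K where K: "1 \<le> K" "\<And>n k. 3 \<le> n \<Longrightarrow> num (n + k) * fact n \<le> K ^ k * fact (n + k) * num n"
    using num_growth by blast
  have "card (small_deg {1..n} k) * (n * card F) \<le> (8 * K) ^ k * fact k * num n"
    if n: "3 \<le> n" and k: "1 \<le> k" and F: "\<forall>T\<in>F. T \<subseteq> {0..<k} \<times> {0..<k} \<and> cone k {0..<k} T \<in> \<G>" for n k F
  proof -
    let ?A = "card (small_deg {1..n} k) * (n * card F)"
    have "(8 * K) ^ k = (2 * 4 * K) ^ k" by simp
    then have p: "(8 * K) ^ k = 2 ^ k * 4 ^ k * K ^ k" by (simp only: power_mult_distrib)
    have b: "(n + k choose k) * (fact k * fact n) = fact (n + k)"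
      using binomial_fact_lemma[of k "n + k"] by (simp add: mult.commute mult.left_commute)
    have "fact (n + k) * ?A = (fact k * fact n) * ((n + k choose k) * ?A)"
      unfolding b[symmetric] by (simp add: algebra_simps)
    also have "\<dots> \<le> (fact k * fact n) * (num (n + k) * ((k + 1) * 4 ^ k))"
      by (intro mult_le_mono2 count_glued) (use k F in auto)
    also have "\<dots> = (fact k * ((k + 1) * 4 ^ k)) * (num (n + k) * fact n)" by (simp add: algebra_simps)
    also have "\<dots> \<le> (fact k * ((k + 1) * 4 ^ k)) * (K ^ k * fact (n + k) * num n)"
      by (intro mult_le_mono2 K(2) n)
    also have "\<dots> \<le> (fact k * (2 ^ k * 4 ^ k)) * (K ^ k * fact (n + k) * num n)"
      by (intro mult_le_mono1 mult_le_mono2) (simp add: Suc_leI)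
    also have "\<dots> = fact (n + k) * ((8 * K) ^ k * fact k * num n)"
      unfolding p by (simp only: mult_ac)
    finally show ?thesis by simp
  qed
  moreover have "1 \<le> 8 * K" using K(1) by simp
  ultimately show ?thesis by blast
qed

end


section \<open>Cycles of length three and minors of fans\<close>

lemma pair_graph_graph_of:
  assumes "finite V" "E \<subseteq> V \<times> V" "irrefl E"
  shows "pair_graph (graph_of V E)"
  using assms by (auto simp: pair_graph_iff graph_of_def sym_def irrefl_def)

lemma pair_graph_fan: "2 \<le> n \<Longrightarrow> pair_graph (fan n)"
  unfolding fan_def by (rule pair_graph_graph_of) (auto simp: irrefl_def)

lemma conn_connected_component:
  assumes "sym E" "a \<in> V"
  shows "conn E {z \<in> V. (a, z) \<in> (E \<inter> V \<times> V)\<^sup>*}" (is "conn E ?A")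
proof -
  let ?E = "E \<inter> ?A \<times> ?A"
  have to: "(a, z) \<in> ?E\<^sup>*" if "(a, z) \<in> (E \<inter> V \<times> V)\<^sup>*" for z
    using that
  proof (induction rule: rtrancl_induct)
    case (step y z)
    then have "(a, z) \<in> (E \<inter> V \<times> V)\<^sup>*" by (meson rtrancl.rtrancl_into_rtrancl)
    then have "(y, z) \<in> ?E" using step by auto
    then show ?case using step.IH by (meson rtrancl.rtrancl_into_rtrancl)
  qed simp
  have "sym ?E" using assms(1) by (auto simp: sym_def)
  then have s: "sym (?E\<^sup>*)" by (rule sym_rtrancl)
  have "(x, y) \<in> ?E\<^sup>*" if "x \<in> ?A" "y \<in> ?A" for x y
  proof -
    have "(x, a) \<in> ?E\<^sup>*" using to[of x] that(1) symD[OF s] by blast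
    moreover have "(a, y) \<in> ?E\<^sup>*" using to[of y] that(2) by blast
    ultimately show ?thesis by (rule rtrancl_trans)
  qed
  moreover have "a \<in> ?A" using assms(2) by simp
  ultimately show ?thesis unfolding conn_def by blast
qed

text \<open>For two neighbours \<open>a\<close> and \<open>b\<close> of a vertex \<open>w\<close>,
  the branch sets are \<open>{w}\<close>, \<open>{b}\<close> and the component of \<open>a\<close>
  after deletion of \<open>w\<close> and \<open>b\<close>. Deleting \<open>w\<close> alone leaves
  \<open>H\<close> connected, so this component has an arc to \<open>b\<close>.\<close>

lemma two_connected_has_triangle_minor:
  assumes H: "pair_graph H" "k_connected 2 H"
  shows "minor (cycle_graph 3) H"
proof -
  let ?V = "pverts H" and ?E = "parcs H"
  have H': "finite ?V" "sym ?E" "irrefl ?E" "?E \<subseteq> ?V \<times> ?V" using H(1) by (auto simp: pair_graph_iff)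
  have c: "conn ?E (?V - X)" if "X \<subseteq> ?V" "card X < 2" for X
    using H that by (simp add: k_connected_def induces_connected_iff)
  have cV: "2 < card ?V" using H(2) by (simp add: k_connected_def)
  have other: "\<exists>x\<in>?V. x \<noteq> p \<and> x \<noteq> q" for p q
  proof (rule ccontr)
    assume "\<not> ?thesis"
    then have "?V \<subseteq> {p, q}" by auto
    then have "card ?V \<le> card {p, q}" by (intro card_mono) auto
    also have "\<dots> \<le> 2" by (simp add: card_insert_if)
    finally show False using cV by simp
  qed
  obtain w where w: "w \<in> ?V" using other by blast
  obtain z where z: "z \<in> ?V" "z \<noteq> w" using other by blast
  have "\<exists>a. (w, a) \<in> ?E"
    using connD[OF c[of "{}"], of "{w}" w z] w z by auto
  then obtain a where a: "(w, a) \<in> ?E" by blast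
  have aV: "a \<in> ?V" "a \<noteq> w" using a H' by (auto simp: irrefl_def)
  obtain y where y: "y \<in> ?V" "y \<noteq> w" "y \<noteq> a" using other by blast
  have "\<exists>b. (w, b) \<in> ?E \<and> b \<noteq> a"
    using connD[OF c[of "{a}"], of "{w}" w y] w aV y by auto
  then obtain b where b: "(w, b) \<in> ?E" "b \<noteq> a" by blast
  have bV: "b \<in> ?V" "b \<noteq> w" using b H' by (auto simp: irrefl_def)
  define U where "U = ?V - {w, b}"
  define A where "A = {z \<in> U. (a, z) \<in> (?E \<inter> U \<times> U)\<^sup>*}"
  have aU: "a \<in> U" using aV b(2) by (auto simp: U_def)
  have cA: "conn ?E A" unfolding A_def by (rule conn_connected_component[OF H'(2) aU])
  have aA: "a \<in> A" using aU by (simp add: A_def)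
  have AU: "A \<subseteq> U" by (auto simp: A_def)
  have "\<exists>x\<in>A. (x, b) \<in> ?E"
  proof -
    have "A \<subseteq> ?V - {w}" "b \<in> ?V - {w} - A" using AU bV by (auto simp: U_def)
    then obtain p q where pq: "p \<in> A" "q \<in> ?V - {w} - A" "(p, q) \<in> ?E"
      using connD[OF c[of "{w}"], of A a b] w aA by auto
    have "q = b"
    proof (rule ccontr)
      assume "q \<noteq> b"
      then have "q \<in> U" using pq by (auto simp: U_def)
      then have "(p, q) \<in> ?E \<inter> U \<times> U" using pq AU by auto
      then have "q \<in> A" using pq(1) \<open>q \<in> U\<close> unfolding A_def by (auto intro: rtrancl_into_rtrancl)
      then show False using pq(2) by simp
    qed
    then show ?thesis using pq by blast
  qed
  then obtain x where x: "x \<in> A" "(x, b) \<in> ?E" by blast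
  define B where "B = (\<lambda>i::nat. if i = 0 then {w} else if i = 1 then A else {b})"
  have l3: "{..<3} = {0, 1, 2::nat}" by (auto simp: lessThan_Suc numeral_eq_Suc)
  have "{(i, (i + 1) mod 3) | i. i < (3::nat)} = (\<lambda>i. (i, (i + 1) mod 3)) ` {..<3}" by auto
  then have e3: "{(i, (i + 1) mod 3) | i. i < (3::nat)} = {(0, 1), (1, 2), (2, 0)}" unfolding l3 by (simp add: numeral_2_eq_2)
  have C: "pverts (cycle_graph 3) = {0, 1, 2}"
    "parcs (cycle_graph 3) \<subseteq> {(0, 1), (1, 2), (2, 0), (1, 0), (2, 1), (0, 2)}"
    using l3 unfolding cycle_graph_def graph_of_def e3 by (auto simp: lessThan_atLeast0)
  show ?thesis
  proof (rule minorI[OF H(1), of _ B])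
    fix v assume "v \<in> pverts (cycle_graph 3)"
    then have "v = 0 \<or> v = 1 \<or> v = 2" using C by auto
    then show "B v \<subseteq> ?V" "conn ?E (B v)"
      using w bV AU cA by (auto simp: B_def U_def conn_singleton)
  next
    fix u v assume "u \<in> pverts (cycle_graph 3)" "v \<in> pverts (cycle_graph 3)" "u \<noteq> v"
    then show "B u \<inter> B v = {}" using bV AU unfolding C by (auto simp: B_def U_def)
  next
    fix u v assume "(u, v) \<in> parcs (cycle_graph 3)"
    then have "(u, v) \<in> {(0, 1), (1, 2), (2, 0), (1, 0), (2, 1), (0, 2)}" by (rule subsetD[OF C(2)])
    moreover have "(a, w) \<in> ?E" "(b, w) \<in> ?E" "(b, x) \<in> ?E" using symD[OF H'(2)] a b x by blast+
    ultimately show "\<exists>x\<in>B u. \<exists>y\<in>B v. (x, y) \<in> ?E"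
      using a b x aA by (auto simp: B_def)
  qed
qed

text \<open>A minor of a fan is a subgraph of a fan: the branch sets avoiding the apex are intervals of
  the path, and \<open>\<phi>\<close> maps a vertex to the left end of its interval (the apex is \<open>0\<close>).\<close>

lemma minor_fan_layout:
  assumes H: "pair_graph H" and n: "2 \<le> n" and m: "minor H (fan n)"
  obtains \<phi> :: "'a \<Rightarrow> nat" where "inj_on \<phi> (pverts H)"
    and "\<And>u v w. \<lbrakk>(u, v) \<in> parcs H; w \<in> pverts H; \<phi> u \<noteq> 0; \<phi> u < \<phi> w\<rbrakk> \<Longrightarrow> \<phi> v \<le> \<phi> w"
proof -
  have F: "pair_graph (fan n)" by (rule pair_graph_fan[OF n])
  obtain B where B: "\<And>v. v \<in> pverts H \<Longrightarrow> B v \<subseteq> pverts (fan n)"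
    "\<And>v. v \<in> pverts H \<Longrightarrow> conn (parcs (fan n)) (B v)"
    "\<And>u v. \<lbrakk>u \<in> pverts H; v \<in> pverts H; u \<noteq> v\<rbrakk> \<Longrightarrow> B u \<inter> B v = {}"
    "\<And>u v. (u, v) \<in> parcs H \<Longrightarrow> \<exists>x \<in> B u. \<exists>y \<in> B v. (x, y) \<in> parcs (fan n)"
    by (rule minorE[OF m F], rule that)
  \<comment> \<open>Vertex \<open>0\<close> of the fan is the apex, so \<open>\<phi> v = 0\<close>
    holds exactly for the vertex whose branch set contains the apex, if there is one.\<close>
  define \<phi> where "\<phi> = (\<lambda>v. LEAST x. x \<in> B v)"
  have in_B: "\<phi> v \<in> B v" if "v \<in> pverts H" for v
    using conn_nonempty[OF B(2)[OF that]] by (auto simp: \<phi>_def intro: LeastI)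
  have le: "\<phi> v \<le> x" if "x \<in> B v" for v x using that by (simp add: \<phi>_def Least_le)
  have HV: "parcs H \<subseteq> pverts H \<times> pverts H" "irrefl (parcs H)" using H by (auto simp: pair_graph_iff)
  have arc: "y = x + 1 \<or> x = y + 1" if "(x, y) \<in> parcs (fan n)" "x \<noteq> 0" "y \<noteq> 0" for x y
    using that by (auto simp: fan_def graph_of_def)
  have interval: "y \<in> B v" if v: "v \<in> pverts H" "\<phi> v \<noteq> 0" and x: "x \<in> B v" "\<phi> v \<le> y" "y \<le> x" for v x y
  proof (rule ccontr)
    assume y: "y \<notin> B v"
    have pos: "z \<noteq> 0" if "z \<in> B v" for z using le[OF that] v(2) by auto
    have "\<phi> v < y" "y < x" using x y in_B[OF v(1)] by (metis le_neq_implies_less)+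
    then obtain p q where pq: "p \<in> {z \<in> B v. z < y}" "q \<in> B v - {z \<in> B v. z < y}" "(p, q) \<in> parcs (fan n)"
      using connD[OF B(2)[OF v(1)], of "{z \<in> B v. z < y}" "\<phi> v" x] in_B[OF v(1)] x by auto
    then have "q = p + 1 \<or> p = q + 1" using arc[OF pq(3)] pos by auto
    then have "q = y" using pq by auto
    then show False using pq y by simp
  qed
  have inj: "inj_on \<phi> (pverts H)"
    using in_B B(3) by (auto simp: inj_on_def) (metis disjoint_iff)
  \<comment> \<open>An edge avoiding the apex cannot jump over \<open>\<phi> w\<close>:
    \<open>B u\<close> is an interval that avoids \<open>\<phi> w\<close> and hence ends before it,
    and the adjacent \<open>y\<close> is at most one step further.\<close>
  have lay: "\<phi> v \<le> \<phi> w" if uv: "(u, v) \<in> parcs H" and w: "w \<in> pverts H" "\<phi> u \<noteq> 0" "\<phi> u < \<phi> w" for u v w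
  proof (rule ccontr)
    assume "\<not> \<phi> v \<le> \<phi> w"
    then have wv: "\<phi> w < \<phi> v" by simp
    have V: "u \<in> pverts H" "v \<in> pverts H" using uv HV by auto
    have ne: "u \<noteq> w" "v \<noteq> w" "u \<noteq> v" using w(3) wv by auto
    obtain x y where xy: "x \<in> B u" "y \<in> B v" "(x, y) \<in> parcs (fan n)" using B(4)[OF uv] by blast
    have "x \<noteq> 0" "y \<noteq> 0" using le[OF xy(1)] le[OF xy(2)] w(2) wv by auto
    then have "y = x + 1 \<or> x = y + 1" using arc[OF xy(3)] by blast
    then have "y \<le> x + 1" by auto
    have wu: "\<phi> w \<notin> B u" "\<phi> w \<notin> B v" using in_B[OF w(1)] B(3) V w(1) ne by blast+
    have "\<not> \<phi> w \<le> x" using interval[OF V(1) w(2) xy(1)] wu w(3) by auto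
    then have "y \<le> \<phi> w" using \<open>y \<le> x + 1\<close> by simp
    then show False using le[OF xy(2)] wv by simp
  qed
  show thesis by (rule that[OF inj lay])
qed

text \<open>The vertex \<open>u\<close> with the largest \<open>\<phi>\<close> has at most two
  neighbours: one with \<open>\<phi>\<close> equal to \<open>0\<close> and one other, since of two
  others the smaller would have an edge to \<open>u\<close> across the larger. Removing them
  isolates \<open>u\<close>.\<close>

lemma minor_fan_not_3_connected:
  assumes H: "pair_graph H" and n: "2 \<le> n" and m: "minor H (fan n)"
  shows "\<not> k_connected 3 H"
proof
  assume c3: "k_connected 3 H"
  obtain \<phi> :: "'a \<Rightarrow> nat" where inj: "inj_on \<phi> (pverts H)"
    and lay: "\<And>u v w. \<lbrakk>(u, v) \<in> parcs H; w \<in> pverts H; \<phi> u \<noteq> 0; \<phi> u < \<phi> w\<rbrakk> \<Longrightarrow> \<phi> v \<le> \<phi> w"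
    using minor_fan_layout[OF assms] by metis
  let ?V = "pverts H" and ?E = "parcs H"
  have H': "finite ?V" "sym ?E" "irrefl ?E" "?E \<subseteq> ?V \<times> ?V" using H(1) by (auto simp: pair_graph_iff)
  have cV: "3 < card ?V" using c3 by (simp add: k_connected_def)
  then have ne: "?V \<noteq> {}" by auto
  have "Max (\<phi> ` ?V) \<in> \<phi> ` ?V" using H'(1) ne by (intro Max_in) auto
  then obtain u where "u \<in> ?V" "\<phi> u = Max (\<phi> ` ?V)" by auto
  then have u: "u \<in> ?V" "\<And>v. v \<in> ?V \<Longrightarrow> \<phi> v \<le> \<phi> u" using H'(1) by auto
  define N where "N = nb ?E u"
  have NV: "N \<subseteq> ?V" "u \<notin> N" using H' by (auto simp: N_def irrefl_def)
  have fN: "finite N" using NV(1) H'(1) finite_subset by blast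
  have inj': "v = w" if "v \<in> N" "w \<in> N" "\<phi> v = \<phi> w" for v w using that NV inj by (auto dest: inj_onD)
  have eq: "v = w" if vw: "v \<in> N" "w \<in> N" "\<phi> v \<noteq> 0" "\<phi> w \<noteq> 0" for v w
  proof -
    have *: "\<not> \<phi> v < \<phi> w" if "v \<in> N" "w \<in> N" "\<phi> v \<noteq> 0" for v w
    proof
      assume l: "\<phi> v < \<phi> w"
      have "(v, u) \<in> ?E" using that(1) symD[OF H'(2)] by (auto simp: N_def)
      then have "\<phi> u \<le> \<phi> w" using lay[of v u w] that(2,3) l NV by auto
      then have "\<phi> u = \<phi> w" using u(2)[of w] that(2) NV by auto
      then have "u = w" using inj u(1) that(2) NV by (auto dest: inj_onD)
      then show False using that(2) NV(2) by simp
    qed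
    have "\<phi> v = \<phi> w" using *[OF vw(1,2,3)] *[OF vw(2,1,4)] by simp
    then show ?thesis using inj' vw by blast
  qed
  have "card {v \<in> N. \<phi> v = 0} \<le> 1" using fN inj' by (auto simp: card_le_Suc0_iff_eq)
  moreover have "card {v \<in> N. \<phi> v \<noteq> 0} \<le> 1" using fN eq by (auto simp: card_le_Suc0_iff_eq)
  moreover have "N = {v \<in> N. \<phi> v = 0} \<union> {v \<in> N. \<phi> v \<noteq> 0}" by auto
  then have "card N \<le> card {v \<in> N. \<phi> v = 0} + card {v \<in> N. \<phi> v \<noteq> 0}" by (metis card_Un_le)
  ultimately have cN: "card N < 3" by simp
  then have cc: "conn ?E (?V - N)" using c3 NV H by (simp add: k_connected_def induces_connected_iff)
  have "?V - N - {u} \<noteq> {}"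
  proof -
    have "card (insert u N) \<le> 3" using cN fN by (simp add: card_insert_if)
    then have "\<not> ?V \<subseteq> insert u N" using cV card_mono[of "insert u N" ?V] fN by auto
    then show ?thesis by blast
  qed
  then obtain z where "z \<in> ?V - N - {u}" by blast
  then show False using connD[OF cc, of "{u}" u z] u NV(2) by (auto simp: N_def)
qed


section \<open>Outerplanar drawings of minors of fans\<close>

definition parab :: "nat \<Rightarrow> complex" where
  "parab a = Complex (real a) ((real a)\<^sup>2)"

lemma parab_eq_iff [simp]: "parab a = parab b \<longleftrightarrow> a = b"
  by (auto simp: parab_def)

lemma chordD:
  assumes "z \<in> closed_segment (parab a) (parab b)" "a < b"
  shows "real a \<le> Re z" "Re z \<le> real b" "Im z = (real a + real b) * Re z - real a * real b"
proof -
  obtain t where t: "0 \<le> t" "t \<le> 1" "z = (1 - t) *\<^sub>R parab a + t *\<^sub>R parab b"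
    using assms(1) by (auto simp: in_segment)
  have re: "Re z = real a + t * (real b - real a)" and im: "Im z = (1 - t) * (real a)\<^sup>2 + t * (real b)\<^sup>2"
    unfolding t(3) by (simp_all add: parab_def algebra_simps)
  have "0 \<le> t * (real b - real a)" using t assms(2) by simp
  then show "real a \<le> Re z" using re by simp
  have "t * (real b - real a) \<le> 1 * (real b - real a)" using t assms(2) by (intro mult_right_mono) auto
  then show "Re z \<le> real b" using re by simp
  show "Im z = (real a + real b) * Re z - real a * real b"
    unfolding re im by (simp add: algebra_simps power2_eq_square)
qed

lemma chord_parab:
  assumes "parab c \<in> closed_segment (parab a) (parab b)" "a < b"
  shows "c = a \<or> c = b"
proof -
  have "(real c)\<^sup>2 = (real a + real b) * real c - real a * real b"
    using chordD(3)[OF assms] by (simp add: parab_def)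
  then have "(real c - real a) * (real c - real b) = 0" by (simp add: algebra_simps power2_eq_square)
  then show ?thesis by simp
qed

lemma chord_eq_parab:
  assumes "z \<in> closed_segment (parab a) (parab b)" "a < b" "Re z = real c" "c = a \<or> c = b"
  shows "z = parab c"
  using chordD(3)[OF assms(1,2)] assms(3,4)
  by (auto simp: parab_def complex_eq_iff algebra_simps power2_eq_square)

text \<open>On the spoke \<open>Im z = b * Re z\<close>, on the chord
  \<open>Im z = (c + d) * Re z - c * d\<close>. If \<open>d \<le> b\<close>, then
  \<open>(c + d - b) * Re z = c * d\<close> with first factor at most \<open>c\<close>, so
  \<open>Re z\<close> reaches \<open>d\<close>, the right end of the chord.\<close>

lemma spoke_inter_chord:
  fixes b c d :: nat
  assumes z: "z \<in> closed_segment (parab 0) (parab b)" "z \<in> closed_segment (parab c) (parab d)"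
    and o: "0 < b" "0 < c" "c < d" "b \<le> c \<or> d \<le> b"
  shows "\<exists>e\<in>{0, b} \<inter> {c, d}. z = parab e"
  using o(4)
proof
  note s = chordD[OF z(1) o(1)] and t = chordD[OF z(2) o(3)]
  assume "b \<le> c"
  then have "b = c" "Re z = real b" using s t by linarith+
  then show ?thesis using chord_eq_parab[OF z(1) o(1)] by auto
next
  note s = chordD[OF z(1) o(1)] and t = chordD[OF z(2) o(3)]
  assume db: "d \<le> b"
  have eq: "(real c + real d - real b) * Re z = real c * real d" using s(3) t(3) by (simp add: algebra_simps)
  have "0 < Re z" using t(1) o(2) by linarith
  have "(real c + real d - real b) * Re z \<le> real c * Re z"
    using db \<open>0 < Re z\<close> by (intro mult_right_mono) auto
  then have "real c * real d \<le> real c * Re z" using eq by simp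
  then have "real d \<le> Re z" using o(2) by simp
  then have re: "Re z = real d" using t(2) by simp
  then have "real c + real d - real b = real c" using eq o by simp
  then have "b = d" by simp
  then show ?thesis using chord_eq_parab[OF z(2) o(3) re] by auto
qed

text \<open>The vertices sit on a parabola in the order of \<open>\<phi>\<close>, and all edges are chords.\<close>

lemma minor_fan_outerplanar:
  assumes H: "pair_graph H" and n: "2 \<le> n" and m: "minor H (fan n)"
  shows "outerplanar H"
proof -
  obtain \<phi> :: "'a \<Rightarrow> nat" where inj: "inj_on \<phi> (pverts H)"
    and lay: "\<And>u v w. \<lbrakk>(u, v) \<in> parcs H; w \<in> pverts H; \<phi> u \<noteq> 0; \<phi> u < \<phi> w\<rbrakk> \<Longrightarrow> \<phi> v \<le> \<phi> w"
    using minor_fan_layout[OF assms] by metis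
  let ?V = "pverts H" and ?E = "parcs H"
  have H': "finite ?V" "sym ?E" "irrefl ?E" "?E \<subseteq> ?V \<times> ?V" using H(1) by (auto simp: pair_graph_iff)
  define p where "p = (\<lambda>v. parab (\<phi> v))"
  define \<gamma> where "\<gamma> = (\<lambda>(u, v). linepath (p u) (p v))"
  have seg: "path_image (\<gamma> (u, v)) = closed_segment (parab (\<phi> u)) (parab (\<phi> v))" for u v
    by (simp add: \<gamma>_def p_def)
  have \<phi>_eq: "u = v" if "u \<in> ?V" "v \<in> ?V" "\<phi> u = \<phi> v" for u v using inj that by (auto dest: inj_onD)
  have E: "u \<in> ?V" "v \<in> ?V" "u \<noteq> v" "(v, u) \<in> ?E" "\<phi> u \<noteq> \<phi> v" if "(u, v) \<in> ?E" for u v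
  proof -
    show "u \<in> ?V" "v \<in> ?V" "u \<noteq> v" using that H' by (auto simp: irrefl_def)
    then show "\<phi> u \<noteq> \<phi> v" using \<phi>_eq by blast
    show "(v, u) \<in> ?E" using symD[OF H'(2) that] .
  qed
  have cross1: "\<exists>w\<in>{u, v} \<inter> {x, y}. z = p w"
    if uv: "(u, v) \<in> ?E" "\<phi> u < \<phi> v" and xy: "(x, y) \<in> ?E" "\<phi> x < \<phi> y" and ne: "{u, v} \<noteq> {x, y}"
      and z: "z \<in> path_image (\<gamma> (u, v))" "z \<in> path_image (\<gamma> (x, y))" for u v x y z
  proof -
    note z' = z[unfolded seg]
    have V: "u \<in> ?V" "v \<in> ?V" "x \<in> ?V" "y \<in> ?V" using E uv(1) xy(1) by blast+
    have to_w: ?thesis if e: "e \<in> {\<phi> u, \<phi> v} \<inter> {\<phi> x, \<phi> y}" "z = parab e" for e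
    proof -
      have "e \<in> \<phi> ` {u, v}" using e(1) by auto
      then obtain s where s': "e = \<phi> s" "s \<in> {u, v}" by (rule imageE)
      have "e \<in> \<phi> ` {x, y}" using e(1) by auto
      then obtain t where t': "e = \<phi> t" "t \<in> {x, y}" by (rule imageE)
      have st: "s \<in> {u, v}" "t \<in> {x, y}" "\<phi> s = e" "\<phi> t = e" using s' t' by simp_all
      then have "s = t" using \<phi>_eq[of s t] V by auto
      then show ?thesis using st e(2) by (intro bexI[of _ s]) (auto simp: p_def)
    qed
    note s = chordD[OF z'(1) uv(2)] and t = chordD[OF z'(2) xy(2)]
    have l1: "\<phi> w \<le> \<phi> u \<or> \<phi> v \<le> \<phi> w" if "\<phi> u \<noteq> 0" "w \<in> ?V" for w
      using lay[OF uv(1) that(2,1)] by linarith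
    have l2: "\<phi> w \<le> \<phi> x \<or> \<phi> y \<le> \<phi> w" if "\<phi> x \<noteq> 0" "w \<in> ?V" for w
      using lay[OF xy(1) that(2,1)] by linarith
    show ?thesis
    proof (cases "\<phi> u = 0")
      case u0: True
      show ?thesis
      proof (cases "\<phi> x = 0")
        case x0: True
        have "u = x" using \<phi>_eq[OF V(1,3)] u0 x0 by simp
        then have "\<phi> v \<noteq> \<phi> y" "\<phi> y \<noteq> \<phi> v" using ne \<phi>_eq[OF V(2,4)] by auto
        moreover have "Im z = real (\<phi> v) * Re z" using s(3) u0 by simp
        moreover have "Im z = real (\<phi> y) * Re z" using t(3) x0 by simp
        ultimately have "Re z = real 0" by auto
        then have "z = parab 0" using chord_eq_parab[OF z'(1) uv(2)] u0 by auto
        then show ?thesis using to_w[of 0] u0 x0 by simp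
      next
        case False
        have "\<exists>e\<in>{0, \<phi> v} \<inter> {\<phi> x, \<phi> y}. z = parab e"
          using spoke_inter_chord[of z "\<phi> v" "\<phi> x" "\<phi> y"] z' u0 uv(2) xy(2) False l2[OF False V(2)] by simp
        then show ?thesis using to_w u0 by auto
      qed
    next
      case u1: False
      show ?thesis
      proof (cases "\<phi> x = 0")
        case x0: True
        have "\<exists>e\<in>{0, \<phi> y} \<inter> {\<phi> u, \<phi> v}. z = parab e"
          using spoke_inter_chord[of z "\<phi> y" "\<phi> u" "\<phi> v"] z' x0 uv(2) xy(2) u1 l1[OF u1 V(4)] by simp
        then show ?thesis using to_w x0 by auto
      next
        case x1: False
        have "\<not> (\<phi> u = \<phi> x \<and> \<phi> v = \<phi> y)" using ne \<phi>_eq V by blast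
        \<comment> \<open>No value of \<open>\<phi>\<close> lies strictly between the ends of an
          edge avoiding the apex, so two different such edges span intervals that meet at most in an
          end.\<close>
        then have "\<phi> v \<le> \<phi> x \<or> \<phi> y \<le> \<phi> u"
          using l1[OF u1 V(3)] l1[OF u1 V(4)] l2[OF x1 V(1)] l2[OF x1 V(2)] uv(2) xy(2) by linarith
        then show ?thesis
        proof
          assume "\<phi> v \<le> \<phi> x"
          then have "\<phi> v = \<phi> x" "Re z = real (\<phi> v)" using s t by linarith+
          then show ?thesis using to_w[of "\<phi> v"] chord_eq_parab[OF z'(1) uv(2)] by auto
        next
          assume "\<phi> y \<le> \<phi> u"
          then have "\<phi> y = \<phi> u" "Re z = real (\<phi> u)" using s t by linarith+
          then show ?thesis using to_w[of "\<phi> u"] chord_eq_parab[OF z'(1) uv(2)] by auto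
        qed
      qed
    qed
  qed
  have swap: "path_image (\<gamma> (u, v)) = path_image (\<gamma> (v, u))" for u v
    unfolding seg by (rule closed_segment_commute)
  have cross: "path_image (\<gamma> (u, v)) \<inter> path_image (\<gamma> (x, y)) \<subseteq> p ` ({u, v} \<inter> {x, y})"
    if uv: "(u, v) \<in> ?E" and xy: "(x, y) \<in> ?E" and ne: "{u, v} \<noteq> {x, y}" for u v x y
  proof
    fix z assume z: "z \<in> path_image (\<gamma> (u, v)) \<inter> path_image (\<gamma> (x, y))"
    obtain u' v' where u': "(u', v') \<in> ?E" "\<phi> u' < \<phi> v'" "{u', v'} = {u, v}" "z \<in> path_image (\<gamma> (u', v'))"
      using uv z E[OF uv] swap[of u v] by (metis IntD1 insert_commute linorder_neqE_nat)
    obtain x' y' where x': "(x', y') \<in> ?E" "\<phi> x' < \<phi> y'" "{x', y'} = {x, y}" "z \<in> path_image (\<gamma> (x', y'))"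
      using xy z E[OF xy] swap[of x y] by (metis IntD2 insert_commute linorder_neqE_nat)
    have "\<exists>w\<in>{u', v'} \<inter> {x', y'}. z = p w"
      by (rule cross1[OF u'(1,2) x'(1,2) _ u'(4) x'(4)]) (use ne u'(3) x'(3) in simp)
    then show "z \<in> p ` ({u, v} \<inter> {x, y})" unfolding u'(3) x'(3) by blast
  qed
  have ends: "path_image (\<gamma> (u, v)) \<inter> p ` ?V = {p u, p v}" if uv: "(u, v) \<in> ?E" for u v
  proof -
    have *: "c = \<phi> u \<or> c = \<phi> v" if "parab c \<in> path_image (\<gamma> (u, v))" for c
    proof (cases "\<phi> u < \<phi> v")
      case True
      then show ?thesis using chord_parab that unfolding seg by blast
    next
      case False
      then have "\<phi> v < \<phi> u" using E(5)[OF uv] by simp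
      then show ?thesis using chord_parab that unfolding swap[of u v] unfolding seg by blast
    qed
    have "{p u, p v} \<subseteq> path_image (\<gamma> (u, v)) \<inter> p ` ?V"
      using E[OF uv] by (auto simp: seg p_def)
    moreover have "path_image (\<gamma> (u, v)) \<inter> p ` ?V \<subseteq> {p u, p v}"
    proof
      fix z assume "z \<in> path_image (\<gamma> (u, v)) \<inter> p ` ?V"
      then obtain w where w: "z = parab (\<phi> w)" "parab (\<phi> w) \<in> path_image (\<gamma> (u, v))"
        by (auto simp: p_def)
      show "z \<in> {p u, p v}" using *[OF w(2)] w(1) by (auto simp: p_def)
    qed
    ultimately show ?thesis by blast
  qed
  have "plane_drawing H p \<gamma>"
    unfolding plane_drawing_def
  proof (intro conjI)
    show "inj_on p ?V" using inj by (auto simp: inj_on_def p_def)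
    show "\<forall>(u, v)\<in>?E. arc (\<gamma> (u, v)) \<and> pathstart (\<gamma> (u, v)) = p u \<and> pathfinish (\<gamma> (u, v)) = p v \<and>
      path_image (\<gamma> (v, u)) = path_image (\<gamma> (u, v)) \<and> path_image (\<gamma> (u, v)) \<inter> p ` ?V = {p u, p v}"
    proof clarify
      fix u v assume uv: "(u, v) \<in> ?E"
      have "p u \<noteq> p v" using E[OF uv] by (simp add: p_def)
      then have "arc (\<gamma> (u, v))" "pathstart (\<gamma> (u, v)) = p u" "pathfinish (\<gamma> (u, v)) = p v"
        by (simp_all add: \<gamma>_def arc_linepath)
      then show "arc (\<gamma> (u, v)) \<and> pathstart (\<gamma> (u, v)) = p u \<and> pathfinish (\<gamma> (u, v)) = p v \<and>
      path_image (\<gamma> (v, u)) = path_image (\<gamma> (u, v)) \<and> path_image (\<gamma> (u, v)) \<inter> p ` ?V = {p u, p v}"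
        using swap[of v u] ends[OF uv] by blast
    qed
    show "\<forall>(u, v)\<in>?E. \<forall>(x, y)\<in>?E. {u, v} \<noteq> {x, y} \<longrightarrow>
        path_image (\<gamma> (u, v)) \<inter> path_image (\<gamma> (x, y)) \<subseteq> p ` ({u, v} \<inter> {x, y})"
      using cross by fast
  qed
  moreover have "p ` ?V \<subseteq> frontier (outside (drawing_set H p \<gamma>))"
  proof (rule image_subsetI)
    fix v assume v: "v \<in> ?V"
    define a where "a = real (\<phi> v)"
    \<comment> \<open>\<open>K\<close> is the half-plane above the tangent of the parabola at
      \<open>p v\<close>. It is convex and contains the whole drawing, so its complement belongs to
      the outside, and \<open>p v\<close> lies on its boundary.\<close>
    define K where "K = {z. 2 * a * Re z - a\<^sup>2 \<le> Im z}"
    have K: "convex K"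
    proof (rule convexI)
      fix x y :: complex and s t :: real
      assume xy: "x \<in> K" "y \<in> K" and st: "0 \<le> s" "0 \<le> t" "s + t = 1"
      have "s * (2 * a * Re x - a\<^sup>2) + t * (2 * a * Re y - a\<^sup>2) \<le> s * Im x + t * Im y"
        using xy st by (intro add_mono mult_left_mono) (auto simp: K_def)
      moreover have "s * (2 * a * Re x - a\<^sup>2) + t * (2 * a * Re y - a\<^sup>2) = 2 * a * (s * Re x + t * Re y) - (s + t) * a\<^sup>2"
        by (simp add: algebra_simps)
      ultimately show "s *\<^sub>R x + t *\<^sub>R y \<in> K" using st(3) by (simp add: K_def)
    qed
    have pK: "parab b \<in> K" for b
    proof -
      have "0 \<le> (real b - a)\<^sup>2" by simp
      then show ?thesis by (simp add: K_def parab_def power2_eq_square algebra_simps)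
    qed
    let ?S = "drawing_set H p \<gamma>"
    have "?S \<subseteq> K"
    proof -
      have "p ` ?V \<subseteq> K" using pK by (auto simp: p_def)
      moreover have "path_image (\<gamma> e) \<subseteq> K" for e
        using closed_segment_subset[OF pK pK K] by (cases e) (simp add: seg)
      ultimately show ?thesis unfolding drawing_set_def by blast
    qed
    then have out: "- K \<subseteq> outside ?S" using K by (rule outside_subset_convex[rotated])
    have "p v \<in> ?S" using v by (simp add: drawing_set_def)
    then have "p v \<notin> outside ?S" by (simp add: outside_def)
    then have 1: "p v \<notin> interior (outside ?S)" using interior_subset by blast
    have "p v \<in> closure (- K)"
    proof (unfold closure_approachable, intro allI impI)
      fix e :: real assume e: "0 < e"
      let ?y = "p v - Complex 0 (e / 2)"
      have "Re ?y = a" "Im ?y = a\<^sup>2 - e / 2" by (simp_all add: p_def parab_def a_def)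
      then have "?y \<in> - K" using e by (simp add: K_def power2_eq_square)
      moreover have "dist ?y (p v) < e" using e by (simp add: dist_norm cmod_def)
      ultimately show "\<exists>y\<in>- K. dist y (p v) < e" by blast
    qed
    then have "p v \<in> closure (outside ?S)" using closure_mono[OF out] by blast
    then show "p v \<in> frontier (outside ?S)" using 1 by (simp add: frontier_def)
  qed
  ultimately show ?thesis unfolding outerplanar_def by blast
qed

section \<open>Cycle minors of cones\<close>

text \<open>A minor of a bare relation, without a vertex set: for \<open>p \<ge> 2\<close> the
  linking arcs force every branch set to meet the field of \<open>T\<close>.\<close>

definition path_minor :: "nat \<Rightarrow> 'a rel \<Rightarrow> bool" where
  "path_minor p T \<longleftrightarrow> (\<exists>B. (\<forall>i<p. conn T (B i)) \<and> (\<forall>i<p. \<forall>j<p. i \<noteq> j \<longrightarrow> B i \<inter> B j = {}) \<and>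
     (\<forall>i. Suc i < p \<longrightarrow> (\<exists>x\<in>B i. \<exists>y\<in>B (Suc i). (x, y) \<in> T)))"

text \<open>At most one branch set of a cycle minor contains the apex; removing it leaves a path minor
  of the base.\<close>

lemma cone_no_cycle_minor:
  assumes c: "pair_graph (cone v S T)" and v: "v \<notin> S" and T: "T \<subseteq> S \<times> S"
    and np: "\<not> path_minor p T"
  shows "\<not> minor (cycle_graph (Suc p)) (cone v S T)"
proof
  let ?N = "Suc p" and ?G = "cone v S T"
  assume m: "minor (cycle_graph ?N) ?G"
  have V: "pverts (cycle_graph ?N) = {0..<?N}" by (simp add: cycle_graph_def graph_of_def)
  obtain B where B: "\<And>w. w \<in> pverts (cycle_graph ?N) \<Longrightarrow> B w \<subseteq> pverts ?G"
      "\<And>w. w \<in> pverts (cycle_graph ?N) \<Longrightarrow> conn (parcs ?G) (B w)"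
      "\<And>u w. \<lbrakk>u \<in> pverts (cycle_graph ?N); w \<in> pverts (cycle_graph ?N); u \<noteq> w\<rbrakk> \<Longrightarrow> B u \<inter> B w = {}"
      "\<And>u w. (u, w) \<in> parcs (cycle_graph ?N) \<Longrightarrow> \<exists>x\<in>B u. \<exists>y\<in>B w. (x, y) \<in> parcs ?G"
    by (rule minorE[OF m c], rule that)
  \<comment> \<open>\<open>j\<close> is the branch set to be discarded: the one with the apex, or an
    arbitrary one if the apex is in none.\<close>
  have "\<exists>j<?N. \<forall>i<?N. i \<noteq> j \<longrightarrow> v \<notin> B i"
  proof (cases "\<exists>j<?N. v \<in> B j")
    case True
    then obtain j where j: "j < ?N" "v \<in> B j" by blast
    have "v \<notin> B i" if "i < ?N" "i \<noteq> j" for i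
      using B(3)[of i j] j that unfolding V by (auto simp del: atLeastLessThan_iff simp: lessThan_atLeast0[symmetric])
    then show ?thesis using j by blast
  qed auto
  then obtain j where j: "j < ?N" "\<And>i. \<lbrakk>i < ?N; i \<noteq> j\<rbrakk> \<Longrightarrow> v \<notin> B i" by blast
  \<comment> \<open>\<open>f\<close> runs around the cycle starting just after \<open>j\<close>, so
    that \<open>f p = j\<close> comes last and consecutive values stay adjacent.\<close>
  define f where "f = (\<lambda>i. (j + 1 + i) mod ?N)"
  have f: "f i < ?N" for i by (simp add: f_def)
  have f_if: "f a = (if j + 1 + a < ?N then j + 1 + a else j + 1 + a - ?N)" if "a < ?N" for a
    using j(1) that by (auto simp: f_def le_mod_geq)
  have finj: "f a = f b \<longleftrightarrow> a = b" if "a < ?N" "b < ?N" for a b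
    using f_if[OF that(1)] f_if[OF that(2)] j(1) that by (auto split: if_splits)
  have fp: "f p = j" using f_if[of p] j(1) by simp
  have fj: "f i \<noteq> j" if "i < p" for i using finj[of i p] that fp by simp
  have fS: "f (Suc i) = Suc (f i) mod ?N" for i by (simp add: f_def mod_Suc_eq)
  have vB: "v \<notin> B (f i)" if "i < p" for i using j(2)[OF f fj[OF that]] .
  have inT: "(x, y) \<in> T" if "(x, y) \<in> parcs ?G" "x \<noteq> v" "y \<noteq> v" for x y using that by auto
  have "path_minor p T"
    unfolding path_minor_def
  proof (intro exI[of _ "\<lambda>i. B (f i)"] conjI allI impI)
    fix i assume i: "i < p"
    have "conn (parcs ?G) (B (f i))" using B(2)[of "f i"] f[of i] by (simp add: V)
    then show "conn T (B (f i))" by (rule conn_mono) (use inT vB[OF i] in blast)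
  next
    fix a b assume ab: "a < p" "b < p" "a \<noteq> b"
    then have "f a \<noteq> f b" using finj[of a b] by simp
    then show "B (f a) \<inter> B (f b) = {}" using B(3)[of "f a" "f b"] f by (simp add: V)
  next
    fix i assume i: "Suc i < p"
    have "(f i, f (Suc i)) \<in> parcs (cycle_graph ?N)"
      using f[of i] unfolding fS by (auto simp: cycle_graph_def graph_of_def)
    then obtain x y where xy: "x \<in> B (f i)" "y \<in> B (f (Suc i))" "(x, y) \<in> parcs ?G" using B(4) by blast
    then have "x \<noteq> v" "y \<noteq> v" using vB[of i] vB[of "Suc i"] i by auto
    then show "\<exists>x\<in>B (f i). \<exists>y\<in>B (f (Suc i)). (x, y) \<in> T" using xy inT by blast
  qed
  then show False using np by simp
qed

text \<open>The middle branch set has arcs to both sides. If they start at the same vertex, it has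
  two partners; otherwise connectedness inside the branch set gives \<open>b\<close> a second
  partner.\<close>

lemma matching_no_path_minor:
  assumes T: "sym T" "\<And>x y z. \<lbrakk>(x, y) \<in> T; (x, z) \<in> T\<rbrakk> \<Longrightarrow> y = z"
  shows "\<not> path_minor 3 T"
proof
  assume "path_minor 3 T"
  then obtain B where B: "\<And>i. i < 3 \<Longrightarrow> conn T (B i)" "\<And>i j. \<lbrakk>i < 3; j < 3; i \<noteq> j\<rbrakk> \<Longrightarrow> B i \<inter> B j = {}"
     "\<And>i. Suc i < 3 \<Longrightarrow> \<exists>x\<in>B i. \<exists>y\<in>B (Suc i). (x, y) \<in> T" for i j :: nat
    unfolding path_minor_def by blast
  obtain a b where ab: "a \<in> B 0" "b \<in> B 1" "(a, b) \<in> T" using B(3)[of 0] by auto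
  obtain c d where cd: "c \<in> B 1" "d \<in> B 2" "(c, d) \<in> T" using B(3)[of 1] by (auto simp: numeral_2_eq_2)
  have ba: "(b, a) \<in> T" using symD[OF T(1) ab(3)] .
  show False
  proof (cases "b = c")
    case True
    then have "a = d" using T(2)[OF ba, of d] cd(3) by simp
    then show False using B(2)[of 0 2] ab(1) cd(2) by auto
  next
    case False
    then obtain e where e: "e \<in> B 1" "(b, e) \<in> T"
      using connD[OF B(1)[of 1], of "{b}" b c] ab cd by auto
    then have "e = a" using T(2)[OF ba, of e] by simp
    then show False using B(2)[of 0 1] ab(1) e(1) by auto
  qed
qed

text \<open>Encodes a rooted forest with at most \<open>l\<close> levels: the unique neighbour of
  smaller rank is the parent. Ranks decrease towards the root but may skip levels.\<close>

definition ranked :: "nat \<Rightarrow> 'a set \<Rightarrow> 'a rel \<Rightarrow> ('a \<Rightarrow> nat) \<Rightarrow> bool" where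
  "ranked l S T r \<longleftrightarrow> T \<subseteq> S \<times> S \<and> sym T \<and> (\<forall>x\<in>S. r x < l) \<and> (\<forall>(x, y)\<in>T. r x \<noteq> r y) \<and>
     (\<forall>x y z. (x, y) \<in> T \<and> (x, z) \<in> T \<and> r y < r x \<and> r z < r x \<longrightarrow> y = z)"

text \<open>In a connected part of a forest all vertices descend, without leaving the part, to one
  vertex of smallest rank. A descending arc that leaves \<open>B\<close> therefore starts there and
  leads to its unique parent.\<close>

lemma ranked_unique_exit:
  assumes r: "ranked l S T r" and B: "conn T B"
    and x: "x \<in> B" "(x, y) \<in> T" "r y < r x" "y \<notin> B"
  shows "z \<in> B \<Longrightarrow> r x \<le> r z"
    and "\<lbrakk>z \<in> B; (z, w) \<in> T; r w < r z; w \<notin> B\<rbrakk> \<Longrightarrow> z = x \<and> w = y"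
proof -
  let ?U = "{(a, b). (a, b) \<in> T \<and> a \<in> B \<and> b \<in> B \<and> r b < r a}"
  have s: "sym T" using r by (simp add: ranked_def)
  have ne: "r a \<noteq> r b" if "(a, b) \<in> T" for a b using r that by (auto simp: ranked_def)
  have uniq: "b = c" if "(a, b) \<in> T" "(a, c) \<in> T" "r b < r a" "r c < r a" for a b c
    using r that unfolding ranked_def by blast
  \<comment> \<open>\<open>D\<close> consists of the vertices that descend to \<open>x\<close>
    inside \<open>B\<close>. A cut arc \<open>(d, e)\<close> with lower \<open>e\<close> would be
    the parent arc of \<open>d\<close>, but that one stays in \<open>D\<close> or is the exit to
    \<open>y\<close>; with higher \<open>e\<close> it puts \<open>e\<close> into
    \<open>D\<close>.\<close>
  define D where "D = {z \<in> B. (z, x) \<in> ?U\<^sup>*}"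
  have "D = B"
  proof (rule ccontr)
    assume "D \<noteq> B"
    then obtain z where z: "z \<in> B - D" by (auto simp: D_def)
    have "x \<in> D" using x by (simp add: D_def)
    then obtain d e where de: "d \<in> D" "e \<in> B - D" "(d, e) \<in> T"
      using connD[OF B, of D x z] z by (auto simp: D_def)
    have dB: "d \<in> B" "(d, x) \<in> ?U\<^sup>*" using de(1) by (auto simp: D_def)
    show False
    proof (cases "r e < r d")
      case True
      show False
      proof (cases "d = x")
        case True
        then show False using uniq[of x e y] de x \<open>r e < r d\<close> by auto
      next
        case False
        then obtain f where f: "(d, f) \<in> ?U" "(f, x) \<in> ?U\<^sup>*" using dB(2) by (meson converse_rtranclE)
        then have "f = e" using uniq[of d f e] de True by auto
        then show False using f(2) de(2) by (simp add: D_def)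
      qed
    next
      case False
      then have "(e, d) \<in> ?U" using ne[OF de(3)] de(2) dB(1) symD[OF s de(3)] by auto
      then have "(e, x) \<in> ?U\<^sup>*" using dB(2) by (rule converse_rtrancl_into_rtrancl)
      then show False using de(2) by (simp add: D_def)
    qed
  qed
  then have reach: "(z, x) \<in> ?U\<^sup>*" if "z \<in> B" for z using that by (auto simp: D_def)
  show "r x \<le> r z" if "z \<in> B" for z
    using reach[OF that] by (induction rule: converse_rtrancl_induct) auto
  show "z = x \<and> w = y" if z: "z \<in> B" "(z, w) \<in> T" "r w < r z" "w \<notin> B" for z w
  proof -
    have "z = x"
    proof (rule ccontr)
      assume "z \<noteq> x"
      then obtain f where "(z, f) \<in> ?U" using reach[OF z(1)] by (meson converse_rtranclE)
      then have "f = w" "f \<in> B" using uniq[of z f w] z by auto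
      then show False using z(4) by simp
    qed
    then show ?thesis using uniq[of x w y] z x by auto
  qed
qed

text \<open>Along a path minor of a forest the depth of the branch sets has no local maximum.\<close>

lemma ranked_no_path_minor:
  assumes r: "ranked l S T r" and l: "1 \<le> l"
  shows "\<not> path_minor (2 * l) T"
proof
  assume "path_minor (2 * l) T"
  then obtain B where B: "\<And>i. i < 2 * l \<Longrightarrow> conn T (B i)"
    "\<And>i j. \<lbrakk>i < 2 * l; j < 2 * l; i \<noteq> j\<rbrakk> \<Longrightarrow> B i \<inter> B j = {}"
     "\<And>i. Suc i < 2 * l \<Longrightarrow> \<exists>x\<in>B i. \<exists>y\<in>B (Suc i). (x, y) \<in> T"
    unfolding path_minor_def by blast
  have T: "T \<subseteq> S \<times> S" "sym T" "\<And>x. x \<in> S \<Longrightarrow> r x < l" "\<And>x y. (x, y) \<in> T \<Longrightarrow> r x \<noteq> r y"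
    using r by (auto simp: ranked_def)
  define h where "h = (\<lambda>i. LEAST k. k \<in> r ` B i)"
  have h_le: "h i \<le> r x" if "x \<in> B i" for i x using that by (auto simp: h_def intro: Least_le)
  \<comment> \<open>\<open>up i j\<close> says that the parent of some vertex of \<open>B i\<close>
    lies in \<open>B j\<close>. By \<open>ranked_unique_exit\<close> there is at most one such
    \<open>j\<close> other than \<open>i\<close>, and the smallest rank drops from \<open>i\<close>
    to \<open>j\<close>.\<close>
  define up where "up = (\<lambda>i j. \<exists>x\<in>B i. \<exists>y\<in>B j. (x, y) \<in> T \<and> r y < r x)"
  have ex: "\<exists>x\<in>B i. \<exists>y\<in>B j. (x, y) \<in> T \<and> r y < r x \<and> y \<notin> B i" if "up i j" "i < 2 * l" "j < 2 * l" "i \<noteq> j" for i j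
    using that B(2)[of i j] unfolding up_def by blast
  have up_less: "h j < h i" if u: "up i j" "i < 2 * l" "j < 2 * l" "i \<noteq> j" for i j
  proof -
    obtain x y where xy: "x \<in> B i" "y \<in> B j" "(x, y) \<in> T" "r y < r x" "y \<notin> B i" using ex[OF u] by blast
    have "h i \<in> r ` B i" unfolding h_def by (rule LeastI[of _ "r x"]) (rule imageI[OF xy(1)])
    then have "r x \<le> h i" using ranked_unique_exit(1)[OF r B(1)[OF u(2)] xy(1,3,4,5)] by auto
    then show ?thesis using h_le[OF xy(2)] xy(4) by simp
  qed
  have up_uniq: "j = k" if u: "up i j" "up i k" "i < 2 * l" "j < 2 * l" "k < 2 * l" "i \<noteq> j" "i \<noteq> k" for i j k
  proof -
    obtain x y where xy: "x \<in> B i" "y \<in> B j" "(x, y) \<in> T" "r y < r x" "y \<notin> B i"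
      using ex[OF u(1,3,4,6)] by blast
    obtain z w where zw: "z \<in> B i" "w \<in> B k" "(z, w) \<in> T" "r w < r z" "w \<notin> B i"
      using ex[OF u(2,3,5,7)] by blast
    have "w = y" using ranked_unique_exit(2)[OF r B(1)[OF u(3)] xy(1,3,4,5) zw(1,3,4,5)] by simp
    then show ?thesis using B(2)[of j k] u(4,5) xy(2) zw(2) by blast
  qed
  have adj: "up i (Suc i) \<or> up (Suc i) i" if i: "Suc i < 2 * l" for i
  proof -
    obtain x y where xy: "x \<in> B i" "y \<in> B (Suc i)" "(x, y) \<in> T" using B(3)[OF i] by blast
    have "r x < r y \<or> r y < r x" using T(4)[OF xy(3)] by linarith
    then show ?thesis using xy symD[OF T(2) xy(3)] unfolding up_def by blast
  qed
  have bound: "h i < l" if i: "i < 2 * l" "i = 0 \<or> i = 2 * l - 1" for i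
  proof -
    have "\<exists>x\<in>B i. x \<in> S"
    proof (cases "i = 0")
      case True
      then show ?thesis using B(3)[of 0] T(1) l by fastforce
    next
      case False
      then obtain k where "i = Suc k" by (cases i) auto
      then show ?thesis using B(3)[of k] T(1) i by fastforce
    qed
    then obtain x where "x \<in> B i" "x \<in> S" by blast
    then show ?thesis using h_le T(3) by (meson le_less_trans)
  qed
  obtain m where m: "l = Suc m" using l by (cases l) auto
  \<comment> \<open>The middle indices are \<open>m\<close> and \<open>m + 1\<close>. Whichever way
    their arc points, uniqueness of the exit makes the smallest rank grow strictly from there
    outwards, up to at least \<open>m + 1 = l\<close> at one end of the path, where it is below
    \<open>l\<close>.\<close>
  from adj[of m] m consider "up (Suc m) m" | "up m (Suc m)" by auto
  then show False
  proof cases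
    case 1
    have "up (m + j + 1) (m + j) \<and> j < h (m + j + 1)" if "m + j + 1 < 2 * l" for j
      using that
    proof (induction j)
      case 0
      then show ?case using 1 up_less[of "Suc m" m] by simp
    next
      case (Suc j)
      then have IH: "up (m + j + 1) (m + j)" "j < h (m + j + 1)" by auto
      have "\<not> up (m + j + 1) (m + j + 2)" using up_uniq[OF IH(1), of "m + j + 2"] Suc.prems by auto
      then have u: "up (m + j + 2) (m + j + 1)" using adj[of "m + j + 1"] Suc.prems by auto
      then have "h (m + j + 1) < h (m + j + 2)" using up_less[OF u] Suc.prems by auto
      then show ?case using u IH(2) by simp
    qed
    from this[of m] have "m < h (m + m + 1)" using m by simp
    moreover have "h (m + m + 1) < l" by (rule bound) (use m in auto)
    ultimately show False using m by simp
  next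
    case 2
    have "up (m - j) (m - j + 1) \<and> j < h (m - j)" if "j \<le> m" for j
      using that
    proof (induction j)
      case 0
      then show ?case using 2 up_less[of m "Suc m"] m by simp
    next
      case (Suc j)
      define i where "i = m - Suc j"
      have i: "m - j = i + 1" "i + 2 < 2 * l" using Suc.prems m by (auto simp: i_def)
      have IH: "up (i + 1) (i + 2)" "j < h (i + 1)" using Suc i by auto
      have "\<not> up (i + 1) i" using up_uniq[OF IH(1), of i] i(2) by auto
      then have u: "up i (i + 1)" using adj[of i] i(2) by auto
      then have "h (i + 1) < h i" using up_less[OF u] i(2) by auto
      then show ?case using u IH(2) unfolding i_def[symmetric] by simp
    qed
    from this[of m] have "m < h 0" by simp
    moreover have "h 0 < l" by (rule bound) (use m in auto)
    ultimately show False using m by simp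
  qed
qed


section \<open>Families of bases of cones\<close>

lemma pair_graph_cone:
  assumes "finite S" "v \<notin> S" "T \<subseteq> S \<times> S" "sym T" "irrefl T"
  shows "pair_graph (cone v S T)"
  using assms by (auto simp: pair_graph_iff sym_def irrefl_def)

definition path_arcs :: "nat \<Rightarrow> (nat \<Rightarrow> nat) \<Rightarrow> nat rel" where
  "path_arcs k p = {(p i, p (Suc i)) | i. Suc i < k} \<union> {(p (Suc i), p i) | i. Suc i < k}"

text \<open>\<open>p\<close> fixes \<open>0\<close>, which becomes an end of the path and removes
  the reversal symmetry: after a known initial piece the next vertex is the neighbour that is not
  the predecessor.\<close>

lemma path_arcs_inj:
  assumes p: "p permutes {1..<k}" and q: "q permutes {1..<k}" and eq: "path_arcs k p = path_arcs k q"
  shows "p = q"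
proof
  have inj: "inj p" "inj q" using p q permutes_inj by blast+
  have ind: "i < k \<Longrightarrow> \<forall>j\<le>i. p j = q j" for i
  proof (induction i)
    case 0
    then show ?case using p q by (simp add: permutes_not_in)
  next
    case (Suc i)
    then have IH: "\<And>j. j \<le> i \<Longrightarrow> p j = q j" by auto
    have "(p i, p (Suc i)) \<in> path_arcs k p" using Suc.prems by (auto simp: path_arcs_def)
    then have "(q i, p (Suc i)) \<in> path_arcs k q" using eq IH by simp
    then consider m where "q i = q m" "p (Suc i) = q (Suc m)" | m where "q i = q (Suc m)" "p (Suc i) = q m"
      by (auto simp: path_arcs_def)
    then have "p (Suc i) = q (Suc i)"
    proof cases
      case 1
      then show ?thesis using injD[OF inj(2) 1(1)] by simp
    next
      case 2
      have "i = Suc m" using injD[OF inj(2) 2(1)] .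
      then have "p (Suc i) = p m" using 2 IH by simp
      then have "Suc i = m" by (rule injD[OF inj(1)])
      then show ?thesis using \<open>i = Suc m\<close> by simp
    qed
    then show ?case using IH by (auto simp: le_Suc_eq)
  qed
  fix x show "p x = q x"
  proof (cases "x < k")
    case True
    then show ?thesis using ind[of x] by blast
  next
    case False
    then show ?thesis using p q by (simp add: permutes_not_in)
  qed
qed

lemma path_family:
  assumes k: "1 \<le> k"
  defines "F \<equiv> path_arcs k ` {p. p permutes {1..<k}}"
  shows "card F = fact (k - 1)"
    and "\<And>T. T \<in> F \<Longrightarrow> T \<subseteq> {0..<k} \<times> {0..<k} \<and> pair_graph (cone k {0..<k} T) \<and> minor (cone k {0..<k} T) (fan (k + 1))"
proof -
  have "card F = card {p. p permutes {1..<k}}"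
    unfolding F_def
  proof (rule card_image[OF inj_onI])
    fix p q assume "p \<in> {p. p permutes {1..<k}}" "q \<in> {p. p permutes {1..<k}}" "path_arcs k p = path_arcs k q"
    then show "p = q" using path_arcs_inj[of p k q] by simp
  qed
  then show "card F = fact (k - 1)" by (simp add: card_permutations)
  fix T assume "T \<in> F"
  then obtain p where p: "p permutes {1..<k}" and T: "T = path_arcs k p" by (auto simp: F_def)
  have p': "p permutes {0..<k}" using permutes_subset[OF p, of "{0..<k}"] by auto
  have inj: "inj p" using p permutes_inj by blast
  have mem: "p i < k" if "i < k" for i using permutes_in_image[OF p', of i] that by simp
  have TS: "T \<subseteq> {0..<k} \<times> {0..<k}" unfolding T path_arcs_def using mem by auto
  have "sym T" unfolding T path_arcs_def by (auto simp: sym_def)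
  moreover have "irrefl T" unfolding T path_arcs_def by (auto simp: irrefl_def inj_eq[OF inj])
  ultimately have pg: "pair_graph (cone k {0..<k} T)" using TS by (intro pair_graph_cone) auto
  \<comment> \<open>Position on the path, shifted by one because \<open>0\<close> is the apex of the
    fan.\<close>
  let ?f = "\<lambda>x. if x = k then 0 else inv p x + 1"
  have invp: "inv p (p i) = i" for i using inj by simp
  have invk: "inv p x < k" if "x < k" for x
    using permutes_in_image[OF permutes_inv[OF p'], of x] that by simp
  have "minor (cone k {0..<k} T) (fan (k + 1))"
  proof (rule minor_embed[of _ ?f])
    show "pair_graph (fan (k + 1))" using k by (intro pair_graph_fan) simp
    show "inj_on ?f (pverts (cone k {0..<k} T))"
      by (auto simp: inj_on_def inj_eq[OF permutes_inj[OF permutes_inv[OF p']]])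
    show "?f ` pverts (cone k {0..<k} T) \<subseteq> pverts (fan (k + 1))"
      using invk by (auto simp: fan_def graph_of_def)
    fix u v assume "(u, v) \<in> parcs (cone k {0..<k} T)"
    then have "(u, v) \<in> T \<or> u = k \<and> v < k \<or> u < k \<and> v = k" by auto
    then show "(?f u, ?f v) \<in> parcs (fan (k + 1))"
    proof (elim disjE)
      assume "(u, v) \<in> T"
      then obtain i where i: "Suc i < k" "u = p i \<and> v = p (Suc i) \<or> u = p (Suc i) \<and> v = p i"
        unfolding T path_arcs_def by auto
      have "p i \<noteq> k" "p (Suc i) \<noteq> k" using mem[of i] mem[of "Suc i"] i(1) by auto
      then have "(?f u, ?f v) = (i + 1, i + 2) \<or> (?f u, ?f v) = (i + 2, i + 1)" using i(2) invp by auto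
      then show ?thesis using i(1) by (auto simp: fan_def graph_of_def)
    qed (use invk in \<open>auto simp: fan_def graph_of_def\<close>)
  qed
  with TS pg show "T \<subseteq> {0..<k} \<times> {0..<k} \<and> pair_graph (cone k {0..<k} T) \<and> minor (cone k {0..<k} T) (fan (k + 1))"
    by blast
qed

text \<open>Perfect matchings between \<open>{0..<j}\<close> and \<open>{j..<2 * j}\<close> only.
  All perfect matchings on \<open>2 * j\<close> points are at most \<open>2 ^ j\<close> times as
  many, a gain that the exponential factor of the bound would hide.\<close>

definition matching_arcs :: "nat \<Rightarrow> (nat \<Rightarrow> nat) \<Rightarrow> nat rel" where
  "matching_arcs j p = {(i, j + p i) | i. i < j} \<union> {(j + p i, i) | i. i < j}"

lemma matching_family:
  defines "F \<equiv> \<lambda>j. matching_arcs j ` {p. p permutes {0..<j}}"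
  shows "card (F j) = fact j"
    and "\<And>T. T \<in> F j \<Longrightarrow> T \<subseteq> {0..<2 * j} \<times> {0..<2 * j} \<and> pair_graph (cone (2 * j) {0..<2 * j} T) \<and>
      \<not> minor (cycle_graph 4) (cone (2 * j) {0..<2 * j} T)"
proof -
  have "inj_on (matching_arcs j) {p. p permutes {0..<j}}"
  proof (rule inj_onI)
    fix p q assume pq: "p \<in> {p. p permutes {0..<j}}" "q \<in> {p. p permutes {0..<j}}"
      "matching_arcs j p = matching_arcs j q"
    show "p = q"
    proof
      fix i show "p i = q i"
      proof (cases "i < j")
        case True
        then have "(i, j + p i) \<in> matching_arcs j q" using pq(3) by (auto simp: matching_arcs_def)
        then show ?thesis using True by (auto simp: matching_arcs_def)
      next
        case False
        then show ?thesis using pq by (simp add: permutes_not_in)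
      qed
    qed
  qed
  then have "card (F j) = card {p. p permutes {0..<j}}" unfolding F_def by (rule card_image)
  then show "card (F j) = fact j" by (simp add: card_permutations)
  fix T assume "T \<in> F j"
  then obtain p where p: "p permutes {0..<j}" and T: "T = matching_arcs j p" by (auto simp: F_def)
  have mem: "p i < j" if "i < j" for i using permutes_in_image[OF p, of i] that by simp
  have inj: "inj p" using permutes_inj[OF p] .
  have TS: "T \<subseteq> {0..<2 * j} \<times> {0..<2 * j}" unfolding T matching_arcs_def using mem by force
  have s: "sym T" unfolding T matching_arcs_def by (auto simp: sym_def)
  have "irrefl T" unfolding T matching_arcs_def by (auto simp: irrefl_def)
  then have pg: "pair_graph (cone (2 * j) {0..<2 * j} T)" using TS s by (intro pair_graph_cone) auto
  have "\<not> path_minor 3 T"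
  proof (rule matching_no_path_minor[OF s])
    fix x y z assume xy: "(x, y) \<in> T" "(x, z) \<in> T"
    show "y = z"
      using xy unfolding T matching_arcs_def by (auto simp: inj_eq[OF inj])
  qed
  then have "\<not> minor (cycle_graph (Suc 3)) (cone (2 * j) {0..<2 * j} T)"
    by (intro cone_no_cycle_minor[OF pg _ TS]) auto
  with TS pg show "T \<subseteq> {0..<2 * j} \<times> {0..<2 * j} \<and> pair_graph (cone (2 * j) {0..<2 * j} T) \<and>
      \<not> minor (cycle_graph 4) (cone (2 * j) {0..<2 * j} T)" by simp
qed

definition forests :: "nat \<Rightarrow> nat \<Rightarrow> nat rel set" where
  "forests l k = {T. \<exists>r. ranked l {0..<k} T r}"

lemma finite_forests: "finite (forests l k)"
  by (rule finite_subset[of _ "Pow ({0..<k} \<times> {0..<k})"]) (auto simp: forests_def ranked_def)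

lemma forests_cone:
  assumes "T \<in> forests l k" "1 \<le> l"
  shows "T \<subseteq> {0..<k} \<times> {0..<k} \<and> pair_graph (cone k {0..<k} T) \<and>
    \<not> minor (cycle_graph (2 * l + 1)) (cone k {0..<k} T)"
proof -
  obtain r where r: "ranked l {0..<k} T r" using assms by (auto simp: forests_def)
  then have TS: "T \<subseteq> {0..<k} \<times> {0..<k}" and s: "sym T" and i: "irrefl T"
    by (auto simp: ranked_def irrefl_def)
  have pg: "pair_graph (cone k {0..<k} T)" using TS s i by (intro pair_graph_cone) auto
  have "\<not> minor (cycle_graph (Suc (2 * l))) (cone k {0..<k} T)"
    by (intro cone_no_cycle_minor[OF pg _ TS] ranked_no_path_minor[OF r assms(2)]) auto
  with TS pg show ?thesis by simp
qed

text \<open>Each of the \<open>k - s\<close> remaining vertices is attached as a leaf of rank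
  \<open>l\<close> to an arbitrary one of the first \<open>s\<close> vertices. Forest and attachment
  can be read off again, the forest being the arcs among the first \<open>s\<close> vertices. The
  parameter \<open>s\<close> is chosen in \<open>forests_count\<close>.\<close>

lemma forests_Suc:
  assumes s: "s \<le> k"
  shows "card (forests l s) * s ^ (k - s) \<le> card (forests (Suc l) k)"
proof -
  define P where "P = PiE {s..<k} (\<lambda>_. {0..<s})"
  define g where "g = (\<lambda>(T :: nat rel, f :: nat \<Rightarrow> nat). T \<union> {(x, f x) | x. x \<in> {s..<k}} \<union> {(f x, x) | x. x \<in> {s..<k}})"
  have cP: "card P = s ^ (k - s)" by (simp add: P_def card_PiE)
  have fP: "f x < s" if "f \<in> P" "s \<le> x" "x < k" for f x using that by (auto simp: P_def dest: PiE_mem)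
  have TF: "T \<subseteq> {0..<s} \<times> {0..<s}" if "T \<in> forests l s" for T using that by (auto simp: forests_def ranked_def)
  have "card (forests l s \<times> P) \<le> card (forests (Suc l) k)"
  proof (rule card_inj_on_le)
    show "inj_on g (forests l s \<times> P)"
    proof (rule inj_onI, clarify)
      fix T f T' f'
      assume T: "T \<in> forests l s" "T' \<in> forests l s" and f: "f \<in> P" "f' \<in> P" and eq: "g (T, f) = g (T', f')"
      have rest: "T = g (T, f) \<inter> {0..<s} \<times> {0..<s}" if "T \<in> forests l s" "f \<in> P" for T f
        using TF[OF that(1)] fP[OF that(2)] by (auto simp: g_def)
      have "T = T'" using rest[OF T(1) f(1)] rest[OF T(2) f(2)] eq by simp
      moreover have "f = f'"
      proof (rule PiE_ext[OF f[unfolded P_def]])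
        fix x assume x: "x \<in> {s..<k}"
        have "(x, f x) \<in> g (T', f')" using x eq unfolding g_def by auto
        moreover have "(x, f x) \<notin> T'" using TF[OF T(2)] x by auto
        moreover have "\<not> (\<exists>y\<in>{s..<k}. x = f' y)" using fP[OF f(2)] x by fastforce
        ultimately show "f x = f' x" unfolding g_def by auto
      qed
      ultimately show "T = T' \<and> f = f'" by simp
    qed
    show "g ` (forests l s \<times> P) \<subseteq> forests (Suc l) k"
    proof (rule image_subsetI, clarify)
      fix T f assume T: "T \<in> forests l s" and f: "f \<in> P"
      obtain r where r: "ranked l {0..<s} T r" using T by (auto simp: forests_def)
      then have r': "T \<subseteq> {0..<s} \<times> {0..<s}" "sym T" "\<And>x. x < s \<Longrightarrow> r x < l"
        "\<And>x y. (x, y) \<in> T \<Longrightarrow> r x \<noteq> r y"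
        "\<And>x y z. \<lbrakk>(x, y) \<in> T; (x, z) \<in> T; r y < r x; r z < r x\<rbrakk> \<Longrightarrow> y = z"
        unfolding ranked_def by (fastforce, fastforce, fastforce, fastforce, blast)
      define r2 where "r2 = (\<lambda>x. if x < s then r x else l)"
      have f': "f x < s" if "s \<le> x" "x < k" for x using fP[OF f that] .
      have cases: "(x, y) \<in> g (T, f) \<longleftrightarrow> (x, y) \<in> T \<or> s \<le> x \<and> x < k \<and> y = f x \<or> s \<le> y \<and> y < k \<and> x = f y" for x y
        by (auto simp: g_def)
      have Tin: "x < s \<and> y < s" if "(x, y) \<in> T" for x y using r'(1) that by auto
      have "ranked (Suc l) {0..<k} (g (T, f)) r2"
        unfolding ranked_def
      proof (intro conjI allI impI ballI)
        show "g (T, f) \<subseteq> {0..<k} \<times> {0..<k}" using Tin f' s by (force simp: cases)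
        show "sym (g (T, f))" using symD[OF r'(2)] by (auto simp: sym_def cases)
        show "r2 x < Suc l" if "x \<in> {0..<k}" for x using r'(3)[of x] by (auto simp: r2_def)
        show "case e of (x, y) \<Rightarrow> r2 x \<noteq> r2 y" if "e \<in> g (T, f)" for e
        proof -
          obtain x y where e: "e = (x, y)" by (cases e)
          have "r2 x \<noteq> r2 y"
            using that[unfolded e cases] Tin[of x y] r'(4)[of x y] f'[of x] f'[of y] r'(3)[of x] r'(3)[of y]
            by (auto simp: r2_def)
          then show ?thesis by (simp add: e)
        qed
        fix x y z assume a: "(x, y) \<in> g (T, f) \<and> (x, z) \<in> g (T, f) \<and> r2 y < r2 x \<and> r2 z < r2 x"
        show "y = z"
        proof (cases "x < s")
          case True
          have down: "(x, y) \<in> T \<and> r y < r x" if "(x, y) \<in> g (T, f)" "r2 y < r2 x" for y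
            using that True r'(3)[of x] Tin[of x y] unfolding cases r2_def by (auto split: if_splits)
          show ?thesis using down[of y] down[of z] a r'(5) by blast
        next
          case False
          have "y = f x" if "(x, y) \<in> g (T, f)" "r2 y < r2 x" for y
            using that False f'[of y] Tin[of x y] unfolding cases by auto
          then show ?thesis using a by blast
        qed
      qed
      then show "g (T, f) \<in> forests (Suc l) k" by (auto simp: forests_def)
    qed
    show "finite (forests (Suc l) k)" by (rule finite_forests)
  qed
  then show ?thesis by (simp add: card_cartesian_product cP)
qed

lemma forests_one: "1 \<le> card (forests 1 k)"
proof -
  have "{} \<in> forests 1 k" by (auto simp: forests_def ranked_def intro!: exI[of _ "\<lambda>_. 0"])
  then have "0 < card (forests 1 k)" using finite_forests card_gt_0_iff by blast
  then show ?thesis by simp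
qed


section \<open>Maximum degree of random graphs\<close>

lemma minor_complete_on:
  assumes "pair_graph H"
  shows "minor H (complete_on (card (pverts H)))"
proof -
  have H: "finite (pverts H)" "parcs H \<subseteq> pverts H \<times> pverts H" "irrefl (parcs H)"
    using assms by (auto simp: pair_graph_iff)
  obtain f where f: "bij_betw f (pverts H) {0..<card (pverts H)}"
    using ex_bij_betw_finite_nat[OF H(1)] by blast
  show ?thesis
  proof (rule minor_embed[of _ f])
    show "pair_graph (complete_on (card (pverts H)))"
      by (auto simp: pair_graph_iff complete_on_def sym_def irrefl_def)
    show "inj_on f (pverts H)" using f by (simp add: bij_betw_def)
    show "f ` pverts H \<subseteq> pverts (complete_on (card (pverts H)))" using f by (simp add: bij_betw_def complete_on_def)
    fix u v assume uv: "(u, v) \<in> parcs H"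
    then have V: "u \<in> pverts H" "v \<in> pverts H" "u \<noteq> v" using H by (auto simp: irrefl_def)
    then have "f u \<noteq> f v" using f by (auto simp: bij_betw_def dest: inj_onD)
    moreover have "f u < card (pverts H)" "f v < card (pverts H)"
      using bij_betwE[OF f] V by auto
    ultimately show "(f u, f v) \<in> parcs (complete_on (card (pverts H)))" by (simp add: complete_on_def)
  qed
qed

text \<open>2-connectedness enters through \<open>minor_glue_cone\<close>. Any single excluded graph
  bounds the complete minors; the head of the list is taken.\<close>

lemma glueable_excluded_minors:
  assumes "Hs \<noteq> []" and pg: "\<And>H. H \<in> set Hs \<Longrightarrow> pair_graph H"
    and k2: "\<And>H. H \<in> set Hs \<Longrightarrow> k_connected 2 H"
  shows "glueable_class (excluded_minors Hs) (card (pverts (hd Hs)))"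
proof -
  let ?X = "excluded_minors Hs"
  have hd: "hd Hs \<in> set Hs" using assms(1) by simp
  have EX: "G \<in> ?X \<longleftrightarrow> pair_graph G \<and> (\<forall>H\<in>set Hs. \<not> minor H G)" for G
    by (simp add: excluded_minors_def)
  have 1: "pair_graph G" if "G \<in> ?X" for G using that by (simp add: EX)
  have 2: "G' \<in> ?X" if G: "G \<in> ?X" "pair_graph G'" "minor G' G" for G G'
  proof -
    have "\<not> minor H G'" if "H \<in> set Hs" for H
      using minor_trans[OF _ G(3,2) 1[OF G(1)], of H] G(1) that unfolding EX by blast
    then show ?thesis using G(2) unfolding EX by blast
  qed
  have 3: "\<not> minor (complete_on (card (pverts (hd Hs)))) G" if G: "G \<in> ?X" for G
  proof
    assume m: "minor (complete_on (card (pverts (hd Hs)))) G"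
    have "pair_graph (complete_on (card (pverts (hd Hs))))"
      by (auto simp: pair_graph_iff complete_on_def sym_def irrefl_def)
    from minor_trans[OF minor_complete_on[OF pg[OF hd]] m this 1[OF G]]
    show False using G hd unfolding EX by blast
  qed
  have 4: "glue_cone G v S T \<in> ?X" if G: "G \<in> ?X" and v: "v \<in> pverts G" and S: "S \<inter> pverts G = {}"
    and T: "T \<subseteq> S \<times> S" and c: "cone v S T \<in> ?X" for G v S T
  proof -
    have "\<not> minor H (glue_cone G v S T)" if H: "H \<in> set Hs" for H
      using minor_glue_cone[OF 1[OF G] pg[OF H] k2[OF H] v S T 1[OF c]] G c H unfolding EX by blast
    then show ?thesis
      using pair_graph_glue_cone[OF 1[OF G] 1[OF c] v] unfolding EX by blast
  qed
  show ?thesis by (intro glueable_class.intro small_class.intro glueable_class_axioms.intro) (rule 1 2 3 4; assumption)+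
qed

text \<open>Provides a graph of every size in the class, so that the uniform distribution is
  meaningful.\<close>

lemma edgeless_in_excluded_minors:
  assumes pg: "\<And>H. H \<in> set Hs \<Longrightarrow> pair_graph H" and k2: "\<And>H. H \<in> set Hs \<Longrightarrow> k_connected 2 H"
  shows "\<lparr>pverts = {1..n}, parcs = {}\<rparr> \<in> excluded_minors Hs"
proof -
  let ?G = "\<lparr>pverts = {1..n}, parcs = {}\<rparr> :: nat pair_pre_digraph"
  have G: "pair_graph ?G" by (auto simp: pair_graph_iff sym_def irrefl_def)
  have "\<not> minor H ?G" if H: "H \<in> set Hs" for H
  proof
    assume m: "minor H ?G"
    have e: "(u, v) \<notin> parcs H" for u v
      by (rule minorE[OF m G]) auto
    have c: "2 < card (pverts H)" using k2[OF H] by (simp add: k_connected_def)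
    then have "pverts H \<noteq> {}" by auto
    then obtain a where a: "a \<in> pverts H" by blast
    have "pverts H \<noteq> {a}" using c by auto
    then obtain b where "b \<in> pverts H" "a \<noteq> b" using a by blast
    moreover note a
    moreover have "conn (parcs H) (pverts H - {})"
      using k2[OF H] pg[OF H] unfolding k_connected_def by (auto simp: induces_connected_iff)
    ultimately show False using connD[of "parcs H" "pverts H" "{a}" a b] e by auto
  qed
  then show ?thesis using G by (simp add: excluded_minors_def)
qed

section \<open>From counting to probabilities\<close>

context glueable_class
begin

definition cone_families :: "(nat \<Rightarrow> nat) \<Rightarrow> (nat \<Rightarrow> real) \<Rightarrow> bool" where
  "cone_families k \<tau> \<longleftrightarrow> (\<forall>\<^sub>F n in sequentially. 1 \<le> k n \<and> 0 < \<tau> n \<and>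
     (\<exists>F. (\<forall>T\<in>F. T \<subseteq> {0..<k n} \<times> {0..<k n} \<and> cone (k n) {0..<k n} T \<in> \<G>) \<and> \<tau> n \<le> real (card F)))"

text \<open>Graphs of maximum degree below \<open>f n\<close> lie in
  \<open>small_deg {1..n} (k n)\<close>, whose share of the class is at most the quotient in the
  limit, by \<open>small_deg_bound\<close>. \<open>M\<close> is obtained before \<open>f\<close>,
  \<open>k\<close> and \<open>\<tau>\<close>, so they may depend on it.\<close>

lemma whp_criterion:
  assumes ne: "\<And>n. 0 < num n"
  obtains M :: real where "1 \<le> M"
    and "\<And>f k \<tau>. \<lbrakk>cone_families k \<tau>; \<forall>\<^sub>F n in sequentially. f n \<le> real (k n);
      (\<lambda>n. M ^ k n * fact (k n) / (real n * \<tau> n)) \<longlonglongrightarrow> 0\<rbrakk> \<Longrightarrow> max_degree_ge_whp \<G> f"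
proof -
  from small_deg_bound obtain M :: nat where M: "1 \<le> M" "\<forall>n\<ge>3. \<forall>k\<ge>1. \<forall>F.
      (\<forall>T\<in>F. T \<subseteq> {0..<k} \<times> {0..<k} \<and> cone k {0..<k} T \<in> \<G>) \<longrightarrow>
      card (small_deg {1..n} k) * (n * card F) \<le> M ^ k * fact k * num n"
    by (elim exE conjE) (rule that)
  have whp: "max_degree_ge_whp \<G> f"
    if fam: "cone_families k \<tau>" and ev: "\<forall>\<^sub>F n in sequentially. f n \<le> real (k n)"
    and lim: "(\<lambda>n. real M ^ k n * fact (k n) / (real n * \<tau> n)) \<longlonglongrightarrow> 0" for f \<tau> :: "nat \<Rightarrow> real" and k
  proof -
    define P where "P = (\<lambda>n. measure_pmf.prob (pmf_of_set (of_size \<G> n)) {G. f n \<le> real (max_degree G)})"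
    let ?b = "\<lambda>n. real M ^ k n * fact (k n) / (real n * \<tau> n)"
    have lower: "\<forall>\<^sub>F n in sequentially. 1 - ?b n \<le> P n"
      using fam[unfolded cone_families_def] ev eventually_ge_at_top[of 3]
    proof eventually_elim
      case (elim n)
      then obtain F where F: "\<forall>T\<in>F. T \<subseteq> {0..<k n} \<times> {0..<k n} \<and> cone (k n) {0..<k n} T \<in> \<G>" "\<tau> n \<le> real (card F)"
        by blast
      define A where "A = cls {1..n}"
      define Q where "Q = {G :: nat pair_pre_digraph. f n \<le> real (max_degree G)}"
      have oA: "of_size \<G> n = A" by (simp add: of_size_def A_def cls_def)
      have fA: "finite A" by (simp add: A_def finite_cls)
      have cA: "card A = num n" by (simp add: A_def num_def)
      have A0: "A \<noteq> {}" using ne[of n] cA by auto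
      have "A - Q \<subseteq> small_deg {1..n} (k n)"
      proof
        fix G assume G: "G \<in> A - Q"
        then have pg: "pair_graph G" "pverts G = {1..n}" using clsD[of G "{1..n}"] by (auto simp: A_def)
        have "deg G v < k n" if v: "v \<in> pverts G" for v
        proof -
          have "deg G v \<le> max_degree G"
            unfolding max_degree_def deg_def out_degree_eq[symmetric]
            by (rule Max_ge) (use v pg in auto)
          moreover have "real (max_degree G) < f n" using G by (simp add: Q_def)
          ultimately show ?thesis using elim by linarith
        qed
        then show "G \<in> small_deg {1..n} (k n)" using G by (simp add: small_deg_def A_def)
      qed
      then have "card (A - Q) \<le> card (small_deg {1..n} (k n))"
        by (intro card_mono finite_small_deg) auto
      then have "card (A - Q) * (n * card F) \<le> M ^ k n * fact (k n) * num n"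
        using M(2)[rule_format, of n "k n" F] elim F(1) by (meson le_trans mult_le_mono1)
      then have "real (card (A - Q)) * (real n * real (card F)) \<le> real M ^ k n * fact (k n) * real (num n)"
        by (metis (mono_tags, lifting) of_nat_fact of_nat_le_iff of_nat_mult of_nat_power)
      moreover have "real (card (A - Q)) * (real n * \<tau> n) \<le> real (card (A - Q)) * (real n * real (card F))"
        using F(2) by (intro mult_left_mono) auto
      ultimately have "real (card (A - Q)) * (real n * \<tau> n) \<le> real M ^ k n * fact (k n) * real (num n)" by linarith
      then have b: "real (card (A - Q)) / real (num n) \<le> ?b n"
        using ne[of n] elim by (simp add: field_simps)
      have "P n = real (card (A \<inter> Q)) / real (num n)"
        unfolding P_def oA Q_def[symmetric] using measure_pmf_of_set[OF A0 fA, of Q] cA by simp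
      also have "card (A \<inter> Q) = card A - card (A - Q)"
        using fA by (metis card_Diff_subset Diff_subset double_diff finite_Diff Diff_Diff_Int)
      also have "real (card A - card (A - Q)) = real (num n) - real (card (A - Q))"
        using cA card_mono[OF fA, of "A - Q"] by (simp add: of_nat_diff)
      finally have "P n = 1 - real (card (A - Q)) / real (num n)" using ne[of n] by (simp add: field_simps)
      then show ?case using b by simp
    qed
    have upper: "\<forall>\<^sub>F n in sequentially. P n \<le> 1" by (intro always_eventually) (simp add: P_def)
    have "(\<lambda>n. 1 - ?b n) \<longlonglongrightarrow> 1 - 0" by (intro tendsto_diff tendsto_const lim)
    then have "P \<longlonglongrightarrow> 1" by (intro tendsto_sandwich[OF lower upper _ tendsto_const]) simp
    then show ?thesis unfolding max_degree_ge_whp_def whp_def P_def .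
  qed
  show thesis by (rule that[of "real M"]) (use M(1) whp in auto)
qed

end

section \<open>Iterated logarithms and the number of forests\<close>

lemma filterlim_funpow_ln: "filterlim ((ln :: real \<Rightarrow> real) ^^ l) at_top at_top"
proof (induction l)
  case 0
  show ?case by (simp add: filterlim_ident id_def)
next
  case (Suc l)
  show ?case using filterlim_compose[OF ln_at_top Suc] by (simp add: comp_def)
qed

text \<open>The inner logarithms have to be positive for this argument, hence only large
  \<open>x\<close>. The quantifier over \<open>y\<close> is inside, since both arguments vary in the
  applications.\<close>

lemma eventually_funpow_ln_mono:
  "\<forall>\<^sub>F x in at_top. \<forall>y\<ge>x. ((ln :: real \<Rightarrow> real) ^^ l) x \<le> (ln ^^ l) y"
proof (induction l)
  case (Suc l)
  have "\<forall>\<^sub>F x in at_top. 0 < ((ln :: real \<Rightarrow> real) ^^ l) x"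
    using filterlim_funpow_ln[of l] by (simp add: filterlim_at_top_dense)
  with Suc show ?case
    by eventually_elim (auto intro!: ln_mono elim: less_le_trans)
qed simp

lemma eventually_funpow_ln_le:
  assumes "1 \<le> l" "0 < \<delta>"
  shows "\<forall>\<^sub>F x in at_top. ((ln :: real \<Rightarrow> real) ^^ l) x \<le> \<delta> * x"
  using assms(1)
proof (induction l rule: dec_induct)
  case base
  have "((\<lambda>x::real. ln x / x) \<longlongrightarrow> 0) at_top" by (rule ln_x_over_x_tendsto_0)
  then have "\<forall>\<^sub>F x::real in at_top. ln x / x < \<delta>" using assms(2) by (rule order_tendstoD)
  with eventually_gt_at_top[of 0] show ?case
    by eventually_elim (simp add: field_simps)
next
  case (step l)
  have "\<forall>\<^sub>F x in at_top. 0 < ((ln :: real \<Rightarrow> real) ^^ l) x"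
    using filterlim_funpow_ln[of l] by (simp add: filterlim_at_top_dense)
  with step.IH show ?case
  proof eventually_elim
    case (elim x)
    have "ln ((ln ^^ l) x) \<le> (ln ^^ l) x" using ln_le_minus_one[OF elim(2)] by simp
    then show ?case using elim(1) by simp
  qed
qed

lemma filterlim_div_funpow_ln:
  assumes "1 \<le> l"
  shows "filterlim (\<lambda>x::real. x / (ln ^^ l) x) at_top at_top"
proof (subst filterlim_at_top_gt[of _ _ 0], intro allI impI)
  fix Z :: real assume Z: "0 < Z"
  have "\<forall>\<^sub>F x in at_top. 0 < ((ln :: real \<Rightarrow> real) ^^ l) x"
    using filterlim_funpow_ln[of l] by (simp add: filterlim_at_top_dense)
  moreover have "\<forall>\<^sub>F x in at_top. ((ln :: real \<Rightarrow> real) ^^ l) x \<le> 1 / Z * x"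
    by (rule eventually_funpow_ln_le[OF assms]) (use Z in simp)
  ultimately show "\<forall>\<^sub>F x in at_top. Z \<le> x / ((ln :: real \<Rightarrow> real) ^^ l) x"
    by eventually_elim (use Z in \<open>simp add: field_simps\<close>)
qed

text \<open>In the induction step the last level chooses its parents among \<open>s = k / (ln ^^ l) k\<close> vertices;
  the forest on these \<open>s\<close> vertices then only costs a factor exponential in \<open>k\<close>.\<close>

lemma forests_count:
  assumes "1 \<le> l"
  shows "\<exists>C\<ge>0. \<forall>\<^sub>F k in sequentially.
    real k ^ k \<le> real (card (forests l k)) * exp (real k * ((ln ^^ l) (real k) + C))"
  using assms
proof (induction l rule: dec_induct)
  case base
  \<comment> \<open>With one level a single forest is counted, and the exponential factor alone is
    \<open>k ^ k\<close>.\<close>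
  have "real k ^ k \<le> real (card (forests 1 k)) * exp (real k * ((ln ^^ 1) (real k) + 0))" if "1 \<le> k" for k
  proof -
    have "real k ^ k = exp (real k * ln (real k))" using that by (simp add: exp_of_nat_mult)
    also have "\<dots> \<le> real (card (forests 1 k)) * exp (real k * ln (real k))"
      using forests_one[of k] by simp
    finally show ?thesis by simp
  qed
  then have "\<forall>\<^sub>F k in sequentially. real k ^ k \<le> real (card (forests 1 k)) * exp (real k * ((ln ^^ 1) (real k) + 0))"
    by (intro eventually_sequentiallyI[of 1])
  then show ?case by blast
next
  case (step l)
  then obtain C where C: "0 \<le> C" "\<forall>\<^sub>F k in sequentially.
    real k ^ k \<le> real (card (forests l k)) * exp (real k * ((ln ^^ l) (real k) + C))" by blast
  let ?Y = "\<lambda>k. (ln ^^ l) (real k)"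
  define s where "s = (\<lambda>k. nat \<lceil>real k / ?Y k\<rceil>)"
  have Yk: "filterlim ?Y at_top sequentially"
    by (rule filterlim_compose[OF filterlim_funpow_ln filterlim_real_sequentially])
  have "filterlim (\<lambda>k. real k / ?Y k) at_top sequentially"
    by (rule filterlim_compose[OF filterlim_div_funpow_ln[OF step.hyps(1)] filterlim_real_sequentially])
  then have "filterlim (\<lambda>k. real (s k)) at_top sequentially"
    by (rule filterlim_at_top_mono) (simp add: s_def real_nat_ceiling_ge)
  then have sr: "filterlim (\<lambda>k. real (s k)) at_top sequentially" .
  have s: "filterlim s at_top sequentially"
    using sr by (simp add: filterlim_sequentially_iff_filterlim_real)
  have "\<forall>\<^sub>F k in sequentially. real (s k) ^ s k \<le> real (card (forests l (s k))) * exp (real (s k) * ((ln ^^ l) (real (s k)) + C))"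
    using eventually_compose_filterlim[OF C(2) s] .
  moreover have "\<forall>\<^sub>F k in sequentially. \<forall>y\<ge>real (s k). (ln ^^ l) (real (s k)) \<le> (ln ^^ l) y"
    using eventually_compose_filterlim[OF eventually_funpow_ln_mono sr] .
  moreover have "\<forall>\<^sub>F k in sequentially. 1 \<le> ?Y k"
    using Yk by (simp add: filterlim_at_top)
  moreover have "\<forall>\<^sub>F k in sequentially. ?Y k \<le> 1 * real k"
    using eventually_compose_filterlim[OF eventually_funpow_ln_le[OF step.hyps(1), of 1] filterlim_real_sequentially] by simp
  moreover have "\<forall>\<^sub>F k in sequentially. (1::nat) \<le> k" by (rule eventually_ge_at_top)
  ultimately have "\<forall>\<^sub>F k in sequentially.
    real k ^ k \<le> real (card (forests (Suc l) k)) * exp (real k * ((ln ^^ Suc l) (real k) + (C + 2)))"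
  proof eventually_elim
    case (elim k)
    let ?s = "s k" and ?y = "?Y k"
    have y: "1 \<le> ?y" "?y \<le> real k" using elim by auto
    have sx: "real k / ?y \<le> real ?s" by (simp add: s_def real_nat_ceiling_ge)
    have k0: "0 < real k" using elim by simp
    have s0: "0 < real ?s" using sx y k0 by (meson divide_pos_pos less_le_trans zero_less_one)
    have "real k / ?y \<le> real k" using y k0 by (simp add: field_simps)
    then have "\<lceil>real k / ?y\<rceil> \<le> int k" by (simp add: ceiling_le_iff)
    then have sk: "?s \<le> k" by (simp only: s_def nat_le_iff)
    have "0 \<le> real k / ?y" using y k0 by simp
    then have s1: "real ?s \<le> real k / ?y + 1" unfolding s_def using ceiling_correct[of "real k / ?y"] by linarith
    have ly: "(ln ^^ l) (real ?s) \<le> ?y" using elim(2) sk by simp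
    have "real ?s * ?y \<le> (real k / ?y + 1) * ?y" using s1 y by (intro mult_right_mono) auto
    also have "\<dots> = real k + ?y" using y by (simp add: field_simps)
    finally have sy: "real ?s * ?y \<le> 2 * real k" using y by simp
    \<comment> \<open>The induction hypothesis at \<open>s\<close> costs only a factor exponential
      in \<open>k\<close>, as \<open>s * ?y\<close> is at most \<open>2 * k\<close>; rounding
      \<open>s\<close> up adds at most \<open>?y \<le> k\<close>.\<close>
    have e: "real ?s * ((ln ^^ l) (real ?s) + C) \<le> real k * (C + 2)"
    proof -
      have "real ?s * ((ln ^^ l) (real ?s) + C) \<le> real ?s * (?y + C)" using ly by (intro mult_left_mono) auto
      also have "\<dots> \<le> 2 * real k + real k * C"
        using sy mult_right_mono[of "real ?s" "real k" C] sk C(1) by (simp add: algebra_simps)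
      finally show ?thesis by (simp add: algebra_simps)
    qed
    have ks: "(real k / real ?s) ^ k \<le> exp (real k * (ln ^^ Suc l) (real k))"
    proof -
      have "real k / real ?s \<le> ?y" using sx y s0 by (simp add: field_simps)
      then have "(real k / real ?s) ^ k \<le> ?y ^ k" using s0 by (intro power_mono) auto
      also have "\<dots> = exp (real k * ln ?y)" using y by (simp add: exp_of_nat_mult)
      finally show ?thesis by simp
    qed
    \<comment> \<open>\<open>s ^ s\<close> is traded for forests by the induction hypothesis,
      \<open>s ^ (k - s)\<close> counts the attachments, and \<open>(k / s) ^ k\<close> is at most
      \<open>?y ^ k\<close>, which brings in the next logarithm.\<close>
    have "real k ^ k = (real k / real ?s) ^ k * (real ?s ^ ?s * real ?s ^ (k - ?s))"
      using s0 sk by (simp add: power_divide flip: power_add)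
    also have "\<dots> \<le> exp (real k * (ln ^^ Suc l) (real k)) *
        ((real (card (forests l ?s)) * exp (real k * (C + 2))) * real ?s ^ (k - ?s))"
    proof (intro mult_mono ks order_refl)
      show "real ?s ^ ?s \<le> real (card (forests l ?s)) * exp (real k * (C + 2))"
        using elim(1) e by (meson exp_le_cancel_iff mult_left_mono of_nat_0_le_iff order_trans)
    qed auto
    also have "\<dots> = (real (card (forests l ?s)) * real ?s ^ (k - ?s)) * exp (real k * ((ln ^^ Suc l) (real k) + (C + 2)))"
      by (simp add: distrib_left exp_add)
    also have "real (card (forests l ?s)) * real ?s ^ (k - ?s) \<le> real (card (forests (Suc l) k))"
      using forests_Suc[OF sk, of l] by (metis of_nat_le_iff of_nat_mult of_nat_power)
    finally show ?case by simp
  qed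
  moreover have "0 \<le> C + 2" using C(1) by simp
  ultimately show ?case by blast
qed

text \<open>For \<open>z = ln n\<close> the error to be controlled is
  \<open>exp (k * (log^(l) z + C) - z)\<close>, and this makes it at most \<open>n\<close> to the
  power \<open>- \<epsilon> / 2\<close>. \<open>k\<close> is real, and the summand \<open>1\<close>
  allows for rounding up. Of the gain \<open>\<epsilon> * z\<close> each of three error terms takes
  an eighth. The part \<open>k \<le> z\<close> later replaces iterated logarithms of
  \<open>k\<close> by those of \<open>z\<close>.\<close>

lemma exponent_bound:
  assumes "1 \<le> l" "0 < \<epsilon>" "\<epsilon> < 1" "0 \<le> C"
  shows "\<forall>\<^sub>F z::real in at_top. \<forall>k. 0 \<le> k \<and> k \<le> (1 - \<epsilon>) * (z / (ln ^^ l) z) + 1 \<longrightarrow>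
    k * ((ln ^^ l) z + C) - z \<le> - (\<epsilon> / 2) * z \<and> k \<le> z"
proof -
  have "\<forall>\<^sub>F z in at_top. max 1 (8 * C / \<epsilon>) \<le> ((ln :: real \<Rightarrow> real) ^^ l) z"
    using filterlim_funpow_ln[of l] by (simp only: filterlim_at_top)
  moreover have "\<forall>\<^sub>F z in at_top. ((ln :: real \<Rightarrow> real) ^^ l) z \<le> \<epsilon> / 8 * z"
    by (rule eventually_funpow_ln_le[OF assms(1)]) (use assms in simp)
  moreover have "\<forall>\<^sub>F z in at_top. max (1 / \<epsilon>) (8 * C / \<epsilon>) \<le> (z::real)" by (rule eventually_ge_at_top)
  ultimately show ?thesis
  proof eventually_elim
    case (elim z)
    let ?y = "(ln ^^ l) z"
    have y: "1 \<le> ?y" "8 * C \<le> \<epsilon> * ?y" using elim(1) assms(2) by (auto simp: field_simps)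
    have z: "1 \<le> \<epsilon> * z" "8 * C \<le> \<epsilon> * z" using elim(3) assms(2) by (auto simp: field_simps)
    have z0: "0 < z" using z(1) assms(2) by (metis less_le_trans zero_less_mult_pos zero_less_one)
    show ?case
    proof (intro allI impI)
      fix k assume k: "0 \<le> k \<and> k \<le> (1 - \<epsilon>) * (z / ?y) + 1"
      have a: "C * (z / ?y) \<le> \<epsilon> * z / 8" using y z0 by (simp add: field_simps mult_left_mono)
      have b: "(1 - \<epsilon>) * (C * (z / ?y)) \<le> 1 * (C * (z / ?y))"
        using assms y z0 by (intro mult_right_mono) auto
      have 1: "(1 - \<epsilon>) * (C * (z / ?y)) \<le> \<epsilon> * z / 8" by (rule order_trans[OF b[unfolded mult_1] a])
      have "k * (?y + C) \<le> ((1 - \<epsilon>) * (z / ?y) + 1) * (?y + C)"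
        using k y assms(4) by (intro mult_right_mono) auto
      also have "\<dots> = (z - \<epsilon> * z) + (1 - \<epsilon>) * (C * (z / ?y)) + ?y + C"
        using y by (simp add: field_simps)
      also have "\<dots> \<le> (z - \<epsilon> * z) + \<epsilon> * z / 8 + \<epsilon> * z / 8 + \<epsilon> * z / 8"
        by (intro add_mono order_refl 1) (use elim(2) z(2) in simp_all)
      finally have "k * (?y + C) - z \<le> - (\<epsilon> / 2) * z"
        using z(1) by simp
      moreover have "(1 - \<epsilon>) * (z / ?y) \<le> (1 - \<epsilon>) * z"
        using assms(3) y z0 by (intro mult_left_mono) (auto simp: field_simps)
      then have "k \<le> z" using k z(1) by (simp add: algebra_simps)
      ultimately show "k * (?y + C) - z \<le> - (\<epsilon> / 2) * z \<and> k \<le> z" by blast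
    qed
  qed
qed

lemma exp_neg_ln_tendsto_0:
  assumes "0 < \<delta>"
  shows "(\<lambda>n. exp (- \<delta> * ln (real n))) \<longlonglongrightarrow> 0"
proof -
  have "filterlim (\<lambda>n. ln (real n)) at_top sequentially"
    by (rule filterlim_compose[OF ln_at_top filterlim_real_sequentially])
  then have "filterlim (\<lambda>n. \<delta> * ln (real n)) at_top sequentially"
    using assms by (intro filterlim_tendsto_pos_mult_at_top[OF tendsto_const])
  then have "filterlim (\<lambda>n. - (\<delta> * ln (real n))) at_bot sequentially"
    by (simp add: filterlim_uminus_at_top)
  from filterlim_compose[OF exp_at_bot this] show ?thesis by simp
qed

lemma fact_le_self_power: "fact k \<le> real k ^ k"
proof -
  have "(fact k :: nat) \<le> k ^ k" using fact_le_power[of k, where ?'a = nat] by simp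
  then have "real (fact k) \<le> real (k ^ k)" by (rule of_nat_mono)
  then show ?thesis by simp
qed

section \<open>The limits for paths, forests and matchings\<close>

context glueable_class
begin

text \<open>With \<open>(k - 1)!\<close> bases the quotient is \<open>M ^ k * k / n\<close>, at most
  \<open>(2 * M) ^ k / n\<close>. The choice of \<open>c\<close> keeps \<open>(2 * M) ^ k\<close> at
  most \<open>2 * M * sqrt n\<close>, where the factor \<open>2 * M\<close> pays for rounding
  \<open>k\<close> up.\<close>

lemma whp_fans:
  assumes ne: "\<And>n. 0 < num n"
    and fan: "\<And>G k. \<lbrakk>pair_graph G; minor G (fan (k + 1)); 1 \<le> k\<rbrakk> \<Longrightarrow> G \<in> \<G>"
  shows "\<exists>c>0. max_degree_ge_whp \<G> (\<lambda>n. c * ln (real n))"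
proof -
  obtain M :: real where M: "1 \<le> M" and crit: "\<And>f k \<tau>. \<lbrakk>cone_families k \<tau>;
      \<forall>\<^sub>F n in sequentially. f n \<le> real (k n);
      (\<lambda>n. M ^ k n * fact (k n) / (real n * \<tau> n)) \<longlonglongrightarrow> 0\<rbrakk> \<Longrightarrow> max_degree_ge_whp \<G> f"
    by (rule whp_criterion[OF ne], rule that)
  define c where "c = 1 / (2 * ln (2 * M))"
  have l: "0 < ln (2 * M)" using M by simp
  then have c: "0 < c" by (simp add: c_def)
  define k where "k = (\<lambda>n. nat \<lceil>c * ln (real n)\<rceil>)"
  have kge: "c * ln (real n) \<le> real (k n)" for n by (simp add: k_def real_nat_ceiling_ge)
  have k1: "1 \<le> k n" "real (k n) \<le> c * ln (real n) + 1" if "2 \<le> n" for n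
  proof -
    have "0 < c * ln (real n)" using that c by simp
    then show "1 \<le> k n" "real (k n) \<le> c * ln (real n) + 1" unfolding k_def by linarith+
  qed
  have "max_degree_ge_whp \<G> (\<lambda>n. c * ln (real n))"
  proof (rule crit[where k = k and \<tau> = "\<lambda>n. fact (k n - 1)"])
    show "\<forall>\<^sub>F n in sequentially. c * ln (real n) \<le> real (k n)" using kge by simp
    show "cone_families k (\<lambda>n. fact (k n - 1))"
      unfolding cone_families_def
    proof (rule eventually_sequentiallyI[of 2])
      fix n :: nat assume n: "2 \<le> n"
      let ?F = "path_arcs (k n) ` {p. p permutes {1..<k n}}"
      note F = path_family[OF k1(1)[OF n]]
      have F1: "\<forall>T\<in>?F. T \<subseteq> {0..<k n} \<times> {0..<k n} \<and> cone (k n) {0..<k n} T \<in> \<G>"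
        using F(2) fan[OF _ _ k1(1)[OF n]] by blast
      have F2: "fact (k n - 1) \<le> real (card ?F)" unfolding F(1) by simp
      show "1 \<le> k n \<and> (0::real) < fact (k n - 1) \<and>
       (\<exists>F. (\<forall>T\<in>F. T \<subseteq> {0..<k n} \<times> {0..<k n} \<and> cone (k n) {0..<k n} T \<in> \<G>) \<and> fact (k n - 1) \<le> real (card F))"
        by (intro conjI exI[of _ ?F] k1(1)[OF n] fact_gt_zero F1 F2)
    qed
    show "(\<lambda>n. M ^ k n * fact (k n) / (real n * fact (k n - 1))) \<longlonglongrightarrow> 0"
    proof (rule tendsto_sandwich[OF _ _ tendsto_const])
      show "\<forall>\<^sub>F n in sequentially. 0 \<le> M ^ k n * fact (k n) / (real n * fact (k n - 1))"
        using M by (intro always_eventually) auto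
      show "\<forall>\<^sub>F n in sequentially. M ^ k n * fact (k n) / (real n * fact (k n - 1)) \<le> 2 * M * exp (- (1 / 2) * ln (real n))"
      proof (rule eventually_sequentiallyI[of 2])
        fix n :: nat assume n: "2 \<le> n"
        have f: "fact (k n) = real (k n) * fact (k n - 1)" using k1(1)[OF n] by (simp add: fact_reduce)
        have "real (k n) \<le> 2 ^ k n" by (metis less_exp less_imp_le of_nat_le_iff of_nat_numeral of_nat_power)
        then have "M ^ k n * real (k n) \<le> M ^ k n * 2 ^ k n" using M by (intro mult_left_mono) auto
        also have "\<dots> = (2 * M) ^ k n" by (simp add: power_mult_distrib)
        also have "\<dots> = exp (real (k n) * ln (2 * M))" using M by (simp add: exp_of_nat_mult)
        also have "\<dots> \<le> exp ((c * ln (real n) + 1) * ln (2 * M))" using k1(2)[OF n] l by simp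
        also have "(c * ln (real n) + 1) * ln (2 * M) = 1 / 2 * ln (real n) + ln (2 * M)"
          using l by (simp add: c_def field_simps)
        also have "exp (1 / 2 * ln (real n) + ln (2 * M)) = 2 * M * exp (1 / 2 * ln (real n))"
          using M by (simp add: exp_add)
        finally have "M ^ k n * real (k n) / real n \<le> 2 * M * exp (1 / 2 * ln (real n)) / real n"
          using n by (intro divide_right_mono) auto
        also have "\<dots> = 2 * M * (exp (1 / 2 * ln (real n)) / exp (ln (real n)))" using n by simp
        also have "\<dots> = 2 * M * exp (- (1 / 2) * ln (real n))" unfolding exp_diff[symmetric] by simp
        finally show "M ^ k n * fact (k n) / (real n * fact (k n - 1)) \<le> 2 * M * exp (- (1 / 2) * ln (real n))"
          unfolding f by simp
      qed
      show "(\<lambda>n. 2 * M * exp (- (1 / 2) * ln (real n))) \<longlonglongrightarrow> 0"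
        using tendsto_mult[OF tendsto_const exp_neg_ln_tendsto_0[of "1 / 2"], of "2 * M"] by simp
    qed
  qed
  then show ?thesis using c by blast
qed

text \<open>As \<open>k!\<close> is at most \<open>k ^ k\<close>, \<open>forests_count\<close>
  bounds the quotient by \<open>exp (k * (log^(l) k + C + ln M)) / n\<close>, and
  \<open>exponent_bound\<close> applies because \<open>log^(l) k\<close> is at most
  \<open>log^(l) (ln n)\<close>.\<close>

lemma whp_forests:
  assumes ne: "\<And>n. 0 < num n" and l: "1 \<le> l"
    and cyc: "\<And>G. \<lbrakk>pair_graph G; \<not> minor (cycle_graph (2 * l + 1)) G\<rbrakk> \<Longrightarrow> G \<in> \<G>"
    and \<epsilon>: "0 < \<epsilon>"
  shows "max_degree_ge_whp \<G> (\<lambda>n. (1 - \<epsilon>) * (ln (real n) / (ln ^^ (l + 1)) (real n)))"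
proof -
  obtain M :: real where M: "1 \<le> M" and crit: "\<And>f k \<tau>. \<lbrakk>cone_families k \<tau>;
      \<forall>\<^sub>F n in sequentially. f n \<le> real (k n);
      (\<lambda>n. M ^ k n * fact (k n) / (real n * \<tau> n)) \<longlonglongrightarrow> 0\<rbrakk> \<Longrightarrow> max_degree_ge_whp \<G> f"
    by (rule whp_criterion[OF ne], rule that)
  \<comment> \<open>For \<open>\<epsilon> \<ge> 1\<close> the target is no longer positive; the cap
    \<open>1 / 2\<close> keeps \<open>k\<close> tending to infinity.\<close>
  define \<delta> where "\<delta> = min \<epsilon> (1 / 2)"
  have \<delta>: "0 < \<delta>" "\<delta> < 1" "\<delta> \<le> \<epsilon>" using \<epsilon> by (auto simp: \<delta>_def)
  let ?L = "\<lambda>n. ln (real n)" and ?Y = "\<lambda>n. (ln ^^ l) (ln (real n))"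
  have Y: "(ln ^^ (l + 1)) (real n) = ?Y n" for n by (simp add: funpow_swap1)
  have Lt: "filterlim ?L at_top sequentially"
    by (rule filterlim_compose[OF ln_at_top filterlim_real_sequentially])
  define q where "q = (\<lambda>n. (1 - \<delta>) * (?L n / ?Y n))"
  define k where "k = (\<lambda>n. nat \<lceil>q n\<rceil>)"
  have Lt': "filterlim (\<lambda>n. ?L n / ?Y n) at_top sequentially"
    by (rule filterlim_compose[OF filterlim_div_funpow_ln[OF l] Lt])
  then have ev_div: "\<forall>\<^sub>F n in sequentially. 0 < ?L n / ?Y n" by (simp only: filterlim_at_top_dense)
  from Lt' have qt: "filterlim q at_top sequentially"
    unfolding q_def using \<delta> by (intro filterlim_tendsto_pos_mult_at_top[OF tendsto_const]) auto
  have kq: "q n \<le> real (k n)" for n by (simp add: k_def real_nat_ceiling_ge)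
  have kt: "filterlim (\<lambda>n. real (k n)) at_top sequentially"
    by (rule filterlim_at_top_mono[OF qt]) (simp add: kq)
  then have kn: "filterlim k at_top sequentially" by (simp add: filterlim_sequentially_iff_filterlim_real)
  obtain C where C: "0 \<le> C" "\<forall>\<^sub>F k in sequentially.
    real k ^ k \<le> real (card (forests l k)) * exp (real k * ((ln ^^ l) (real k) + C))"
    using forests_count[OF l] by blast
  have ev_q: "\<forall>\<^sub>F n in sequentially. 0 < q n" using qt by (simp add: filterlim_at_top_dense)
  have ev_count: "\<forall>\<^sub>F n in sequentially. real (k n) ^ k n \<le> real (card (forests l (k n))) * exp (real (k n) * ((ln ^^ l) (real (k n)) + C))"
    using eventually_compose_filterlim[OF C(2) kn] .
  have ev_mono: "\<forall>\<^sub>F n in sequentially. \<forall>y\<ge>real (k n). (ln ^^ l) (real (k n)) \<le> (ln ^^ l) y"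
    using eventually_compose_filterlim[OF eventually_funpow_ln_mono kt] .
  have C': "0 \<le> C + ln M" using C(1) M by simp
  have ev_exp: "\<forall>\<^sub>F n in sequentially. \<forall>k. 0 \<le> k \<and> k \<le> q n + 1 \<longrightarrow>
    k * (?Y n + (C + ln M)) - ?L n \<le> - (\<delta> / 2) * ?L n \<and> k \<le> ?L n"
    using eventually_compose_filterlim[OF exponent_bound[OF l \<delta>(1,2) C'] Lt] unfolding q_def .
  have ev_n: "\<forall>\<^sub>F n in sequentially. (2::nat) \<le> n" by (rule eventually_ge_at_top)
  show ?thesis
  proof (rule crit[where k = k and \<tau> = "\<lambda>n. real (card (forests l (k n)))"])
    show "\<forall>\<^sub>F n in sequentially. (1 - \<epsilon>) * (ln (real n) / (ln ^^ (l + 1)) (real n)) \<le> real (k n)"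
      using ev_div
    proof eventually_elim
      case (elim n)
      then have "(1 - \<epsilon>) * (?L n / ?Y n) \<le> q n"
        unfolding q_def using \<delta>(3) by (intro mult_right_mono) auto
      then show ?case unfolding Y using kq[of n] by linarith
    qed
    show "cone_families k (\<lambda>n. real (card (forests l (k n))))"
      unfolding cone_families_def using ev_q ev_count
    proof eventually_elim
      case (elim n)
      have k0: "0 < real (k n)" using elim(1) kq[of n] by linarith
      have F1: "0 < real (card (forests l (k n)))"
      proof (rule ccontr)
        assume "\<not> ?thesis"
        then have "real (k n) ^ k n \<le> 0" using elim(2) by simp
        then show False using zero_less_power[OF k0, of "k n"] by linarith
      qed
      have F2: "\<forall>T\<in>forests l (k n). T \<subseteq> {0..<k n} \<times> {0..<k n} \<and> cone (k n) {0..<k n} T \<in> \<G>"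
        using forests_cone[OF _ l] cyc by blast
      have "1 \<le> k n" using k0 by simp
      then show ?case by (intro conjI exI[of _ "forests l (k n)"] F1 F2 order_refl)
    qed
    show "(\<lambda>n. M ^ k n * fact (k n) / (real n * real (card (forests l (k n))))) \<longlonglongrightarrow> 0"
    proof (rule tendsto_sandwich[OF _ _ tendsto_const exp_neg_ln_tendsto_0[of "\<delta> / 2"]])
      show "\<forall>\<^sub>F n in sequentially. 0 \<le> M ^ k n * fact (k n) / (real n * real (card (forests l (k n))))"
        using M by (intro always_eventually) auto
      show "\<forall>\<^sub>F n in sequentially. M ^ k n * fact (k n) / (real n * real (card (forests l (k n)))) \<le> exp (- (\<delta> / 2) * ln (real n))"
        using ev_q ev_count ev_mono ev_exp ev_n
      proof eventually_elim
        case (elim n)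
        let ?k = "real (k n)" and ?c = "real (card (forests l (k n)))"
        have kle: "?k \<le> q n + 1" unfolding k_def using elim(1) by linarith
        then have ex: "?k * (?Y n + (C + ln M)) - ?L n \<le> - (\<delta> / 2) * ?L n" and kL: "?k \<le> ?L n"
          using elim(4) by auto
        have k0: "0 < ?k" using elim(1) kq[of n] by linarith
        have c0: "0 < ?c"
        proof (rule ccontr)
          assume "\<not> ?thesis"
          then have "?k ^ k n \<le> 0" using elim(2) by simp
          then show False using zero_less_power[OF k0, of "k n"] by linarith
        qed
        have "(ln ^^ l) ?k \<le> ?Y n" using elim(3) kL by blast
        then have "exp (?k * ((ln ^^ l) ?k + C)) \<le> exp (?k * (?Y n + C))" using k0 by simp
        then have "?k ^ k n \<le> ?c * exp (?k * (?Y n + C))"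
          using elim(2) c0 by (meson mult_left_mono less_imp_le order_trans)
        then have fk: "fact (k n) \<le> ?c * exp (?k * (?Y n + C))" using fact_le_self_power[of "k n"] by linarith
        have Mk: "M ^ k n = exp (?k * ln M)" using M by (simp add: exp_of_nat_mult)
        have "M ^ k n * fact (k n) \<le> exp (?k * ln M) * (?c * exp (?k * (?Y n + C)))"
          unfolding Mk using fk by (intro mult_left_mono) auto
        also have "\<dots> = ?c * exp (?k * (?Y n + (C + ln M)))" by (simp add: algebra_simps exp_add)
        finally have "M ^ k n * fact (k n) / (real n * ?c) \<le> ?c * exp (?k * (?Y n + (C + ln M))) / (real n * ?c)"
          using c0 elim(5) by (intro divide_right_mono) auto
        also have "\<dots> = exp (?k * (?Y n + (C + ln M))) / exp (?L n)" using c0 elim(5) by simp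
        also have "\<dots> = exp (?k * (?Y n + (C + ln M)) - ?L n)" by (simp add: exp_diff)
        also have "\<dots> \<le> exp (- (\<delta> / 2) * ?L n)" using ex by simp
        finally show ?case .
      qed
    qed (use \<delta> in simp)
  qed
qed

text \<open>A base has \<open>2 * j\<close> vertices, but \<open>(2 * j)! / j!\<close> is at most
  \<open>(2 * j) ^ j\<close>: the exponent involves \<open>j\<close> while the degree is
  \<open>2 * j\<close>, whence the constant 2.\<close>

lemma whp_matchings:
  assumes ne: "\<And>n. 0 < num n"
    and cyc: "\<And>G. \<lbrakk>pair_graph G; \<not> minor (cycle_graph 4) G\<rbrakk> \<Longrightarrow> G \<in> \<G>"
    and \<epsilon>: "0 < \<epsilon>"
  shows "max_degree_ge_whp \<G> (\<lambda>n. (2 - \<epsilon>) * (ln (real n) / ln (ln (real n))))"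
proof -
  obtain M :: real where M: "1 \<le> M" and crit: "\<And>f k \<tau>. \<lbrakk>cone_families k \<tau>;
      \<forall>\<^sub>F n in sequentially. f n \<le> real (k n);
      (\<lambda>n. M ^ k n * fact (k n) / (real n * \<tau> n)) \<longlonglongrightarrow> 0\<rbrakk> \<Longrightarrow> max_degree_ge_whp \<G> f"
    by (rule whp_criterion[OF ne], rule that)
  \<comment> \<open>Halved because \<open>2 - \<epsilon>\<close> is compared with
    \<open>2 * (1 - \<delta>)\<close>.\<close>
  define \<delta> where "\<delta> = min (\<epsilon> / 2) (1 / 2)"
  have \<delta>: "0 < \<delta>" "\<delta> < 1" "2 * \<delta> \<le> \<epsilon>" using \<epsilon> by (auto simp: \<delta>_def)
  let ?L = "\<lambda>n. ln (real n)" and ?Y = "\<lambda>n. ln (ln (real n))"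
  have Lt: "filterlim ?L at_top sequentially"
    by (rule filterlim_compose[OF ln_at_top filterlim_real_sequentially])
  define q where "q = (\<lambda>n. (1 - \<delta>) * (?L n / ?Y n))"
  define j where "j = (\<lambda>n. nat \<lceil>q n\<rceil>)"
  have "filterlim (\<lambda>n. ?L n / (ln ^^ 1) (?L n)) at_top sequentially"
    by (rule filterlim_compose[OF filterlim_div_funpow_ln[of 1] Lt]) simp
  then have Lt': "filterlim (\<lambda>n. ?L n / ?Y n) at_top sequentially" by simp
  then have ev_div: "\<forall>\<^sub>F n in sequentially. 0 < ?L n / ?Y n" by (simp only: filterlim_at_top_dense)
  from Lt' have qt: "filterlim q at_top sequentially"
    unfolding q_def using \<delta> by (intro filterlim_tendsto_pos_mult_at_top[OF tendsto_const]) auto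
  have jq: "q n \<le> real (j n)" for n by (simp add: j_def real_nat_ceiling_ge)
  have ev_q: "\<forall>\<^sub>F n in sequentially. 0 < q n" using qt by (simp add: filterlim_at_top_dense)
  \<comment> \<open>Collects the factor \<open>2 ^ j\<close> of \<open>(2 * j) ^ j\<close> and the
    factor \<open>M ^ (2 * j)\<close>.\<close>
  define C where "C = ln 2 + 2 * ln M"
  have C': "0 \<le> C" using M by (simp add: C_def)
  have ev_exp: "\<forall>\<^sub>F n in sequentially. \<forall>k. 0 \<le> k \<and> k \<le> q n + 1 \<longrightarrow>
    k * (?Y n + C) - ?L n \<le> - (\<delta> / 2) * ?L n \<and> k \<le> ?L n"
    using eventually_compose_filterlim[OF exponent_bound[of 1, OF _ \<delta>(1,2) C'] Lt] by (simp add: q_def)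
  have ev_n: "\<forall>\<^sub>F n in sequentially. (3::nat) \<le> n" by (rule eventually_ge_at_top)
  show ?thesis
  proof (rule crit[where k = "\<lambda>n. 2 * j n" and \<tau> = "\<lambda>n. fact (j n)"])
    show "\<forall>\<^sub>F n in sequentially. (2 - \<epsilon>) * (?L n / ?Y n) \<le> real (2 * j n)"
      using ev_div
    proof eventually_elim
      case (elim n)
      then have "(2 - \<epsilon>) * (?L n / ?Y n) \<le> (2 * (1 - \<delta>)) * (?L n / ?Y n)"
        using \<delta>(3) by (intro mult_right_mono) auto
      then have "(2 - \<epsilon>) * (?L n / ?Y n) \<le> 2 * q n" by (simp only: q_def mult.assoc)
      then show ?case using jq[of n] by simp
    qed
    show "cone_families (\<lambda>n. 2 * j n) (\<lambda>n. fact (j n))"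
      unfolding cone_families_def using ev_q
    proof eventually_elim
      case (elim n)
      have j0: "0 < real (j n)" using elim(1) jq[of n] by linarith
      have F1: "\<forall>T\<in>matching_arcs (j n) ` {p. p permutes {0..<j n}}.
          T \<subseteq> {0..<2 * j n} \<times> {0..<2 * j n} \<and> cone (2 * j n) {0..<2 * j n} T \<in> \<G>"
        using matching_family(2) cyc by blast
      have F2: "fact (j n) \<le> real (card (matching_arcs (j n) ` {p. p permutes {0..<j n}}))"
        unfolding matching_family(1) by simp
      have "1 \<le> 2 * j n" using j0 by simp
      then show ?case
        by (intro conjI exI[of _ "matching_arcs (j n) ` {p. p permutes {0..<j n}}"] fact_gt_zero F1 F2)
    qed
    show "(\<lambda>n. M ^ (2 * j n) * fact (2 * j n) / (real n * fact (j n))) \<longlonglongrightarrow> 0"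
    proof (rule tendsto_sandwich[OF _ _ tendsto_const exp_neg_ln_tendsto_0[of "\<delta> / 2"]])
      show "\<forall>\<^sub>F n in sequentially. 0 \<le> M ^ (2 * j n) * fact (2 * j n) / (real n * fact (j n))"
        using M by (intro always_eventually) auto
      show "\<forall>\<^sub>F n in sequentially. M ^ (2 * j n) * fact (2 * j n) / (real n * fact (j n)) \<le> exp (- (\<delta> / 2) * ln (real n))"
        using ev_q ev_exp ev_n
      proof eventually_elim
        case (elim n)
        let ?j = "real (j n)"
        have kle: "?j \<le> q n + 1" unfolding j_def using elim(1) by linarith
        then have ex: "?j * (?Y n + C) - ?L n \<le> - (\<delta> / 2) * ?L n" and jL: "?j \<le> ?L n"
          using elim(2) by auto
        have j0: "0 < ?j" using elim(1) jq[of n] by linarith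
        have "fact (2 * j n) div fact (2 * j n - j n) \<le> (2 * j n) ^ j n"
          by (rule fact_div_fact_le_pow) simp
        moreover have "fact (j n) dvd (fact (2 * j n) :: nat)" by (rule fact_dvd) simp
        ultimately have "fact (2 * j n) \<le> (2 * j n) ^ j n * fact (j n)"
          by (metis (no_types, lifting) add_diff_cancel_right' dvd_div_mult_self mult_2 mult_le_mono1)
        then have "real (fact (2 * j n)) \<le> real ((2 * j n) ^ j n * fact (j n))" by (rule of_nat_mono)
        then have f: "fact (2 * j n) \<le> (2 * ?j) ^ j n * fact (j n)" by simp
        have Mj: "M ^ (2 * j n) = exp (?j * (2 * ln M))"
        proof -
          have "exp (?j * (2 * ln M)) = exp (real (2 * j n) * ln M)" by simp
          also have "\<dots> = M ^ (2 * j n)" unfolding exp_of_nat_mult using M by simp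
          finally show ?thesis by simp
        qed
        have "(2 * ?j) ^ j n = exp (?j * ln (2 * ?j))" unfolding exp_of_nat_mult using j0 by simp
        also have "ln (2 * ?j) = ln 2 + ln ?j" using j0 by (simp add: ln_mult)
        also have "ln ?j \<le> ?Y n" using jL j0 by simp
        finally have p: "(2 * ?j) ^ j n \<le> exp (?j * (ln 2 + ?Y n))" using j0 by simp
        have "M ^ (2 * j n) * fact (2 * j n) \<le> exp (?j * (2 * ln M)) * (exp (?j * (ln 2 + ?Y n)) * fact (j n))"
          unfolding Mj by (intro mult_left_mono order_trans[OF f mult_right_mono[OF p]]) auto
        also have "\<dots> = exp (?j * (?Y n + C)) * fact (j n)"
          by (simp add: C_def algebra_simps exp_add)
        finally have "M ^ (2 * j n) * fact (2 * j n) / (real n * fact (j n)) \<le> exp (?j * (?Y n + C)) * fact (j n) / (real n * fact (j n))"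
          by (intro divide_right_mono) auto
        also have "\<dots> = exp (?j * (?Y n + C)) / exp (?L n)" using elim(3) by simp
        also have "\<dots> = exp (?j * (?Y n + C) - ?L n)" by (simp add: exp_diff)
        also have "\<dots> \<le> exp (- (\<delta> / 2) * ?L n)" using ex by simp
        finally show ?case .
      qed
    qed (use \<delta> in simp)
  qed
qed

end

theorem theorem3:
  fixes Hs :: "'a pair_pre_digraph list"
    and \<G> :: "nat pair_pre_digraph set"
  assumes "Hs \<noteq> []"
    and "\<And>H. H \<in> set Hs \<Longrightarrow> pair_graph H"
    and "\<And>H. H \<in> set Hs \<Longrightarrow> k_connected 2 H"
    and "\<G> = excluded_minors Hs"
  shows
    "((\<forall>H \<in> set Hs. \<forall>n \<ge> 2. \<not> minor H (fan n)) \<longrightarrow>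
        (\<exists>c > 0. max_degree_ge_whp \<G> (\<lambda>n. c * ln (real n)))) \<and>
     ((\<forall>H \<in> set Hs. k_connected 3 H) \<longrightarrow>
        (\<exists>c > 0. max_degree_ge_whp \<G> (\<lambda>n. c * ln (real n)))) \<and>
     ((\<forall>H \<in> set Hs. \<not> outerplanar H) \<longrightarrow>
        (\<exists>c > 0. max_degree_ge_whp \<G> (\<lambda>n. c * ln (real n)))) \<and>
     ((\<forall>H \<in> set Hs. minor (cycle_graph 4) H) \<longrightarrow>
        (\<forall>\<epsilon> > 0. max_degree_ge_whp \<G>
           (\<lambda>n. (2 - \<epsilon>) * (ln (real n) / ln (ln (real n)))))) \<and>
     ((\<forall>H \<in> set Hs. minor (cycle_graph 5) H) \<longrightarrow>
        (\<forall>\<epsilon> > 0. max_degree_ge_whp \<G>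
           (\<lambda>n. (1 - \<epsilon>) * (ln (real n) / ln (ln (ln (real n))))))) \<and>
     (\<forall>l \<ge> 3. (\<forall>H \<in> set Hs. minor (cycle_graph (2 * l + 1)) H) \<longrightarrow>
        (\<exists>c > 0. max_degree_ge_whp \<G>
           (\<lambda>n. c * (ln (real n) / (ln ^^ (l + 1)) (real n))))) \<and>
     (\<forall>H \<in> set Hs. minor (cycle_graph 3) H) \<and>
     (\<exists>c > 0. max_degree_ge_whp \<G> (\<lambda>n. c * (ln (real n) / ln (ln (real n)))))"
proof -
  note pg = assms(2) and k2 = assms(3)
  interpret glueable_class \<G> "card (pverts (hd Hs))"
    unfolding assms(4) by (rule glueable_excluded_minors[OF assms(1,2,3)])
  have ne: "0 < num n" for n
  proof -
    have "\<lparr>pverts = {1..n}, parcs = {}\<rparr> \<in> \<G>"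
      unfolding assms(4) by (rule edgeless_in_excluded_minors[OF pg k2])
    then have "\<lparr>pverts = {1..n}, parcs = {}\<rparr> \<in> cls {1..n}" by (simp add: cls_def)
    then show ?thesis unfolding num_def using finite_cls[of "{1..n}"] by (auto simp: card_gt_0_iff)
  qed
  have mem: "G \<in> \<G>" if "pair_graph G" "\<And>H. H \<in> set Hs \<Longrightarrow> \<not> minor H G" for G
    using that by (simp add: assms(4) excluded_minors_def)
  \<comment> \<open>By transitivity, an excluded graph inside a minor of a fan would itself be a
    minor of that fan.\<close>
  have fans: "\<exists>c>0. max_degree_ge_whp \<G> (\<lambda>n. c * ln (real n))"
    if nf: "\<And>H n. \<lbrakk>H \<in> set Hs; 2 \<le> n\<rbrakk> \<Longrightarrow> \<not> minor H (fan n)"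
  proof (rule whp_fans[OF ne])
    fix G :: "nat pair_pre_digraph" and k :: nat
    assume G: "pair_graph G" "minor G (fan (k + 1))" "1 \<le> k"
    have f: "pair_graph (fan (k + 1))" by (rule pair_graph_fan) (use G(3) in simp)
    show "G \<in> \<G>"
      by (rule mem[OF G(1)]) (use minor_trans[OF _ G(2,1) f] nf[of _ "k + 1"] G(3) in auto)
  qed
  have cycles: "G \<in> \<G>" if "\<And>H. H \<in> set Hs \<Longrightarrow> minor (cycle_graph m) H" "pair_graph G" "\<not> minor (cycle_graph m) G"
    for m and G :: "nat pair_pre_digraph"
  proof (rule mem[OF that(2)])
    fix H assume H: "H \<in> set Hs"
    show "\<not> minor H G" using minor_trans[OF that(1)[OF H] _ pg[OF H] that(2)] that(3) by blast
  qed
  have forests: "max_degree_ge_whp \<G> (\<lambda>n. (1 - \<epsilon>) * (ln (real n) / (ln ^^ (l + 1)) (real n)))"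
    if "\<forall>H\<in>set Hs. minor (cycle_graph (2 * l + 1)) H" "1 \<le> l" "0 < \<epsilon>" for l \<epsilon>
    by (rule whp_forests[OF ne that(2) cycles that(3)]) (use that(1) in auto)
  have c3: "\<forall>H\<in>set Hs. minor (cycle_graph 3) H"
    using two_connected_has_triangle_minor pg k2 by blast
  show ?thesis
  proof (intro conjI impI allI)
    assume "\<forall>H\<in>set Hs. \<forall>n\<ge>2. \<not> minor H (fan n)"
    then show "\<exists>c>0. max_degree_ge_whp \<G> (\<lambda>n. c * ln (real n))" by (intro fans) blast
  next
    assume "\<forall>H\<in>set Hs. k_connected 3 H"
    then show "\<exists>c>0. max_degree_ge_whp \<G> (\<lambda>n. c * ln (real n))"
      using minor_fan_not_3_connected pg by (intro fans) blast
  next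
    assume "\<forall>H\<in>set Hs. \<not> outerplanar H"
    then show "\<exists>c>0. max_degree_ge_whp \<G> (\<lambda>n. c * ln (real n))"
      using minor_fan_outerplanar pg by (intro fans) blast
  next
    fix \<epsilon> :: real assume "\<forall>H\<in>set Hs. minor (cycle_graph 4) H" "0 < \<epsilon>"
    then show "max_degree_ge_whp \<G> (\<lambda>n. (2 - \<epsilon>) * (ln (real n) / ln (ln (real n))))"
      by (intro whp_matchings[OF ne]) (auto intro: cycles)
  next
    fix \<epsilon> :: real assume "\<forall>H\<in>set Hs. minor (cycle_graph 5) H" "0 < \<epsilon>"
    then show "max_degree_ge_whp \<G> (\<lambda>n. (1 - \<epsilon>) * (ln (real n) / ln (ln (ln (real n)))))"
      \<comment> \<open>The 5-cycle is the case \<open>l = 2\<close> of the forest bound.\<close>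
      using forests[of 2 \<epsilon>] by (simp add: numeral_eq_Suc)
  next
    fix l :: nat assume "3 \<le> l" "\<forall>H\<in>set Hs. minor (cycle_graph (2 * l + 1)) H"
    then have "max_degree_ge_whp \<G> (\<lambda>n. (1 - 1 / 2) * (ln (real n) / (ln ^^ (l + 1)) (real n)))"
      by (intro forests) auto
    then show "\<exists>c>0. max_degree_ge_whp \<G> (\<lambda>n. c * (ln (real n) / (ln ^^ (l + 1)) (real n)))"
      by (intro exI[of _ "1 - 1 / 2"]) simp
  next
    show "\<forall>H\<in>set Hs. minor (cycle_graph 3) H" by (rule c3)
    \<comment> \<open>Case \<open>l = 1\<close>: the base has no arcs, so the cone is a
      star.\<close>
    have "max_degree_ge_whp \<G> (\<lambda>n. (1 - 1 / 2) * (ln (real n) / (ln ^^ (1 + 1)) (real n)))"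
      using c3 by (intro forests) (auto simp: numeral_3_eq_3)
    then show "\<exists>c>0. max_degree_ge_whp \<G> (\<lambda>n. c * (ln (real n) / ln (ln (real n))))"
      by (intro exI[of _ "1 - 1 / 2"]) simp
  qed
qed

end
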